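(* Let $(M_1,c_1)$ and $(M_2,c_2)$ be two compact conformal manifolds such that $\dim(M_1\times M_2)\ge 3$, and let $c$ be a conformal product structure on $M:=M_1\times M_2$, with adapted Weyl connection $\nabla$. Assume that $c$ contains an Einstein metric $g$ such that the restriction to $\mathrm{T}M_2$ of the Lee form of $\nabla$ with respect to $g$ is $\nabla$-parallel in the direction of $\mathrm{T}M_1$. Then there exist metrics $h_1\in c_1$ and $h_2\in c_2$ such that $c=[h_1+h_2]$, i.e. the Einstein metric $g$ is conformal to a product metric.
   Context: Manifolds are smooth, connected, without boundary, and the factors have positive dimension. A conformal class on a manifold is an equivalence class of Riemannian metrics for the relation $g\sim g'\iff g'=e^{2f}g$ for some smooth function $f$; $[g]$ denotes the class of $g$; a conformal manifold is a manifold with a conformal class. On $M=M_1\times M_2$ we identify $\mathrm{T}M=\mathrm{T}M_1\oplus\mathrm{T}M_2$ (pull-backs understood), and $h_1+h_2$ denotes the Riemannian product metric $\pi_1^*h_1+\pi_2^*h_2$, where $\pi_i:M\to M_i$ are the projections. Conformal product structure: a conformal class $c$ on $M$ such that both projections $\pi_i:(M,c)\to(M_i,c_i)$ are orthogonal conformal submersions; equivalently, for some (hence any) $g_i\in c_i$ there are smooth functions $f_1,f_2$ on $M$ with $c=[e^{2f_1}g_1+e^{2f_2}g_2]$. Weyl connection on $(M,c)$: a torsion-free linear connection $\nabla$ such that for each $g\in c$ there is a 1-form $\theta^g$ (the Lee form of $\nabla$ with respect to $g$) with $\nabla g=-2\theta^g\otimes g$. For a conformal product structure, the adapted Weyl connection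 is the unique Weyl connection on $(M,c)$ whose holonomy preserves the decomposition $\mathrm{T}M=\mathrm{T}M_1\oplus\mathrm{T}M_2$; for $g=e^{2f_1}g_1+e^{2f_2}g_2\in c$ its Lee form satisfies $\theta^g(X_1)=-X_1(f_2)$ for $X_1\in\mathrm{T}M_1$ and $\theta^g(X_2)=-X_2(f_1)$ for $X_2\in \mathrm{T}M_2$. The restriction of $\theta^g$ to $\mathrm{T}M_2$ is the 1-form $\theta^g_2$ on $M$ that equals $\theta^g$ on $\mathrm{T}M_2$ and vanishes on $\mathrm{T}M_1$. It is $\nabla$-parallel in the direction of $\mathrm{T}M_1$ if $\nabla_{X_1}\theta^g_2=0$ for all $X_1\in\mathrm{T}M_1$. A metric $g$ is Einstein if $\mathrm{Ric}^g=\lambda g$ for a constant $\lambda\in\mathbb{R}$. *)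

theory Defs
  imports "HOL-Analysis.Analysis"
begin

section \<open>Smooth maps between open subsets of Euclidean spaces\<close>

primrec Ck_on :: "nat \<Rightarrow> 'e::real_normed_vector set \<Rightarrow> ('e \<Rightarrow> 'g::real_normed_vector) \<Rightarrow> bool" where
  "Ck_on 0 S f \<longleftrightarrow> continuous_on S f"
| "Ck_on (Suc k) S f \<longleftrightarrow> (\<forall>x\<in>S. f differentiable (at x)) \<and>
     (\<forall>v. Ck_on k S (\<lambda>x. frechet_derivative f (at x) v))"

text \<open>Only meant for open \<open>S\<close>.\<close>
definition smooth_on :: "'e::real_normed_vector set \<Rightarrow> ('e \<Rightarrow> 'g::real_normed_vector) \<Rightarrow> bool" where
  "smooth_on S f \<longleftrightarrow> (\<forall>k. Ck_on k S f)"

section \<open>Smooth manifolds\<close>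

text \<open>A manifold is a whole type \<open>'a\<close> (Hausdorff and second countable by its type classes) with an
  atlas, not necessarily maximal, of charts into the Euclidean space \<open>'e\<close>; its dimension is
  \<open>DIM('e)\<close>, which is positive. A chart is a pair of a domain and a coordinate map; the values of the
  coordinate map outside the domain are irrelevant.\<close>

type_synonym ('a, 'e) chart = "'a set \<times> ('a \<Rightarrow> 'e)"

abbreviation dom_of :: "('a, 'e) chart \<Rightarrow> 'a set" where
  "dom_of \<phi> \<equiv> fst \<phi>"

abbreviation coord :: "('a, 'e) chart \<Rightarrow> 'a \<Rightarrow> 'e" where
  "coord \<phi> \<equiv> snd \<phi>"

definition cod_of :: "('a, 'e) chart \<Rightarrow> 'e set" where
  "cod_of \<phi> = coord \<phi> ` dom_of \<phi>"

definition point :: "('a, 'e) chart \<Rightarrow> 'e \<Rightarrow> 'a" where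
  "point \<phi> = inv_into (dom_of \<phi>) (coord \<phi>)"

definition is_chart :: "('a::topological_space, 'e::euclidean_space) chart \<Rightarrow> bool" where
  "is_chart \<phi> \<longleftrightarrow> open (dom_of \<phi>) \<and> open (cod_of \<phi>) \<and>
     homeomorphism (dom_of \<phi>) (cod_of \<phi>) (coord \<phi>) (point \<phi>)"

text \<open>Coordinate expression of a map \<open>f\<close>, and the differential of \<open>f\<close> in coordinates at the point
  with coordinates \<open>x\<close>.\<close>

definition local_rep :: "('a \<Rightarrow> 'b) \<Rightarrow> ('a, 'e) chart \<Rightarrow> ('b, 'f) chart \<Rightarrow> 'e \<Rightarrow> 'f" where
  "local_rep f \<phi> \<psi> = coord \<psi> \<circ> f \<circ> point \<phi>"

definition differential ::
  "('a \<Rightarrow> 'b) \<Rightarrow> ('a, 'e::real_normed_vector) chart \<Rightarrow> ('b, 'f::real_normed_vector) chart \<Rightarrow> 'e \<Rightarrow> 'e \<Rightarrow> 'f" where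
  "differential f \<phi> \<psi> x = frechet_derivative (local_rep f \<phi> \<psi>) (at x)"

text \<open>Coordinates in the chart \<open>\<phi>\<close> of the points lying in both domains, and the change of
  coordinates there.\<close>

definition overlap :: "('a, 'e) chart \<Rightarrow> ('a, 'e) chart \<Rightarrow> 'e set" where
  "overlap \<phi> \<psi> = coord \<phi> ` (dom_of \<phi> \<inter> dom_of \<psi>)"

abbreviation transition :: "('a, 'e) chart \<Rightarrow> ('a, 'e) chart \<Rightarrow> 'e \<Rightarrow> 'e" where
  "transition \<phi> \<psi> \<equiv> local_rep (\<lambda>p. p) \<phi> \<psi>"

abbreviation Dtransition :: "('a, 'e::real_normed_vector) chart \<Rightarrow> ('a, 'e) chart \<Rightarrow> 'e \<Rightarrow> 'e \<Rightarrow> 'e" where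
  "Dtransition \<phi> \<psi> \<equiv> differential (\<lambda>p. p) \<phi> \<psi>"

definition smooth_atlas :: "('a::topological_space, 'e::euclidean_space) chart set \<Rightarrow> bool" where
  "smooth_atlas A \<longleftrightarrow> (\<forall>\<phi>\<in>A. is_chart \<phi>) \<and> (\<Union>\<phi>\<in>A. dom_of \<phi>) = UNIV \<and>
     (\<forall>\<phi>\<in>A. \<forall>\<psi>\<in>A. smooth_on (overlap \<phi> \<psi>) (transition \<phi> \<psi>))"

definition smooth_manifold ::
  "('a::{t2_space, second_countable_topology}, 'e::euclidean_space) chart set \<Rightarrow> bool" where
  "smooth_manifold A \<longleftrightarrow> smooth_atlas A \<and> connected (UNIV :: 'a set)"

definition compact_manifold ::
  "('a::{t2_space, second_countable_topology}, 'e::euclidean_space) chart set \<Rightarrow> bool" where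
  "compact_manifold A \<longleftrightarrow> smooth_manifold A \<and> compact (UNIV :: 'a set)"

definition smooth_fun :: "('a, 'e::euclidean_space) chart set \<Rightarrow> ('a \<Rightarrow> real) \<Rightarrow> bool" where
  "smooth_fun A f \<longleftrightarrow> (\<forall>\<phi>\<in>A. smooth_on (cod_of \<phi>) (f \<circ> point \<phi>))"

definition smooth_map ::
  "('a::topological_space, 'e::euclidean_space) chart set \<Rightarrow>
   ('b::topological_space, 'f::euclidean_space) chart set \<Rightarrow> ('a \<Rightarrow> 'b) \<Rightarrow> bool" where
  "smooth_map A B f \<longleftrightarrow> continuous_on UNIV f \<and>
     (\<forall>\<phi>\<in>A. \<forall>\<psi>\<in>B. smooth_on {x \<in> cod_of \<phi>. f (point \<phi> x) \<in> dom_of \<psi>} (local_rep f \<phi> \<psi>))"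

definition prod_chart :: "('a, 'e) chart \<Rightarrow> ('b, 'f) chart \<Rightarrow> ('a \<times> 'b, 'e \<times> 'f) chart" where
  "prod_chart \<phi> \<psi> = (dom_of \<phi> \<times> dom_of \<psi>, map_prod (coord \<phi>) (coord \<psi>))"

definition prod_atlas ::
  "('a, 'e) chart set \<Rightarrow> ('b, 'f) chart set \<Rightarrow> ('a \<times> 'b, 'e \<times> 'f) chart set" where
  "prod_atlas A B = (\<Union>\<phi>\<in>A. \<Union>\<psi>\<in>B. {prod_chart \<phi> \<psi>})"

section \<open>Tensors and connections\<close>

text \<open>The tangent space at a point is represented, in each chart around the point, by a copy of
  \<open>'e\<close>; the copies are identified by \<^const>\<open>Dtransition\<close>. A tensor field is the family of its
  coordinate expressions: the arguments are a chart \<open>\<phi>\<close>, the coordinates \<open>x \<in> cod_of \<phi>\<close> of a point,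
  and tangent vectors in the chart \<open>\<phi>\<close>. Values at charts outside the atlas or at
  \<open>x \<notin> cod_of \<phi>\<close> are irrelevant.\<close>

type_synonym ('a, 'e) form_field = "('a, 'e) chart \<Rightarrow> 'e \<Rightarrow> 'e \<Rightarrow> real"
type_synonym ('a, 'e) metric_field = "('a, 'e) chart \<Rightarrow> 'e \<Rightarrow> 'e \<Rightarrow> 'e \<Rightarrow> real"
type_synonym ('a, 'e) distribution = "('a, 'e) chart \<Rightarrow> 'e \<Rightarrow> 'e set"

definition one_form :: "('a, 'e::euclidean_space) chart set \<Rightarrow> ('a, 'e) form_field \<Rightarrow> bool" where
  "one_form A \<theta> \<longleftrightarrow>
     (\<forall>\<phi>\<in>A. (\<forall>x\<in>cod_of \<phi>. linear (\<theta> \<phi> x)) \<and> (\<forall>v. smooth_on (cod_of \<phi>) (\<lambda>x. \<theta> \<phi> x v))) \<and>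
     (\<forall>\<phi>\<in>A. \<forall>\<psi>\<in>A. \<forall>x\<in>overlap \<phi> \<psi>. \<forall>v.
        \<theta> \<phi> x v = \<theta> \<psi> (transition \<phi> \<psi> x) (Dtransition \<phi> \<psi> x v))"

definition riemannian_metric :: "('a, 'e::euclidean_space) chart set \<Rightarrow> ('a, 'e) metric_field \<Rightarrow> bool" where
  "riemannian_metric A g \<longleftrightarrow>
     (\<forall>\<phi>\<in>A. (\<forall>x\<in>cod_of \<phi>. bilinear (g \<phi> x) \<and> (\<forall>u v. g \<phi> x u v = g \<phi> x v u) \<and>
                (\<forall>u. u \<noteq> 0 \<longrightarrow> g \<phi> x u u > 0)) \<and>
             (\<forall>u v. smooth_on (cod_of \<phi>) (\<lambda>x. g \<phi> x u v))) \<and>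
     (\<forall>\<phi>\<in>A. \<forall>\<psi>\<in>A. \<forall>x\<in>overlap \<phi> \<psi>. \<forall>u v.
        g \<phi> x u v = g \<psi> (transition \<phi> \<psi> x) (Dtransition \<phi> \<psi> x u) (Dtransition \<phi> \<psi> x v))"

text \<open>A linear connection is given by its coordinate expressions (Christoffel symbols)
  \<open>\<Gamma> \<phi> x :: 'e \<Rightarrow> 'e \<Rightarrow> 'e\<close>: for vector fields with coordinate expressions \<open>X\<close>, \<open>Y\<close> in the chart \<open>\<phi>\<close>,
  \<open>\<nabla>\<^sub>X Y = DY(X) + \<Gamma> \<phi> x X Y\<close>. The transformation law below says that this expression is a
  vector field, i.e. that it is mapped by \<^const>\<open>Dtransition\<close> to the one in the other chart.\<close>

type_synonym ('a, 'e) connection_field = "('a, 'e) chart \<Rightarrow> 'e \<Rightarrow> 'e \<Rightarrow> 'e \<Rightarrow> 'e"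

definition linear_connection ::
  "('a, 'e::euclidean_space) chart set \<Rightarrow> ('a, 'e) connection_field \<Rightarrow> bool" where
  "linear_connection A \<Gamma> \<longleftrightarrow>
     (\<forall>\<phi>\<in>A. (\<forall>x\<in>cod_of \<phi>. bilinear (\<Gamma> \<phi> x)) \<and> (\<forall>u v. smooth_on (cod_of \<phi>) (\<lambda>x. \<Gamma> \<phi> x u v))) \<and>
     (\<forall>\<phi>\<in>A. \<forall>\<psi>\<in>A. \<forall>x\<in>overlap \<phi> \<psi>. \<forall>u v.
        Dtransition \<phi> \<psi> x (\<Gamma> \<phi> x u v) =
          frechet_derivative (\<lambda>y. Dtransition \<phi> \<psi> y v) (at x) u +
          \<Gamma> \<psi> (transition \<phi> \<psi> x) (Dtransition \<phi> \<psi> x u) (Dtransition \<phi> \<psi> x v))"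

text \<open>The formulas below evaluate the invariant expressions on the coordinate (constant) vector
  fields \<open>u\<close>, \<open>v\<close>, \<open>w\<close> of the chart \<open>\<phi>\<close>; these have vanishing Lie brackets, and
  \<open>\<nabla>\<^sub>u v = \<Gamma> \<phi> x u v\<close>.\<close>

definition torsion_free ::
  "('a, 'e::euclidean_space) chart set \<Rightarrow> ('a, 'e) connection_field \<Rightarrow> bool" where
  "torsion_free A \<Gamma> \<longleftrightarrow> (\<forall>\<phi>\<in>A. \<forall>x\<in>cod_of \<phi>. \<forall>u v. \<Gamma> \<phi> x u v = \<Gamma> \<phi> x v u)"

text \<open>\<open>(\<nabla>\<^sub>u g)(v, w) = u(g(v, w)) - g(\<nabla>\<^sub>u v, w) - g(v, \<nabla>\<^sub>u w)\<close>\<close>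
definition nabla_metric ::
  "('a, 'e::euclidean_space) connection_field \<Rightarrow> ('a, 'e) metric_field \<Rightarrow>
   ('a, 'e) chart \<Rightarrow> 'e \<Rightarrow> 'e \<Rightarrow> 'e \<Rightarrow> 'e \<Rightarrow> real" where
  "nabla_metric \<Gamma> g \<phi> x u v w =
     frechet_derivative (\<lambda>y. g \<phi> y v w) (at x) u - g \<phi> x (\<Gamma> \<phi> x u v) w - g \<phi> x v (\<Gamma> \<phi> x u w)"

text \<open>\<open>(\<nabla>\<^sub>u \<theta>)(v) = u(\<theta>(v)) - \<theta>(\<nabla>\<^sub>u v)\<close>\<close>
definition nabla_form ::
  "('a, 'e::euclidean_space) connection_field \<Rightarrow> ('a, 'e) form_field \<Rightarrow>
   ('a, 'e) chart \<Rightarrow> 'e \<Rightarrow> 'e \<Rightarrow> 'e \<Rightarrow> real" where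
  "nabla_form \<Gamma> \<theta> \<phi> x u v =
     frechet_derivative (\<lambda>y. \<theta> \<phi> y v) (at x) u - \<theta> \<phi> x (\<Gamma> \<phi> x u v)"

text \<open>\<open>R(u, v)w = \<nabla>\<^sub>u \<nabla>\<^sub>v w - \<nabla>\<^sub>v \<nabla>\<^sub>u w\<close>\<close>
definition curvature ::
  "('a, 'e::euclidean_space) connection_field \<Rightarrow> ('a, 'e) chart \<Rightarrow> 'e \<Rightarrow> 'e \<Rightarrow> 'e \<Rightarrow> 'e \<Rightarrow> 'e" where
  "curvature \<Gamma> \<phi> x u v w =
     (frechet_derivative (\<lambda>y. \<Gamma> \<phi> y v w) (at x) u + \<Gamma> \<phi> x u (\<Gamma> \<phi> x v w)) -
     (frechet_derivative (\<lambda>y. \<Gamma> \<phi> y u w) (at x) v + \<Gamma> \<phi> x v (\<Gamma> \<phi> x u w))"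

text \<open>\<open>Ric(v, w)\<close> is the trace of \<open>u \<mapsto> R(u, v)w\<close>.\<close>
definition ricci ::
  "('a, 'e::euclidean_space) connection_field \<Rightarrow> ('a, 'e) chart \<Rightarrow> 'e \<Rightarrow> 'e \<Rightarrow> 'e \<Rightarrow> real" where
  "ricci \<Gamma> \<phi> x v w = (\<Sum>b\<in>Basis. curvature \<Gamma> \<phi> x b v w \<bullet> b)"

definition levi_civita ::
  "('a, 'e::euclidean_space) chart set \<Rightarrow> ('a, 'e) metric_field \<Rightarrow> ('a, 'e) connection_field \<Rightarrow> bool" where
  "levi_civita A g \<Gamma> \<longleftrightarrow> linear_connection A \<Gamma> \<and> torsion_free A \<Gamma> \<and>
     (\<forall>\<phi>\<in>A. \<forall>x\<in>cod_of \<phi>. \<forall>u v w. nabla_metric \<Gamma> g \<phi> x u v w = 0)"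

definition einstein_metric :: "('a, 'e::euclidean_space) chart set \<Rightarrow> ('a, 'e) metric_field \<Rightarrow> bool" where
  "einstein_metric A g \<longleftrightarrow> riemannian_metric A g \<and>
     (\<exists>\<Gamma> lam. levi_civita A g \<Gamma> \<and>
        (\<forall>\<phi>\<in>A. \<forall>x\<in>cod_of \<phi>. \<forall>v w. ricci \<Gamma> \<phi> x v w = lam * g \<phi> x v w))"

section \<open>Conformal classes and Weyl connections\<close>

definition conf_class_of ::
  "('a, 'e::euclidean_space) chart set \<Rightarrow> ('a, 'e) metric_field \<Rightarrow> ('a, 'e) metric_field set" where
  "conf_class_of A g = {g'. riemannian_metric A g' \<and>
     (\<exists>f. smooth_fun A f \<and>
        (\<forall>\<phi>\<in>A. \<forall>x\<in>cod_of \<phi>. \<forall>u v. g' \<phi> x u v = exp (2 * f (point \<phi> x)) * g \<phi> x u v))}"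

definition conformal_class ::
  "('a, 'e::euclidean_space) chart set \<Rightarrow> ('a, 'e) metric_field set \<Rightarrow> bool" where
  "conformal_class A c \<longleftrightarrow> (\<exists>g. riemannian_metric A g \<and> c = conf_class_of A g)"

definition lee_form ::
  "('a, 'e::euclidean_space) chart set \<Rightarrow> ('a, 'e) connection_field \<Rightarrow> ('a, 'e) metric_field \<Rightarrow>
   ('a, 'e) form_field \<Rightarrow> bool" where
  "lee_form A \<Gamma> g \<theta> \<longleftrightarrow> one_form A \<theta> \<and>
     (\<forall>\<phi>\<in>A. \<forall>x\<in>cod_of \<phi>. \<forall>u v w. nabla_metric \<Gamma> g \<phi> x u v w = - 2 * \<theta> \<phi> x u * g \<phi> x v w)"

definition weyl_connection ::
  "('a, 'e::euclidean_space) chart set \<Rightarrow> ('a, 'e) metric_field set \<Rightarrow> ('a, 'e) connection_field \<Rightarrow> bool" where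
  "weyl_connection A c \<Gamma> \<longleftrightarrow> linear_connection A \<Gamma> \<and> torsion_free A \<Gamma> \<and> (\<forall>g\<in>c. \<exists>\<theta>. lee_form A \<Gamma> g \<theta>)"

section \<open>Parallel transport\<close>

text \<open>\<open>w \<phi> t\<close> and \<open>V \<phi> t\<close> are the coordinate expressions of the velocity of \<open>\<gamma>\<close> and of a vector field
  along \<open>\<gamma>\<close>, at those \<open>t \<in> {0..1}\<close> where \<open>\<gamma> t\<close> is in the domain of \<open>\<phi>\<close>.\<close>

definition C1_curve ::
  "('a::topological_space, 'e::euclidean_space) chart set \<Rightarrow> (real \<Rightarrow> 'a) \<Rightarrow>
   (('a, 'e) chart \<Rightarrow> real \<Rightarrow> 'e) \<Rightarrow> bool" where
  "C1_curve A \<gamma> w \<longleftrightarrow> continuous_on {0..1} \<gamma> \<and>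
     (\<forall>\<phi>\<in>A. continuous_on {t\<in>{0..1}. \<gamma> t \<in> dom_of \<phi>} (w \<phi>) \<and>
        (\<forall>t\<in>{0..1}. \<gamma> t \<in> dom_of \<phi> \<longrightarrow>
           ((\<lambda>s. coord \<phi> (\<gamma> s)) has_vector_derivative w \<phi> t) (at t within {0..1})))"

definition parallel_field ::
  "('a, 'e::euclidean_space) chart set \<Rightarrow> ('a, 'e) connection_field \<Rightarrow> (real \<Rightarrow> 'a) \<Rightarrow>
   (('a, 'e) chart \<Rightarrow> real \<Rightarrow> 'e) \<Rightarrow> (('a, 'e) chart \<Rightarrow> real \<Rightarrow> 'e) \<Rightarrow> bool" where
  "parallel_field A \<Gamma> \<gamma> w V \<longleftrightarrow>
     (\<forall>\<phi>\<in>A. \<forall>\<psi>\<in>A. \<forall>t\<in>{0..1}. \<gamma> t \<in> dom_of \<phi> \<inter> dom_of \<psi> \<longrightarrow>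
        V \<psi> t = Dtransition \<phi> \<psi> (coord \<phi> (\<gamma> t)) (V \<phi> t)) \<and>
     (\<forall>\<phi>\<in>A. \<forall>t\<in>{0..1}. \<gamma> t \<in> dom_of \<phi> \<longrightarrow>
        (V \<phi> has_vector_derivative - \<Gamma> \<phi> (coord \<phi> (\<gamma> t)) (w \<phi> t) (V \<phi> t)) (at t within {0..1}))"

text \<open>The distribution \<open>E\<close> is preserved by parallel transport along all curves. Closed curves alone
  would not do: a flat connection can have trivial holonomy group although \<open>E\<close> is not
  parallel, and the adapted Weyl connection would not be unique.\<close>
definition holonomy_preserves ::
  "('a::topological_space, 'e::euclidean_space) chart set \<Rightarrow> ('a, 'e) connection_field \<Rightarrow>
   ('a, 'e) distribution \<Rightarrow> bool" where
  "holonomy_preserves A \<Gamma> E \<longleftrightarrow>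
     (\<forall>\<gamma> w V. C1_curve A \<gamma> w \<and> parallel_field A \<Gamma> \<gamma> w V \<and>
        (\<forall>\<phi>\<in>A. \<gamma> 0 \<in> dom_of \<phi> \<longrightarrow> V \<phi> 0 \<in> E \<phi> (coord \<phi> (\<gamma> 0))) \<longrightarrow>
        (\<forall>\<phi>\<in>A. \<gamma> 1 \<in> dom_of \<phi> \<longrightarrow> V \<phi> 1 \<in> E \<phi> (coord \<phi> (\<gamma> 1))))"

section \<open>Conformal product structures\<close>

definition ker_differential ::
  "('b, 'f::real_normed_vector) chart set \<Rightarrow> ('a \<Rightarrow> 'b) \<Rightarrow> ('a, 'e::real_normed_vector) distribution" where
  "ker_differential B f \<phi> x =
     {u. \<forall>\<psi>\<in>B. f (point \<phi> x) \<in> dom_of \<psi> \<longrightarrow> differential f \<phi> \<psi> x u = 0}"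

text \<open>A submersion whose differential, restricted to the orthogonal complement of its kernel, is a
  homothety at each point. Since \<open>c\<close> and \<open>c'\<close> are conformal classes, it does not matter whether one
  takes all or some metrics in them.\<close>
definition conformal_submersion ::
  "('a::topological_space, 'e::euclidean_space) chart set \<Rightarrow> ('a, 'e) metric_field set \<Rightarrow>
   ('b::topological_space, 'f::euclidean_space) chart set \<Rightarrow> ('b, 'f) metric_field set \<Rightarrow>
   ('a \<Rightarrow> 'b) \<Rightarrow> bool" where
  "conformal_submersion A c B c' f \<longleftrightarrow> smooth_map A B f \<and>
     (\<forall>g\<in>c. \<forall>h\<in>c'. \<forall>\<phi>\<in>A. \<forall>x\<in>cod_of \<phi>. \<forall>\<psi>\<in>B. f (point \<phi> x) \<in> dom_of \<psi> \<longrightarrow>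
        surj (differential f \<phi> \<psi> x) \<and>
        (\<exists>\<rho>>0. \<forall>u v.
           (\<forall>k\<in>ker_differential B f \<phi> x. g \<phi> x u k = 0) \<and>
           (\<forall>k\<in>ker_differential B f \<phi> x. g \<phi> x v k = 0) \<longrightarrow>
           h \<psi> (local_rep f \<phi> \<psi> x) (differential f \<phi> \<psi> x u) (differential f \<phi> \<psi> x v)
             = \<rho> * g \<phi> x u v))"

text \<open>\<open>TM\<^sub>1\<close> is the kernel of the differential of the second projection, and vice versa.\<close>

abbreviation TM1 :: "('b, 'f::euclidean_space) chart set \<Rightarrow> ('a \<times> 'b, 'e::euclidean_space \<times> 'f) distribution" where
  "TM1 A2 \<equiv> ker_differential A2 snd"

abbreviation TM2 :: "('a, 'e::euclidean_space) chart set \<Rightarrow> ('a \<times> 'b, 'e \<times> 'f::euclidean_space) distribution" where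
  "TM2 A1 \<equiv> ker_differential A1 fst"

definition conformal_product_structure ::
  "('a::topological_space, 'e::euclidean_space) chart set \<Rightarrow> ('a, 'e) metric_field set \<Rightarrow>
   ('b::topological_space, 'f::euclidean_space) chart set \<Rightarrow> ('b, 'f) metric_field set \<Rightarrow>
   ('a \<times> 'b, 'e \<times> 'f) metric_field set \<Rightarrow> bool" where
  "conformal_product_structure A1 c1 A2 c2 c \<longleftrightarrow>
     conformal_class (prod_atlas A1 A2) c \<and>
     conformal_submersion (prod_atlas A1 A2) c A1 c1 fst \<and>
     conformal_submersion (prod_atlas A1 A2) c A2 c2 snd \<and>
     (\<forall>g\<in>c. \<forall>\<phi>\<in>prod_atlas A1 A2. \<forall>x\<in>cod_of \<phi>. \<forall>u\<in>TM1 A2 \<phi> x. \<forall>v\<in>TM2 A1 \<phi> x. g \<phi> x u v = 0)"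

definition adapted_weyl_connection ::
  "('a::topological_space, 'e::euclidean_space) chart set \<Rightarrow>
   ('b::topological_space, 'f::euclidean_space) chart set \<Rightarrow>
   ('a \<times> 'b, 'e \<times> 'f) metric_field set \<Rightarrow> ('a \<times> 'b, 'e \<times> 'f) connection_field \<Rightarrow> bool" where
  "adapted_weyl_connection A1 A2 c \<Gamma> \<longleftrightarrow>
     weyl_connection (prod_atlas A1 A2) c \<Gamma> \<and>
     holonomy_preserves (prod_atlas A1 A2) \<Gamma> (TM1 A2) \<and>
     holonomy_preserves (prod_atlas A1 A2) \<Gamma> (TM2 A1)"

text \<open>\<open>\<theta>'\<close> is the 1-form that equals \<open>\<theta>\<close> on \<open>TM\<^sub>2\<close> and vanishes on \<open>TM\<^sub>1\<close>.\<close>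
definition restriction_TM2 ::
  "('a, 'e::euclidean_space) chart set \<Rightarrow> ('b, 'f::euclidean_space) chart set \<Rightarrow>
   ('a \<times> 'b, 'e \<times> 'f) form_field \<Rightarrow> ('a \<times> 'b, 'e \<times> 'f) form_field \<Rightarrow> bool" where
  "restriction_TM2 A1 A2 \<theta> \<theta>' \<longleftrightarrow> one_form (prod_atlas A1 A2) \<theta>' \<and>
     (\<forall>\<phi>\<in>prod_atlas A1 A2. \<forall>x\<in>cod_of \<phi>.
        (\<forall>v\<in>TM2 A1 \<phi> x. \<theta>' \<phi> x v = \<theta> \<phi> x v) \<and> (\<forall>u\<in>TM1 A2 \<phi> x. \<theta>' \<phi> x u = 0))"

definition parallel_in_direction ::
  "('a, 'e::euclidean_space) chart set \<Rightarrow> ('a, 'e) connection_field \<Rightarrow> ('a, 'e) distribution \<Rightarrow>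
   ('a, 'e) form_field \<Rightarrow> bool" where
  "parallel_in_direction A \<Gamma> E \<theta> \<longleftrightarrow>
     (\<forall>\<phi>\<in>A. \<forall>x\<in>cod_of \<phi>. \<forall>u\<in>E \<phi> x. \<forall>v. nabla_form \<Gamma> \<theta> \<phi> x u v = 0)"

text \<open>By the transformation law of \<open>h\<close>, the chart chosen around the image point is irrelevant.\<close>
definition pullback_metric ::
  "('b, 'f::euclidean_space) chart set \<Rightarrow> ('a \<Rightarrow> 'b) \<Rightarrow> ('b, 'f) metric_field \<Rightarrow>
   ('a, 'e::euclidean_space) metric_field" where
  "pullback_metric B f h \<phi> x u v =
     (let \<psi> = (SOME \<psi>. \<psi> \<in> B \<and> f (point \<phi> x) \<in> dom_of \<psi>)
      in h \<psi> (local_rep f \<phi> \<psi> x) (differential f \<phi> \<psi> x u) (differential f \<phi> \<psi> x v))"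

definition product_metric ::
  "('a, 'e::euclidean_space) chart set \<Rightarrow> ('b, 'f::euclidean_space) chart set \<Rightarrow>
   ('a, 'e) metric_field \<Rightarrow> ('b, 'f) metric_field \<Rightarrow> ('a \<times> 'b, 'e \<times> 'f) metric_field" where
  "product_metric A1 A2 h1 h2 \<phi> x u v =
     pullback_metric A1 fst h1 \<phi> x u v + pullback_metric A2 snd h2 \<phi> x u v"

end

theory Submission
  imports Defs
begin

text \<open>
  Write \<open>g = e\<^sup>2\<^sup>F\<^sup>1 g\<^sub>1 + e\<^sup>2\<^sup>F\<^sup>2 g\<^sub>2\<close>. Since \<open>\<nabla>\<close> preserves both factors and is torsion-free, \<open>\<nabla>\<close> of a vector field
  on one factor in a direction of the other vanishes, so the parallelism hypothesis says that the mixed second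
  derivatives of \<open>F\<^sub>1\<close> vanish. Absorbing a function of the first variable into \<open>g\<^sub>1\<close>, one may take
  \<open>F\<^sub>1 = b\<close> to be a function on \<open>M\<^sub>2\<close>; it remains to see that \<open>f = F\<^sub>2\<close> splits as a sum as well.
  With \<open>n\<^sub>i = dim M\<^sub>i\<close>, the mixed part of the Einstein equation reads \<open>(n\<^sub>2 - 1) D\<^sub>1D\<^sub>2f = (n\<^sub>1 + n\<^sub>2 - 2) D\<^sub>1f D\<^sub>2b\<close>.

  If \<open>n\<^sub>2 = 1\<close>, then \<open>D\<^sub>1f = 0\<close> wherever \<open>b' \<noteq> 0\<close> and, by continuity, wherever \<open>b'' \<noteq> 0\<close>; where \<open>b' = b'' = 0\<close> the
  Einstein equation along \<open>M\<^sub>2\<close> makes \<open>e\<^sup>-\<^sup>f\<Delta>e\<^sup>f\<close> constant on the slice, and the strong maximum principle makes \<open>f\<close>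
  constant there.

  If \<open>n\<^sub>2 \<ge> 2\<close>, then \<open>e\<^sup>-\<^sup>k\<^sup>b D\<^sub>1f\<close> with \<open>k = (n\<^sub>1 + n\<^sub>2 - 2) / (n\<^sub>2 - 1)\<close> does not depend on the second variable. If \<open>n\<^sub>1 = 1\<close>, the
  Einstein equation along \<open>M\<^sub>1\<close> at a minimum or a maximum of \<open>b\<close>, according to the sign of the Einstein constant, makes
  \<open>e\<^sup>f\<close> super- or subharmonic on a slice, so that \<open>D\<^sub>1f = 0\<close> on this slice, hence everywhere. If \<open>n\<^sub>1 \<ge> 2\<close> and \<open>b\<close> is not constant,
  the trace-free Einstein equation along \<open>M\<^sub>1\<close> is quadratic in \<open>e\<^sup>k\<^sup>b\<close>, which takes infinitely many values;
  its leading coefficient is the trace-free part of \<open>D\<^sub>1f \<otimes> D\<^sub>1f\<close>, and again \<open>D\<^sub>1f = 0\<close>.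
\<close>

section \<open>Calculus of smooth functions\<close>

text \<open>Two features of the setting shape the proof. The adapted connection is known through
  parallel transport only, so its Christoffel symbols are reached by solving the transport equation
  along short segments. And tensors are families of coordinate expressions, so curvature is computed
  in one product chart; it yields either a vanishing derivative, to be integrated over a connected
  factor, or a sign on a slice, for the maximum principle on the compact first factor. For n1 = 1
  the Einstein equation along M1 says that n2 e^-f Lap(e^f) on the slice is -(Lap b + lambda). Lap b
  is nonnegative at a minimum of b and nonpositive at a maximum, so the extremum is chosen where Lap
  b and lambda cannot have opposite signs. The product metric comes from the splitting of both
  exponents: F2 - F1 = k2 - k1 with k1 on M1 and k2 on M2, and g is a multiple of e^(2 k1) g1 + e^(2
  k2) g2.\<close>

abbreviation dd :: "('e::real_normed_vector \<Rightarrow> 'g::real_normed_vector) \<Rightarrow> 'e \<Rightarrow> 'e \<Rightarrow> 'g" where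
  "dd f x v \<equiv> frechet_derivative f (at x) v"

lemma dd_eqI: "(f has_derivative f') (at x) \<Longrightarrow> frechet_derivative f (at x) = f'"
  by (rule frechet_derivative_at[symmetric])

lemma dd_works: "f differentiable (at x) \<Longrightarrow> (f has_derivative frechet_derivative f (at x)) (at x)"
  by (simp add: frechet_derivative_works)

text \<open>\<open>frechet_derivative\<close> is a choice from the set of derivatives at x, and that
  set depends on the germ of the function only. So the chosen values agree even at a point without
  derivative.\<close>

lemma dd_cong:
  assumes "open S" "x \<in> S" "\<And>y. y \<in> S \<Longrightarrow> f y = g y"
  shows "frechet_derivative f (at x) = frechet_derivative g (at x)"
proof -
  have "(f has_derivative f') (at x) \<longleftrightarrow> (g has_derivative f') (at x)" for f'
    using assms has_derivative_transform_within_open[of f f' x UNIV S g]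
      has_derivative_transform_within_open[of g f' x UNIV S f] by auto
  then show ?thesis unfolding frechet_derivative_def by simp
qed

lemma differentiable_cong:
  assumes "open S" "x \<in> S" "\<And>y. y \<in> S \<Longrightarrow> f y = g y" "f differentiable (at x)"
  shows "g differentiable (at x)"
  using assms has_derivative_transform_within_open[of f _ x UNIV S g]
  unfolding differentiable_def by blast

section \<open>Functions of class C^k: locality and closure properties\<close>

lemma Ck_on_cong:
  assumes "open S" "\<And>x. x \<in> S \<Longrightarrow> f x = g x" "Ck_on k S f"
  shows "Ck_on k S g"
  using assms
proof (induction k arbitrary: f g)
  case 0 then show ?case by (simp cong: continuous_on_cong)
next
  case (Suc k)
  have "g differentiable (at x)" if "x \<in> S" for x
    using Suc.prems that by (auto intro: differentiable_cong[of S x f g])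
  moreover have "Ck_on k S (\<lambda>x. dd g x v)" for v
  proof (rule Suc.IH)
    show "dd f x v = dd g x v" if "x \<in> S" for x
      using dd_cong[OF Suc.prems(1) that, of f g] Suc.prems(2) by simp
  qed (use Suc.prems in auto)
  ultimately show ?case by simp
qed

lemma Ck_on_SucD: "Ck_on (Suc k) S f \<Longrightarrow> Ck_on k S f"
proof (induction k arbitrary: f)
  case 0 then show ?case
    by (simp add: continuous_at_imp_continuous_on differentiable_imp_continuous_within)
next
  case (Suc k) then show ?case by (metis Ck_on.simps(2))
qed

lemma Ck_on_subset: "Ck_on k S f \<Longrightarrow> T \<subseteq> S \<Longrightarrow> Ck_on k T f"
proof (induction k arbitrary: f)
  case 0 then show ?case by (auto intro: continuous_on_subset)
next
  case (Suc k) then show ?case by (simp add: subset_iff)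
qed

lemma Ck_on_const: "Ck_on k S (\<lambda>x. c)"
  by (induction k arbitrary: c) auto

lemma Ck_on_ident: "Ck_on k S (\<lambda>x. x)"
  by (cases k) (auto simp: Ck_on_const)

text \<open>Pattern of the closure lemmas: the formula \<open>d\<close> for the derivative has the
  shape of the original expression with f replaced by a derivative of f, so the induction ranges
  over f; \<open>Ck_on_cong\<close> passes from the formula to \<open>dd\<close>, with which it
  agrees on S.\<close>

lemma Ck_on_bounded_linear:
  assumes "bounded_linear L" "open S" "Ck_on k S f"
  shows "Ck_on k S (\<lambda>x. L (f x))"
  using assms(3)
proof (induction k arbitrary: f)
  case 0 then show ?case by (simp add: bounded_linear.continuous_on[OF assms(1)])
next
  case (Suc k)
  have d: "((\<lambda>x. L (f x)) has_derivative (\<lambda>v. L (dd f x v))) (at x)" if "x \<in> S" for x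
    using that Suc.prems by (auto intro!: bounded_linear.has_derivative[OF assms(1)] dd_works)
  have "Ck_on k S (\<lambda>x. dd (\<lambda>x. L (f x)) x v)" for v
    by (rule Ck_on_cong[OF assms(2) _ Suc.IH[of "\<lambda>x. dd f x v"]]) (use Suc.prems dd_eqI[OF d] in auto)
  then show ?case using d by (auto simp: differentiable_def)
qed

lemma Ck_on_add:
  assumes "open S" "Ck_on k S f" "Ck_on k S g"
  shows "Ck_on k S (\<lambda>x. f x + g x)"
  using assms(2,3)
proof (induction k arbitrary: f g)
  case 0 then show ?case by (simp add: continuous_on_add)
next
  case (Suc k)
  have d: "((\<lambda>x. f x + g x) has_derivative (\<lambda>v. dd f x v + dd g x v)) (at x)" if "x \<in> S" for x
    using that Suc.prems by (auto intro!: has_derivative_add dd_works)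
  have "Ck_on k S (\<lambda>x. dd (\<lambda>x. f x + g x) x v)" for v
    by (rule Ck_on_cong[OF assms(1) _ Suc.IH[of "\<lambda>x. dd f x v" "\<lambda>x. dd g x v"]])
       (use Suc.prems dd_eqI[OF d] in auto)
  then show ?case using d by (auto simp: differentiable_def)
qed

lemma Ck_on_bounded_bilinear:
  assumes "bounded_bilinear B" "open S" "Ck_on k S f" "Ck_on k S g"
  shows "Ck_on k S (\<lambda>x. B (f x) (g x))"
  using assms(3,4)
proof (induction k arbitrary: f g)
  case 0 then show ?case by (simp add: bounded_bilinear.continuous_on[OF assms(1)])
next
  case (Suc k)
  have d: "((\<lambda>x. B (f x) (g x)) has_derivative (\<lambda>v. B (f x) (dd g x v) + B (dd f x v) (g x))) (at x)"
    if "x \<in> S" for x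
    using that Suc.prems by (auto intro!: bounded_bilinear.FDERIV[OF assms(1)] dd_works)
  have "Ck_on k S (\<lambda>x. dd (\<lambda>x. B (f x) (g x)) x v)" for v
    by (rule Ck_on_cong[OF assms(2) _ Ck_on_add[OF assms(2) Suc.IH[of f "\<lambda>x. dd g x v"] Suc.IH[of "\<lambda>x. dd f x v" g]]])
       (use Suc.prems dd_eqI[OF d] Ck_on_SucD in auto)
  then show ?case using d by (auto simp: differentiable_def)
qed

text \<open>Affine maps cover the inclusions of slices, x \<mapsto> (x, 0) + (0, y), as well as the
  projections of a product.\<close>

lemma Ck_on_affine:
  assumes "bounded_linear L" "open T" "\<And>z. z \<in> T \<Longrightarrow> L z + c \<in> S" "Ck_on k S f"
  shows "Ck_on k T (\<lambda>z. f (L z + c))"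
  using assms(4)
proof (induction k arbitrary: f)
  case 0
  have "continuous_on T (\<lambda>z. L z + c)"
    by (intro continuous_intros bounded_linear.continuous_on[OF assms(1)])
  then show ?case using 0 assms(3) by (auto intro: continuous_on_compose2)
next
  case (Suc k)
  have L: "((\<lambda>z. L z + c) has_derivative L) (at z)" for z
    using bounded_linear_imp_has_derivative[OF assms(1)] by (auto intro!: derivative_eq_intros)
  have d: "((\<lambda>z. f (L z + c)) has_derivative (\<lambda>v. dd f (L z + c) (L v))) (at z)" if "z \<in> T" for z
    using has_derivative_compose[OF L, of f "dd f (L z + c)" z] Suc.prems assms(3)[OF that] by (simp add: dd_works)
  have "Ck_on k T (\<lambda>z. dd (\<lambda>z. f (L z + c)) z v)" for v
    by (rule Ck_on_cong[OF assms(2) _ Suc.IH[of "\<lambda>x. dd f x (L v)"]]) (use Suc.prems dd_eqI[OF d] in auto)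
  then show ?case using d by (auto simp: differentiable_def)
qed

text \<open>The derivative exp f * Df contains the function itself, so f stays fixed in the
  induction: the induction hypothesis supplies the first factor, the assumption on f the second.
  \<open>Ck_on_inverse\<close> works in the same way.\<close>

lemma Ck_on_exp:
  fixes f :: "'e::real_normed_vector \<Rightarrow> real"
  assumes "open S" "Ck_on k S f"
  shows "Ck_on k S (\<lambda>x. exp (f x))"
  using assms(2)
proof (induction k)
  case 0 then show ?case by (simp add: continuous_on_exp)
next
  case (Suc k)
  have d: "((\<lambda>x. exp (f x)) has_derivative (\<lambda>v. exp (f x) * dd f x v)) (at x)" if "x \<in> S" for x
    using that Suc.prems by (auto intro!: derivative_eq_intros dd_works)
  have "Ck_on k S (\<lambda>x. dd (\<lambda>x. exp (f x)) x v)" for v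
    by (rule Ck_on_cong[OF assms(1) _ Ck_on_bounded_bilinear[OF bounded_bilinear_mult assms(1) Suc.IH, of "\<lambda>x. dd f x v"]])
       (use Suc.prems dd_eqI[OF d] Ck_on_SucD in auto)
  then show ?case using d by (auto simp: differentiable_def)
qed

lemma Ck_on_inverse:
  fixes f :: "'e::real_normed_vector \<Rightarrow> real"
  assumes "open S" "Ck_on k S f" "\<And>x. x \<in> S \<Longrightarrow> f x \<noteq> 0"
  shows "Ck_on k S (\<lambda>x. inverse (f x))"
  using assms(2)
proof (induction k)
  case 0 then show ?case using assms(3) by (simp add: continuous_on_inverse)
next
  case (Suc k)
  note M = Ck_on_bounded_bilinear[OF bounded_bilinear_mult assms(1)]
  have d: "((\<lambda>x. inverse (f x)) has_derivative (\<lambda>v. (-1) * (inverse (f x) * dd f x v * inverse (f x)))) (at x)"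
    if "x \<in> S" for x
    using that Suc.prems assms(3) by (auto intro!: derivative_eq_intros dd_works)
  have "Ck_on k S (\<lambda>x. dd (\<lambda>x. inverse (f x)) x v)" for v
    by (rule Ck_on_cong[OF assms(1) _ M[OF Ck_on_const[of _ _ "-1"] M[OF M[OF Suc.IH, of "\<lambda>x. dd f x v"] Suc.IH]]])
       (use Suc.prems dd_eqI[OF d] Ck_on_SucD in auto)
  then show ?case using d by (auto simp: differentiable_def)
qed

text \<open>The derivative Df / f no longer contains the logarithm, so a case distinction on k
  replaces the induction.\<close>

lemma Ck_on_ln:
  fixes f :: "'e::real_normed_vector \<Rightarrow> real"
  assumes "open S" "Ck_on k S f" "\<And>x. x \<in> S \<Longrightarrow> f x > 0"
  shows "Ck_on k S (\<lambda>x. ln (f x))"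
proof (cases k)
  case 0 then show ?thesis using assms(2,3) by (force intro!: continuous_on_ln)
next
  case (Suc k)
  have df: "x \<in> S \<Longrightarrow> f differentiable (at x)" "Ck_on k S (\<lambda>x. dd f x v)" for x v
    using assms(2) Suc by auto
  have d: "((\<lambda>x. ln (f x)) has_derivative (\<lambda>v. inverse (f x) * dd f x v)) (at x)" if "x \<in> S" for x
    using that assms(3)[OF that] df(1)[OF that]
    by (auto intro!: derivative_eq_intros dd_works simp: field_simps)
  have i: "Ck_on k S (\<lambda>x. inverse (f x))"
    using assms(3) by (intro Ck_on_inverse assms(1) Ck_on_SucD[OF assms(2)[unfolded Suc]]) (metis less_irrefl)
  have "Ck_on k S (\<lambda>x. dd (\<lambda>x. ln (f x)) x v)" for v
    by (rule Ck_on_cong[OF assms(1) _ Ck_on_bounded_bilinear[OF bounded_bilinear_mult assms(1) i df(2)[of v]]])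
       (use dd_eqI[OF d] in auto)
  then show ?thesis using d Suc by (auto simp: differentiable_def)
qed

section \<open>Smooth functions: closure properties, products and slices\<close>

lemma smooth_on_continuous: "smooth_on S f \<Longrightarrow> continuous_on S f"
  unfolding smooth_on_def using Ck_on.simps(1) by blast

lemma smooth_on_differentiable: "smooth_on S f \<Longrightarrow> x \<in> S \<Longrightarrow> f differentiable (at x)"
  unfolding smooth_on_def using Ck_on.simps(2) by blast

lemma smooth_on_has_derivative:
  "smooth_on S f \<Longrightarrow> x \<in> S \<Longrightarrow> (f has_derivative frechet_derivative f (at x)) (at x)"
  by (intro dd_works smooth_on_differentiable)

lemma smooth_on_dd: "smooth_on S f \<Longrightarrow> smooth_on S (\<lambda>x. dd f x v)"
  unfolding smooth_on_def using Ck_on.simps(2) by blast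

lemma smooth_on_linear_dd: "smooth_on S f \<Longrightarrow> x \<in> S \<Longrightarrow> linear (frechet_derivative f (at x))"
  by (intro linear_frechet_derivative smooth_on_differentiable)

lemma smooth_on_cong: "open S \<Longrightarrow> (\<And>x. x \<in> S \<Longrightarrow> f x = g x) \<Longrightarrow> smooth_on S f \<Longrightarrow> smooth_on S g"
  unfolding smooth_on_def by (blast intro: Ck_on_cong)

lemma smooth_on_subset: "smooth_on S f \<Longrightarrow> T \<subseteq> S \<Longrightarrow> smooth_on T f"
  unfolding smooth_on_def by (blast intro: Ck_on_subset)

lemma smooth_on_const: "smooth_on S (\<lambda>x. c)"
  unfolding smooth_on_def by (blast intro: Ck_on_const)

lemma smooth_on_ident: "smooth_on S (\<lambda>x. x)"
  unfolding smooth_on_def by (blast intro: Ck_on_ident)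

lemma smooth_on_bounded_linear: "bounded_linear L \<Longrightarrow> open S \<Longrightarrow> smooth_on S f \<Longrightarrow> smooth_on S (\<lambda>x. L (f x))"
  unfolding smooth_on_def by (blast intro: Ck_on_bounded_linear)

lemma smooth_on_add: "open S \<Longrightarrow> smooth_on S f \<Longrightarrow> smooth_on S g \<Longrightarrow> smooth_on S (\<lambda>x. f x + g x)"
  unfolding smooth_on_def by (blast intro: Ck_on_add)

lemma smooth_on_mult:
  fixes f g :: "'e::real_normed_vector \<Rightarrow> real"
  shows "open S \<Longrightarrow> smooth_on S f \<Longrightarrow> smooth_on S g \<Longrightarrow> smooth_on S (\<lambda>x. f x * g x)"
  unfolding smooth_on_def by (blast intro: Ck_on_bounded_bilinear[OF bounded_bilinear_mult])

lemma smooth_on_scaleR: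
  fixes f :: "'e::real_normed_vector \<Rightarrow> real"
  shows "open S \<Longrightarrow> smooth_on S f \<Longrightarrow> smooth_on S g \<Longrightarrow> smooth_on S (\<lambda>x. f x *\<^sub>R g x)"
  unfolding smooth_on_def by (blast intro: Ck_on_bounded_bilinear[OF bounded_bilinear_scaleR])

lemma smooth_on_inner:
  fixes f g :: "'e::real_normed_vector \<Rightarrow> 'g::real_inner"
  shows "open S \<Longrightarrow> smooth_on S f \<Longrightarrow> smooth_on S g \<Longrightarrow> smooth_on S (\<lambda>x. f x \<bullet> g x)"
  unfolding smooth_on_def by (blast intro: Ck_on_bounded_bilinear[OF bounded_bilinear_inner])

lemma smooth_on_minus: "open S \<Longrightarrow> smooth_on S f \<Longrightarrow> smooth_on S (\<lambda>x. - f x)"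
  using smooth_on_bounded_linear[OF bounded_linear_minus[OF bounded_linear_ident]] by blast

lemma smooth_on_diff: "open S \<Longrightarrow> smooth_on S f \<Longrightarrow> smooth_on S g \<Longrightarrow> smooth_on S (\<lambda>x. f x - g x)"
  using smooth_on_add[of S f "\<lambda>x. - g x"] smooth_on_minus[of S g] by simp

lemma smooth_on_affine:
  "bounded_linear L \<Longrightarrow> open T \<Longrightarrow> (\<And>z. z \<in> T \<Longrightarrow> L z + c \<in> S) \<Longrightarrow> smooth_on S f \<Longrightarrow> smooth_on T (\<lambda>z. f (L z + c))"
  unfolding smooth_on_def by (blast intro: Ck_on_affine)

lemma smooth_on_exp:
  fixes f :: "'e::real_normed_vector \<Rightarrow> real"
  shows "open S \<Longrightarrow> smooth_on S f \<Longrightarrow> smooth_on S (\<lambda>x. exp (f x))"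
  unfolding smooth_on_def by (blast intro: Ck_on_exp)

lemma smooth_on_ln:
  fixes f :: "'e::real_normed_vector \<Rightarrow> real"
  shows "open S \<Longrightarrow> smooth_on S f \<Longrightarrow> (\<And>x. x \<in> S \<Longrightarrow> f x > 0) \<Longrightarrow> smooth_on S (\<lambda>x. ln (f x))"
  unfolding smooth_on_def by (blast intro: Ck_on_ln)

lemma smooth_on_divide:
  fixes f g :: "'e::real_normed_vector \<Rightarrow> real"
  assumes "open S" "smooth_on S f" "smooth_on S g" "\<And>x. x \<in> S \<Longrightarrow> g x \<noteq> 0"
  shows "smooth_on S (\<lambda>x. f x / g x)"
proof -
  have "smooth_on S (\<lambda>x. inverse (g x))"
    using assms unfolding smooth_on_def by (blast intro: Ck_on_inverse)
  then show ?thesis using smooth_on_mult assms by (fastforce simp: divide_inverse)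
qed

lemma smooth_on_fst:
  assumes "open S" "open T" "smooth_on S f"
  shows "smooth_on (S \<times> T) (\<lambda>z. f (fst z))"
  using smooth_on_affine[OF bounded_linear_fst, of "S \<times> T" 0 S f] assms by (auto simp: open_Times)

lemma smooth_on_snd:
  assumes "open S" "open T" "smooth_on T f"
  shows "smooth_on (S \<times> T) (\<lambda>z. f (snd z))"
  using smooth_on_affine[OF bounded_linear_snd, of "S \<times> T" 0 T f] assms by (auto simp: open_Times)

lemma smooth_on_slice1:
  assumes "open S" "y \<in> T" "smooth_on (S \<times> T) f"
  shows "smooth_on S (\<lambda>x. f (x, y))"
proof -
  have "bounded_linear (\<lambda>x. (x, 0))" by (intro bounded_linear_Pair bounded_linear_ident bounded_linear_zero)
  from smooth_on_affine[OF this assms(1), of "(0,y)" "S \<times> T" f] show ?thesis using assms by auto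
qed

lemma smooth_on_slice2:
  assumes "open T" "x \<in> S" "smooth_on (S \<times> T) f"
  shows "smooth_on T (\<lambda>y. f (x, y))"
proof -
  have "bounded_linear (\<lambda>y. (0, y))" by (intro bounded_linear_Pair bounded_linear_ident bounded_linear_zero)
  from smooth_on_affine[OF this assms(1), of "(x,0)" "S \<times> T" f] show ?thesis using assms by auto
qed

lemma smooth_on_map_prod:
  fixes f :: "'a::real_normed_vector \<Rightarrow> 'c::real_normed_vector" and g :: "'b::real_normed_vector \<Rightarrow> 'd::real_normed_vector"
  assumes "open S" "open T" "smooth_on S f" "smooth_on T g"
  shows "smooth_on (S \<times> T) (map_prod f g)"
proof -
  have o: "open (S \<times> T)" using assms by (simp add: open_Times)
  have 1: "bounded_linear (\<lambda>x::'c. (x, 0::'d))" "bounded_linear (\<lambda>y::'d. (0::'c, y))"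
    by (intro bounded_linear_Pair bounded_linear_ident bounded_linear_zero)+
  have "smooth_on (S \<times> T) (\<lambda>z. (f (fst z), 0) + (0, g (snd z)))"
    by (intro smooth_on_add o smooth_on_bounded_linear[OF 1(1) o smooth_on_fst]
        smooth_on_bounded_linear[OF 1(2) o smooth_on_snd] assms)
  then show ?thesis by (simp add: map_prod_def case_prod_unfold)
qed

section \<open>Derivatives along lines and slices; symmetry of second derivatives\<close>

lemma has_vector_derivative_along_line:
  assumes "f differentiable (at (x + t *\<^sub>R v))"
  shows "((\<lambda>s. f (x + s *\<^sub>R v)) has_vector_derivative dd f (x + t *\<^sub>R v) v) (at t)"
proof -
  have 1: "((\<lambda>s. x + s *\<^sub>R v) has_derivative (\<lambda>s. s *\<^sub>R v)) (at t)"
    by (auto intro!: derivative_eq_intros)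
  have "((\<lambda>s. f (x + s *\<^sub>R v)) has_derivative (\<lambda>s. dd f (x + t *\<^sub>R v) (s *\<^sub>R v))) (at t)"
    using has_derivative_compose[OF 1 dd_works[OF assms]] .
  then show ?thesis
    using linear_frechet_derivative[OF assms] by (simp add: has_vector_derivative_def linear_scale)
qed

lemma has_real_derivative_along_line:
  fixes f :: "'e::real_normed_vector \<Rightarrow> real"
  assumes "f differentiable (at (x + t *\<^sub>R v))"
  shows "((\<lambda>s. f (x + s *\<^sub>R v)) has_real_derivative dd f (x + t *\<^sub>R v) v) (at t)"
  using has_vector_derivative_along_line[OF assms] by (simp add: has_real_derivative_iff_has_vector_derivative)

lemma dd_eq_0_if_constant_along_line:
  assumes "f differentiable (at x)" "open S" "x \<in> S" "\<And>t. x + t *\<^sub>R v \<in> S \<Longrightarrow> f (x + t *\<^sub>R v) = c"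
  shows "dd f x v = 0"
proof -
  have 1: "((\<lambda>s. f (x + s *\<^sub>R v)) has_vector_derivative dd f x v) (at 0)"
    using has_vector_derivative_along_line[of f x 0 v] assms by simp
  have "open ((\<lambda>s. x + s *\<^sub>R v) -` S)"
    using assms(2) by (auto intro!: open_vimage continuous_intros)
  then have "((\<lambda>s. c) has_vector_derivative dd f x v) (at 0)"
    using has_vector_derivative_transform_within_open[OF 1, of "(\<lambda>s. x + s *\<^sub>R v) -` S" "\<lambda>s. c"] assms by auto
  then show ?thesis using vector_derivative_unique_at[OF _ has_vector_derivative_const] by blast
qed

lemma fst_snd_along_line [simp]:
  "fst (z + t *\<^sub>R (u, v)) = fst z + t *\<^sub>R u" "snd (z + t *\<^sub>R (u, v)) = snd z + t *\<^sub>R v"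
  by auto

lemma dd_fst:
  assumes "f differentiable (at (fst z))"
  shows "dd (\<lambda>z. f (fst z)) z w = dd f (fst z) (fst w)"
  by (subst dd_eqI[OF has_derivative_compose[OF has_derivative_fst[OF has_derivative_ident] dd_works[OF assms]]]) simp

lemma dd_snd:
  assumes "f differentiable (at (snd z))"
  shows "dd (\<lambda>z. f (snd z)) z w = dd f (snd z) (snd w)"
  by (subst dd_eqI[OF has_derivative_compose[OF has_derivative_snd[OF has_derivative_ident] dd_works[OF assms]]]) simp

lemma dd_slice1:
  assumes "f differentiable (at (x, y))"
  shows "dd (\<lambda>x. f (x, y)) x u = dd f (x, y) (u, 0)" "(\<lambda>x. f (x, y)) differentiable (at x)"
proof -
  have 1: "((\<lambda>x. (x, y)) has_derivative (\<lambda>u. (u, 0))) (at x)" by (auto intro!: derivative_eq_intros)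
  note has_derivative_compose[OF 1 dd_works[OF assms]]
  from dd_eqI[OF this] this show "dd (\<lambda>x. f (x, y)) x u = dd f (x, y) (u, 0)" "(\<lambda>x. f (x, y)) differentiable (at x)"
    by (auto simp: differentiable_def)
qed

lemma dd_slice2:
  assumes "f differentiable (at (x, y))"
  shows "dd (\<lambda>y. f (x, y)) y u = dd f (x, y) (0, u)" "(\<lambda>y. f (x, y)) differentiable (at y)"
proof -
  have 1: "((\<lambda>y. (x, y)) has_derivative (\<lambda>u. (0, u))) (at y)" by (auto intro!: derivative_eq_intros)
  note has_derivative_compose[OF 1 dd_works[OF assms]]
  from dd_eqI[OF this] this show "dd (\<lambda>y. f (x, y)) y u = dd f (x, y) (0, u)" "(\<lambda>y. f (x, y)) differentiable (at y)"
    by (auto simp: differentiable_def)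
qed

text \<open>The second difference of f over the parallelogram spanned by h u and h v is symmetric in
  u and v. Applying the mean value theorem twice equates it with h^2 times either mixed derivative
  at some nearby point, and both mixed derivatives are continuous at x.\<close>

lemma smooth_on_symmetric:
  fixes f :: "'e::real_normed_vector \<Rightarrow> real"
  assumes "open S" "smooth_on S f" "x \<in> S"
  shows "dd (\<lambda>z. dd f z u) x v = dd (\<lambda>z. dd f z v) x u"
proof -
  have mv: "\<exists>s t. 0 < s \<and> s < h \<and> 0 < t \<and> t < h \<and>
      f (x + h *\<^sub>R u + h *\<^sub>R v) - f (x + h *\<^sub>R u) - f (x + h *\<^sub>R v) + f x
        = h * h * dd (\<lambda>z. dd f z u) (x + s *\<^sub>R u + t *\<^sub>R v) v"
    if h: "0 < h" and sub: "\<And>s t. 0 \<le> s \<Longrightarrow> s \<le> h \<Longrightarrow> 0 \<le> t \<Longrightarrow> t \<le> h \<Longrightarrow> x + s *\<^sub>R u + t *\<^sub>R v \<in> S" for h u v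
  proof -
    let ?p = "\<lambda>s. f ((x + h *\<^sub>R v) + s *\<^sub>R u) - f (x + s *\<^sub>R u)"
    have "\<exists>s. 0 < s \<and> s < h \<and> ?p h - ?p 0 = (h - 0) * (dd f ((x + h *\<^sub>R v) + s *\<^sub>R u) u - dd f (x + s *\<^sub>R u) u)"
    proof (rule MVT2)
      fix s assume s: "0 \<le> s" "s \<le> h"
      have "(x + h *\<^sub>R v) + s *\<^sub>R u \<in> S" "x + s *\<^sub>R u \<in> S"
        using sub[of s h] sub[of s 0] s h by (auto simp: algebra_simps)
      then show "(?p has_real_derivative (dd f ((x + h *\<^sub>R v) + s *\<^sub>R u) u - dd f (x + s *\<^sub>R u) u)) (at s)"
        by (intro DERIV_diff has_real_derivative_along_line smooth_on_differentiable[OF assms(2)])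
    qed (use h in auto)
    then obtain s where s: "0 < s" "s < h"
      "?p h - ?p 0 = h * (dd f ((x + h *\<^sub>R v) + s *\<^sub>R u) u - dd f (x + s *\<^sub>R u) u)" by auto
    let ?q = "\<lambda>t. dd f ((x + s *\<^sub>R u) + t *\<^sub>R v) u"
    have "\<exists>t. 0 < t \<and> t < h \<and> ?q h - ?q 0 = (h - 0) * dd (\<lambda>z. dd f z u) ((x + s *\<^sub>R u) + t *\<^sub>R v) v"
    proof (rule MVT2)
      fix t assume t: "0 \<le> t" "t \<le> h"
      have "(x + s *\<^sub>R u) + t *\<^sub>R v \<in> S" using sub[of s t] t s by auto
      then show "(?q has_real_derivative dd (\<lambda>z. dd f z u) ((x + s *\<^sub>R u) + t *\<^sub>R v) v) (at t)"
        by (intro has_real_derivative_along_line smooth_on_differentiable[OF smooth_on_dd[OF assms(2)]])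
    qed (use h in auto)
    then obtain t where t: "0 < t" "t < h" "?q h - ?q 0 = h * dd (\<lambda>z. dd f z u) ((x + s *\<^sub>R u) + t *\<^sub>R v) v" by auto
    then show ?thesis using s by (intro exI[of _ s] exI[of _ t]) (simp add: algebra_simps)
  qed
  have cont: "continuous (at x) (\<lambda>z. dd (\<lambda>z. dd f z u) z v)" for u v
    using smooth_on_continuous[OF smooth_on_dd[OF smooth_on_dd[OF assms(2)]]] assms
    by (simp add: continuous_on_eq_continuous_at)
  show ?thesis
  proof (rule ccontr)
    let ?a = "\<lambda>z. dd (\<lambda>z. dd f z u) z v" and ?b = "\<lambda>z. dd (\<lambda>z. dd f z v) z u"
    assume ne: "?a x \<noteq> ?b x"
    \<comment> \<open>Half of the gap: numbers that lie within e of the two values at x cannot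
      coincide.\<close>
    define e where "e = \<bar>?a x - ?b x\<bar> / 2"
    have e: "e > 0" using ne by (simp add: e_def)
    obtain d1 where d1: "d1 > 0" "\<And>z. dist z x < d1 \<Longrightarrow> dist (?a z) (?a x) < e"
      using cont[of u v] e unfolding continuous_at_eps_delta by blast
    obtain d2 where d2: "d2 > 0" "\<And>z. dist z x < d2 \<Longrightarrow> dist (?b z) (?b x) < e"
      using cont[of v u] e unfolding continuous_at_eps_delta by blast
    obtain d3 where d3: "d3 > 0" "ball x d3 \<subseteq> S" using assms openE by blast
    define d where "d = min d1 (min d2 d3)"
    \<comment> \<open>Small enough that s |u| + t |v| \<le> d / 2 for s, t \<le> h; the summand 1
      keeps the denominator positive when u = v = 0.\<close>
    define h where "h = d / (2 * (norm u + norm v + 1))"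
    have d: "d > 0" using d1 d2 d3 by (simp add: d_def)
    have nn: "norm u + norm v + 1 > 0" by (smt (verit) norm_ge_zero)
    then have h: "h > 0" using d by (simp add: h_def)
    have close: "dist (x + s *\<^sub>R u + t *\<^sub>R v) x < d" if "0 \<le> s" "s \<le> h" "0 \<le> t" "t \<le> h" for s t
    proof -
      have "norm (s *\<^sub>R u + t *\<^sub>R v) \<le> s * norm u + t * norm v"
        using norm_triangle_ineq[of "s *\<^sub>R u" "t *\<^sub>R v"] that by simp
      also have "\<dots> \<le> h * norm u + h * norm v" using that by (intro add_mono mult_right_mono) auto
      also have "\<dots> \<le> h * (norm u + norm v + 1)" using h by (simp add: algebra_simps)
      also have "\<dots> = d / 2" using nn by (simp add: h_def field_simps)
      finally show ?thesis using d by (simp add: dist_norm algebra_simps)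
    qed
    have inS: "x + s *\<^sub>R u + t *\<^sub>R v \<in> S" if "0 \<le> s" "s \<le> h" "0 \<le> t" "t \<le> h" for s t
      using close[OF that] d3(2) by (force simp: d_def dist_commute)
    obtain s t where st: "0 < s" "s < h" "0 < t" "t < h"
      "f (x + h *\<^sub>R u + h *\<^sub>R v) - f (x + h *\<^sub>R u) - f (x + h *\<^sub>R v) + f x = h * h * ?a (x + s *\<^sub>R u + t *\<^sub>R v)"
      using mv[OF h inS] by blast
    have inS': "x + s *\<^sub>R v + t *\<^sub>R u \<in> S" if "0 \<le> s" "s \<le> h" "0 \<le> t" "t \<le> h" for s t
      using inS[of t s] that by (simp add: algebra_simps)
    obtain s' t' where st': "0 < s'" "s' < h" "0 < t'" "t' < h"
      "f (x + h *\<^sub>R v + h *\<^sub>R u) - f (x + h *\<^sub>R v) - f (x + h *\<^sub>R u) + f x = h * h * ?b (x + s' *\<^sub>R v + t' *\<^sub>R u)"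
      using mv[OF h inS'] by blast
    have "h * h * ?a (x + s *\<^sub>R u + t *\<^sub>R v) = h * h * ?b (x + s' *\<^sub>R v + t' *\<^sub>R u)"
      using st(5) st'(5) by (simp add: algebra_simps)
    then have eq: "?a (x + s *\<^sub>R u + t *\<^sub>R v) = ?b (x + t' *\<^sub>R u + s' *\<^sub>R v)" using h by (simp add: algebra_simps)
    have "dist (?a (x + s *\<^sub>R u + t *\<^sub>R v)) (?a x) < e"
      using close[of s t] st by (intro d1) (auto simp: d_def)
    moreover have "dist (?b (x + t' *\<^sub>R u + s' *\<^sub>R v)) (?b x) < e"
      using close[of t' s'] st' by (intro d2) (auto simp: d_def)
    ultimately have "\<bar>?a x - ?b x\<bar> < 2 * e" using eq by (simp add: dist_real_def)
    then show False by (simp add: e_def)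
  qed
qed

section \<open>Inner products and orthonormal frames\<close>

lemma bilinear_linear:
  assumes "bilinear B"
  shows "linear (B u)" "linear (\<lambda>u. B u v)"
  using assms by (auto simp: bilinear_def)

lemma bilinear_sum_scale:
  assumes "bilinear B"
  shows "B (\<Sum>i\<in>I. c i *\<^sub>R f i) v = (\<Sum>i\<in>I. c i *\<^sub>R B (f i) v)"
    and "B u (\<Sum>i\<in>I. c i *\<^sub>R h i) = (\<Sum>i\<in>I. c i *\<^sub>R B u (h i))"
  using linear_sum[OF bilinear_linear(2)[OF assms, of v], of "\<lambda>i. c i *\<^sub>R f i" I]
    linear_sum[OF bilinear_linear(1)[OF assms, of u], of "\<lambda>i. c i *\<^sub>R h i" I]
  by (simp_all add: bilinear_lmul[OF assms] bilinear_rmul[OF assms])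

lemma bilinear_expand:
  assumes "bilinear B"
  shows "B u v = (\<Sum>b\<in>Basis. \<Sum>b'\<in>Basis. (u \<bullet> b) *\<^sub>R (v \<bullet> b') *\<^sub>R B b b')"
proof -
  have v: "B w v = (\<Sum>b'\<in>Basis. (v \<bullet> b') *\<^sub>R B w b')" for w
    using bilinear_sum_scale(2)[OF assms, of w "\<lambda>b. v \<bullet> b" "\<lambda>b. b" Basis] by (simp add: euclidean_representation)
  have "B u v = (\<Sum>b\<in>Basis. (u \<bullet> b) *\<^sub>R B b v)"
    using bilinear_sum_scale(1)[OF assms, of "\<lambda>b. u \<bullet> b" "\<lambda>b. b" Basis v] by (simp add: euclidean_representation)
  then show ?thesis by (simp only: v scaleR_sum_right)
qed

definition inner_form :: "('e::euclidean_space \<Rightarrow> 'e \<Rightarrow> real) \<Rightarrow> bool" where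
  "inner_form G \<longleftrightarrow> bilinear G \<and> (\<forall>u v. G u v = G v u) \<and> (\<forall>u. u \<noteq> 0 \<longrightarrow> G u u > 0)"

lemma inner_form_scale: "inner_form G \<Longrightarrow> c > 0 \<Longrightarrow> inner_form (\<lambda>u v. c * G u v)"
  unfolding inner_form_def bilinear_def
  by (auto intro!: linear_compose_scale_right simp: linear_iff algebra_simps)

lemma inner_form_eqI:
  assumes "inner_form G" "\<And>w. G u w = G v w"
  shows "u = v"
proof (rule ccontr)
  assume "u \<noteq> v"
  have "G (u - v) (u - v) = G u (u - v) - G v (u - v)"
    using assms(1) by (simp add: inner_form_def bilinear_lsub)
  then have "G (u - v) (u - v) = 0" using assms(2) by simp
  moreover have "G (u - v) (u - v) > 0" using assms(1) \<open>u \<noteq> v\<close> by (simp add: inner_form_def)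
  ultimately show False by simp
qed

text \<open>Riesz representation, the source of all gradients below: \<open>?T\<close> packs the
  values of G v on the standard basis into a vector. Definiteness makes it injective, and equality
  of dimensions makes it onto.\<close>

lemma inner_form_representation:
  assumes G: "inner_form G" and l: "linear l"
  shows "\<exists>v. \<forall>w. G v w = l w"
proof -
  have bl: "bilinear G" using G by (simp add: inner_form_def)
  let ?T = "\<lambda>v. \<Sum>b\<in>Basis. G v b *\<^sub>R b"
  have "linear ?T"
    by (rule linear_compose_sum) (auto simp: linear_iff bilinear_ladd[OF bl] bilinear_lmul[OF bl] algebra_simps)
  moreover have "inj ?T"
  proof (rule injI)
    fix u v assume "?T u = ?T v"
    then have "G u b = G v b" if "b \<in> Basis" for b
      using that inner_sum_left_Basis[of b "\<lambda>b. G u b"] inner_sum_left_Basis[of b "\<lambda>b. G v b"] by simp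
    then have "G u = G v"
      by (intro linear_eq_stdbasis bilinear_linear[OF bl]) auto
    then show "u = v" using inner_form_eqI[OF G] by metis
  qed
  ultimately have "surj ?T" by (rule linear_inj_imp_surj)
  from surjD[OF this] obtain v where v: "(\<Sum>b\<in>Basis. l b *\<^sub>R b) = ?T v" ..
  have "G v b = l b" if "b \<in> Basis" for b
    using that v inner_sum_left_Basis[of b "\<lambda>b. G v b"] inner_sum_left_Basis[of b l] by simp
  then have "G v = l" by (intro linear_eq_stdbasis bilinear_linear[OF bl] l) auto
  then show ?thesis by auto
qed

definition orthonormal :: "('e::euclidean_space \<Rightarrow> 'e \<Rightarrow> real) \<Rightarrow> 'e set \<Rightarrow> bool" where
  "orthonormal G I \<longleftrightarrow> finite I \<and> (\<forall>e\<in>I. \<forall>e'\<in>I. G e e' = (if e = e' then 1 else 0))"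

text \<open>The expansion formula replaces the condition of spanning the space, being the
  consequence of it that traces and Parseval's identity use.\<close>

definition frame :: "('e::euclidean_space \<Rightarrow> 'e \<Rightarrow> real) \<Rightarrow> 'e set \<Rightarrow> bool" where
  "frame G I \<longleftrightarrow> orthonormal G I \<and> (\<forall>w. w = (\<Sum>e\<in>I. G w e *\<^sub>R e))"

lemma orthonormal_card_le:
  fixes G :: "'e::euclidean_space \<Rightarrow> 'e \<Rightarrow> real"
  assumes "bilinear G" "orthonormal G I"
  shows "card I \<le> DIM('e)"
proof -
  have "independent I"
  proof (rule independent_if_scalars_zero)
    show "finite I" using assms by (simp add: orthonormal_def)
    fix f e assume z: "(\<Sum>x\<in>I. f x *\<^sub>R x) = 0" and e: "e \<in> I"
    have "G (\<Sum>x\<in>I. f x *\<^sub>R x) e = (\<Sum>x\<in>I. f x * G x e)"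
      by (simp add: bilinear_sum_scale[OF assms(1)])
    also have "\<dots> = (\<Sum>x\<in>I. if x = e then f x else 0)"
      using assms(2) e by (intro sum.cong) (auto simp: orthonormal_def)
    also have "\<dots> = f e" using e assms(2) by (simp add: orthonormal_def)
    finally show "f e = 0" using z linear_0[OF bilinear_linear(2)[OF assms(1), of e]] by simp
  qed
  then show ?thesis by (rule independent_bound[THEN conjunct2])
qed

text \<open>Gram-Schmidt: an orthonormal set that is not yet a frame leaves some w with a nonzero
  remainder, and the normalized remainder enlarges the set. By \<open>orthonormal_card_le\<close>
  this cannot reach cardinality DIM + 1.\<close>

lemma frame_exists:
  fixes G :: "'e::euclidean_space \<Rightarrow> 'e \<Rightarrow> real"
  assumes G: "inner_form G"
  shows "\<exists>I. frame G I"
proof -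
  have bl: "bilinear G" and sym: "G u v = G v u" for u v using G by (auto simp: inner_form_def)
  have "(\<exists>I. frame G I) \<or> (\<exists>I. orthonormal G I \<and> card I = n)" for n
  proof (induction n)
    case 0 show ?case by (intro disjI2 exI[of _ "{}"]) (simp add: orthonormal_def)
  next
    case (Suc n)
    show ?case
    proof (cases "\<exists>I. frame G I")
      case False
      then obtain I where I: "orthonormal G I" "card I = n" using Suc by blast
      then obtain w where w: "w \<noteq> (\<Sum>e\<in>I. G w e *\<^sub>R e)" using False unfolding frame_def by blast
      define w' where "w' = w - (\<Sum>e\<in>I. G w e *\<^sub>R e)"
      have pos: "G w' w' > 0" using G w by (simp add: inner_form_def w'_def)
      have orth: "G w' e = 0" if e: "e \<in> I" for e
      proof -
        have "G (\<Sum>x\<in>I. G w x *\<^sub>R x) e = (\<Sum>x\<in>I. G w x * G x e)"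
          by (simp add: bilinear_sum_scale[OF bl])
        also have "\<dots> = (\<Sum>x\<in>I. if x = e then G w x else 0)"
          using I(1) e by (intro sum.cong) (auto simp: orthonormal_def)
        also have "\<dots> = G w e" using e I(1) by (simp add: orthonormal_def)
        finally show ?thesis by (simp add: w'_def bilinear_lsub[OF bl])
      qed
      define n' where "n' = (1 / sqrt (G w' w')) *\<^sub>R w'"
      have n1: "G n' n' = 1"
        using pos by (simp add: n'_def bilinear_lmul[OF bl] bilinear_rmul[OF bl])
      have n0: "G n' e = 0" "G e n' = 0" if "e \<in> I" for e
        using orth[OF that] sym[of e n'] by (simp_all add: n'_def bilinear_lmul[OF bl])
      have "n' \<notin> I" using n0(1) n1 by force
      then have "orthonormal G (insert n' I) \<and> card (insert n' I) = Suc n"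
        using I n0 n1 by (auto simp: orthonormal_def)
      then show ?thesis by blast
    qed auto
  qed
  from this[of "Suc DIM('e)"] show ?thesis using orthonormal_card_le[OF bl] by fastforce
qed

text \<open>Turns the coordinate trace that occurs in a divergence into a trace for G: expand the
  basis vector b in the frame, exchange the sums, and collect the coordinates of A e.\<close>

lemma trace_frame:
  assumes G: "bilinear G" and I: "frame G I" and A: "linear A"
  shows "(\<Sum>b\<in>Basis. A b \<bullet> b) = (\<Sum>e\<in>I. G (A e) e)"
proof -
  have fin: "finite I" using I by (simp add: frame_def orthonormal_def)
  have exp: "w = (\<Sum>e\<in>I. G w e *\<^sub>R e)" for w using I by (simp add: frame_def)
  have "(\<Sum>b\<in>Basis. A b \<bullet> b) = (\<Sum>b\<in>Basis. A (\<Sum>e\<in>I. G b e *\<^sub>R e) \<bullet> b)"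
    using exp by simp
  also have "\<dots> = (\<Sum>b\<in>Basis. \<Sum>e\<in>I. G b e * (A e \<bullet> b))"
    using A by (simp add: linear_sum linear_scale inner_sum_left)
  also have "\<dots> = (\<Sum>e\<in>I. \<Sum>b\<in>Basis. (A e \<bullet> b) * G b e)"
    by (subst sum.swap) (simp add: mult.commute)
  also have "\<dots> = (\<Sum>e\<in>I. G (\<Sum>b\<in>Basis. (A e \<bullet> b) *\<^sub>R b) e)"
    by (simp add: bilinear_sum_scale[OF G])
  finally show ?thesis by (simp add: euclidean_representation)
qed

text \<open>Ellipticity constants that depend on the bounds for G only, hence uniform in the point
  even if the frame is picked at each point without any continuity. The last estimate is
  Cauchy-Schwarz for w \<bullet> w, the sum of G w e * (e \<bullet> w), together with Parseval's
  identity for G w w.\<close>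

lemma frame_elliptic:
  fixes G :: "'e::euclidean_space \<Rightarrow> 'e \<Rightarrow> real"
  assumes G: "inner_form G" and I: "frame G I"
    and lower: "\<And>u. c * (u \<bullet> u) \<le> G u u" and upper: "\<And>u. G u u \<le> C * (u \<bullet> u)" and "c > 0" "C > 0"
  shows "finite I" "(\<Sum>e\<in>I. e \<bullet> e) \<le> DIM('e) / c" "(1 / C) * (w \<bullet> w) \<le> (\<Sum>e\<in>I. (e \<bullet> w)\<^sup>2)"
proof -
  have bl: "bilinear G" using G by (simp add: inner_form_def)
  show fin: "finite I" using I by (simp add: frame_def orthonormal_def)
  have "(\<Sum>e\<in>I. e \<bullet> e) \<le> (\<Sum>e\<in>I. 1 / c)"
  proof (rule sum_mono)
    fix e assume "e \<in> I"
    then have "G e e = 1" using I by (simp add: frame_def orthonormal_def)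
    then show "e \<bullet> e \<le> 1 / c" using lower[of e] \<open>c > 0\<close> by (simp add: field_simps)
  qed
  also have "\<dots> \<le> DIM('e) * (1 / c)"
    using orthonormal_card_le[OF bl, of I] I \<open>c > 0\<close> by (simp add: frame_def field_simps)
  finally show "(\<Sum>e\<in>I. e \<bullet> e) \<le> DIM('e) / c" by simp
  have exp: "w = (\<Sum>e\<in>I. G w e *\<^sub>R e)" for w using I by (simp add: frame_def)
  have "G w w = G w (\<Sum>e\<in>I. G w e *\<^sub>R e)" using exp[of w] by simp
  then have gw: "G w w = (\<Sum>e\<in>I. (G w e)\<^sup>2)"
    by (simp add: bilinear_sum_scale[OF bl] power2_eq_square)
  have "w \<bullet> w = (\<Sum>e\<in>I. G w e *\<^sub>R e) \<bullet> w" using exp[of w] by simp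
  then have ww: "w \<bullet> w = (\<Sum>e\<in>I. G w e * (e \<bullet> w))" by (simp add: inner_sum_left)
  have "(w \<bullet> w)\<^sup>2 \<le> (\<Sum>e\<in>I. (G w e)\<^sup>2) * (\<Sum>e\<in>I. (e \<bullet> w)\<^sup>2)"
    unfolding ww by (rule Cauchy_Schwarz_ineq_sum)
  also have "\<dots> \<le> (C * (w \<bullet> w)) * (\<Sum>e\<in>I. (e \<bullet> w)\<^sup>2)"
    using upper[of w] gw by (intro mult_right_mono sum_nonneg) auto
  finally have le: "(w \<bullet> w) * (w \<bullet> w) \<le> (w \<bullet> w) * (C * (\<Sum>e\<in>I. (e \<bullet> w)\<^sup>2))"
    by (simp add: power2_eq_square algebra_simps)
  show "(1 / C) * (w \<bullet> w) \<le> (\<Sum>e\<in>I. (e \<bullet> w)\<^sup>2)"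
  proof (cases "w = 0")
    case False
    then have "w \<bullet> w \<le> C * (\<Sum>e\<in>I. (e \<bullet> w)\<^sup>2)" using le by (simp add: mult_le_cancel_left)
    then show ?thesis using \<open>C > 0\<close> by (simp add: field_simps)
  qed simp
qed

section \<open>Bounds that are uniform over a compact set of points\<close>

lemma bilinear_uniform_bound:
  fixes B :: "'x::topological_space \<Rightarrow> 'e::euclidean_space \<Rightarrow> 'e \<Rightarrow> 'g::real_normed_vector"
  assumes K: "compact K" and bl: "\<And>x. x \<in> K \<Longrightarrow> bilinear (B x)"
    and cont: "\<And>u v. continuous_on K (\<lambda>x. B x u v)"
  shows "\<exists>C>0. \<forall>x\<in>K. \<forall>u v. norm (B x u v) \<le> C * (norm u * norm v)"
proof -
  have "\<exists>C. \<forall>x\<in>K. norm (B x b b') \<le> C" for b b'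
    using compact_imp_bounded[OF compact_continuous_image[OF cont[of b b'] K]] by (auto simp: bounded_iff)
  then obtain C where C: "\<And>b b' x. x \<in> K \<Longrightarrow> norm (B x b b') \<le> C b b'" by metis
  \<comment> \<open>The absolute values and the summand 1 make D positive whatever the bounds C
    are.\<close>
  define D where "D = (\<Sum>b\<in>Basis. \<Sum>b'\<in>Basis. \<bar>C b b'\<bar>) + 1"
  have "norm (B x u v) \<le> D * (norm u * norm v)" if x: "x \<in> K" for x u v
  proof -
    have "norm (B x u v) \<le> (\<Sum>b\<in>Basis. \<Sum>b'\<in>Basis. norm ((u \<bullet> b) *\<^sub>R (v \<bullet> b') *\<^sub>R B x b b'))"
      by (subst bilinear_expand[OF bl[OF x]]) (rule order_trans[OF norm_sum], rule sum_mono, rule norm_sum)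
    also have "\<dots> \<le> (\<Sum>b\<in>Basis. \<Sum>b'\<in>Basis. (norm u * norm v) * \<bar>C b b'\<bar>)"
    proof (intro sum_mono)
      fix b b' :: 'e assume b: "b \<in> Basis" "b' \<in> Basis"
      have "norm ((u \<bullet> b) *\<^sub>R (v \<bullet> b') *\<^sub>R B x b b') = (\<bar>u \<bullet> b\<bar> * \<bar>v \<bullet> b'\<bar>) * norm (B x b b')" by (simp add: abs_mult)
      also have "\<dots> \<le> (norm u * norm v) * \<bar>C b b'\<bar>"
        using C[OF x, of b b'] b by (intro mult_mono Basis_le_norm) auto
      finally show "norm ((u \<bullet> b) *\<^sub>R (v \<bullet> b') *\<^sub>R B x b b') \<le> (norm u * norm v) * \<bar>C b b'\<bar>" .
    qed
    also have "\<dots> = (norm u * norm v) * (\<Sum>b\<in>Basis. \<Sum>b'\<in>Basis. \<bar>C b b'\<bar>)"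
      by (simp add: sum_distrib_left)
    also have "\<dots> \<le> D * (norm u * norm v)" by (simp add: D_def algebra_simps)
    finally show ?thesis .
  qed
  moreover have "D > 0" by (simp add: D_def add_nonneg_pos sum_nonneg)
  ultimately show ?thesis by blast
qed

text \<open>A minimum over the compact set K x unit sphere is positive. Joint continuity in point
  and vector comes from the expansion \<open>rep\<close>, in which only finitely many coefficients
  depend on the point.\<close>

lemma inner_form_uniform_lower_bound:
  fixes G :: "'x::topological_space \<Rightarrow> 'e::euclidean_space \<Rightarrow> 'e \<Rightarrow> real"
  assumes K: "compact K" and G: "\<And>x. x \<in> K \<Longrightarrow> inner_form (G x)"
    and cont: "\<And>u v. continuous_on K (\<lambda>x. G x u v)"
  shows "\<exists>c>0. \<forall>x\<in>K. \<forall>u. c * (u \<bullet> u) \<le> G x u u"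
proof (cases "K = {}")
  case False
  have rep: "G x u u = (\<Sum>b\<in>Basis. \<Sum>b'\<in>Basis. (u \<bullet> b) * ((u \<bullet> b') * G x b b'))" if x: "x \<in> K" for x u
  proof -
    have "bilinear (G x)" using G[OF x] by (simp add: inner_form_def)
    from bilinear_expand[OF this, of u u] show ?thesis by simp
  qed
  let ?P = "K \<times> sphere (0::'e) 1"
  have "continuous_on ?P (\<lambda>p. \<Sum>b\<in>Basis. \<Sum>b'\<in>Basis. (snd p \<bullet> b) * ((snd p \<bullet> b') * G (fst p) b b'))"
    by (intro continuous_intros continuous_on_compose2[OF cont, of _ fst]) auto
  then have "continuous_on ?P (\<lambda>p. G (fst p) (snd p) (snd p))"
    by (rule continuous_on_eq) (use rep in auto)
  moreover have "compact ?P" "?P \<noteq> {}" using K False by (auto intro: compact_Times)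
  ultimately obtain p where p: "p \<in> ?P" "\<And>q. q \<in> ?P \<Longrightarrow> G (fst p) (snd p) (snd p) \<le> G (fst q) (snd q) (snd q)"
    using continuous_attains_inf[of ?P "\<lambda>p. G (fst p) (snd p) (snd p)"] by blast
  define c where "c = G (fst p) (snd p) (snd p)"
  have "snd p \<noteq> 0" using p(1) by auto
  then have "c > 0" using G[of "fst p"] p(1) by (auto simp: c_def inner_form_def)
  moreover have "c * (u \<bullet> u) \<le> G x u u" if x: "x \<in> K" for x u
  proof (cases "u = 0")
    case False
    have bl: "bilinear (G x)" using G[OF x] by (simp add: inner_form_def)
    have "c \<le> G x ((1 / norm u) *\<^sub>R u) ((1 / norm u) *\<^sub>R u)"
      using p(2)[of "(x, (1 / norm u) *\<^sub>R u)"] x False by (auto simp: c_def)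
    also have "\<dots> = G x u u / (u \<bullet> u)"
      by (simp add: bilinear_lmul[OF bl] bilinear_rmul[OF bl] dot_square_norm power2_eq_square)
    finally show ?thesis using False by (simp add: field_simps)
  next
    case True
    have bl: "bilinear (G x)" using G[OF x] by (simp add: inner_form_def)
    show ?thesis using True bilinear_lzero[OF bl] by simp
  qed
  ultimately show ?thesis by blast
qed (auto intro: exI[of _ 1])

section \<open>The strong maximum principle\<close>

text \<open>If the second derivative along v were positive, the first one, which vanishes at x,
  would be positive just beyond x, and the mean value theorem would produce a value above the
  maximum.\<close>

lemma second_derivative_at_max:
  fixes f :: "'e::euclidean_space \<Rightarrow> real"
  assumes "open S" "smooth_on S f" "x \<in> S" "\<And>y. y \<in> S \<Longrightarrow> f y \<le> f x"
  shows "dd f x v = 0" "dd (\<lambda>y. dd f y v) x v \<le> 0"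
proof -
  show 0: "dd f x v = 0" for v
    using differential_zero_maxmin[OF assms(3,1) smooth_on_has_derivative[OF assms(2,3)]] assms(4) by (simp add: fun_eq_iff)
  show "dd (\<lambda>y. dd f y v) x v \<le> 0"
  proof (rule ccontr)
    assume "\<not> ?thesis"
    moreover have "((\<lambda>t. dd f (x + t *\<^sub>R v) v) has_real_derivative dd (\<lambda>y. dd f y v) x v) (at 0)"
      using has_real_derivative_along_line[of "\<lambda>y. dd f y v" x 0 v]
        smooth_on_differentiable[OF smooth_on_dd[OF assms(2)] assms(3)] by simp
    ultimately obtain d where d: "d > 0" "\<And>h. 0 < h \<Longrightarrow> h < d \<Longrightarrow> dd f (x + h *\<^sub>R v) v > 0"
      using DERIV_pos_inc_right[of "\<lambda>t. dd f (x + t *\<^sub>R v) v" "dd (\<lambda>y. dd f y v) x v" 0] 0 by auto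
    have "open ((\<lambda>s. x + s *\<^sub>R v) -` S)" using assms(1) by (auto intro!: open_vimage continuous_intros)
    then obtain r where r: "r > 0" "ball 0 r \<subseteq> (\<lambda>s. x + s *\<^sub>R v) -` S"
      using assms(3) openE[of "(\<lambda>s. x + s *\<^sub>R v) -` S" 0] by auto
    define h where "h = min d r / 2"
    have h: "0 < h" "h < d" "h < r" using d r by (auto simp: h_def)
    have inS: "x + t *\<^sub>R v \<in> S" if "0 \<le> t" "t \<le> h" for t
      using r(2) that h by (force simp: dist_real_def)
    have "\<exists>s. 0 < s \<and> s < h \<and> f (x + h *\<^sub>R v) - f (x + 0 *\<^sub>R v) = (h - 0) * dd f (x + s *\<^sub>R v) v"
      by (rule MVT2[OF h(1)]) (intro has_real_derivative_along_line smooth_on_differentiable[OF assms(2)] inS)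
    then obtain s where "0 < s" "s < h" "f (x + h *\<^sub>R v) - f x = h * dd f (x + s *\<^sub>R v) v" by auto
    then have "f (x + h *\<^sub>R v) > f x" using d(2)[of s] h by (smt (verit) mult_pos_pos)
    then show False using assms(4)[OF inS[of h]] h by simp
  qed
qed

text \<open>\<open>L f = \<Sum>e\<in>I. D\<^sup>2f(e, e) + Df(\<beta>)\<close> is uniformly elliptic near every point, with \<open>I\<close> and \<open>\<beta>\<close> depending
  on the point in an arbitrary, possibly discontinuous way.\<close>
definition elliptic_subsolution :: "'e::euclidean_space set \<Rightarrow> ('e \<Rightarrow> real) \<Rightarrow> bool" where
  "elliptic_subsolution S f \<longleftrightarrow> (\<forall>x0\<in>S. \<exists>r>0. \<exists>c>0. \<exists>C. cball x0 r \<subseteq> S \<and> (\<forall>x\<in>cball x0 r. \<exists>I \<beta>.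
     finite I \<and> (\<Sum>e\<in>I. e \<bullet> e) \<le> C \<and> (\<forall>w. c * (w \<bullet> w) \<le> (\<Sum>e\<in>I. (e \<bullet> w)\<^sup>2)) \<and> norm \<beta> \<le> C \<and>
     0 \<le> (\<Sum>e\<in>I. dd (\<lambda>y. dd f y e) x e) + dd f x \<beta>))"

text \<open>Hopf's barrier \<open>exp (-a |x - p|\<^sup>2)\<close> is a strict subsolution for large \<open>a\<close>.\<close>
lemma strong_maximum_principle_local:
  fixes f :: "'e::euclidean_space \<Rightarrow> real"
  assumes S: "open S" and f: "smooth_on S f" and le: "\<And>x. x \<in> S \<Longrightarrow> f x \<le> M"
    and ell: "elliptic_subsolution S f" and x0: "x0 \<in> S" "f x0 = M"
  shows "\<exists>d>0. \<forall>x\<in>ball x0 d. x \<in> S \<and> f x = M"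
proof -
  obtain r c C where r: "r > 0" "c > 0" "cball x0 r \<subseteq> S" and
    L: "\<And>x. x \<in> cball x0 r \<Longrightarrow> \<exists>I \<beta>. finite I \<and> (\<Sum>e\<in>I. e \<bullet> e) \<le> C \<and>
     (\<forall>w. c * (w \<bullet> w) \<le> (\<Sum>e\<in>I. (e \<bullet> w)\<^sup>2)) \<and> norm \<beta> \<le> C \<and>
     0 \<le> (\<Sum>e\<in>I. dd (\<lambda>y. dd f y e) x e) + dd f x \<beta>"
    using ell x0(1) unfolding elliptic_subsolution_def by meson
  have C0: "C \<ge> 0" using L[of x0] r(1) by (smt (verit) norm_ge_zero centre_in_cball)
  \<comment> \<open>With radius r/4 the point z1 of the level set nearest to x1 lies within r/2 of
    x0, and the ball of radius \<delta> < r/4 about z1 stays inside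
    \<open>cball x0 r\<close>.\<close>
  have "f x1 = M" if x1: "x1 \<in> ball x0 (r/4)" for x1
  proof (rule ccontr)
    assume ne: "f x1 \<noteq> M"
    define Z where "Z = {z \<in> cball x0 r. f z = M}"
    have fc: "continuous_on (cball x0 r) f"
      using continuous_on_subset[OF smooth_on_continuous[OF f] r(3)] .
    have "closed Z" unfolding Z_def
      using continuous_closed_preimage_constant[OF fc] by simp
    moreover have "x0 \<in> Z" using x0 r by (simp add: Z_def)
    ultimately obtain z1 where z1: "z1 \<in> Z" "\<And>y. y \<in> Z \<Longrightarrow> dist x1 z1 \<le> dist x1 y"
      using distance_attains_inf[of Z x1] by blast
    define R where "R = dist x1 z1"
    have R: "R > 0" using ne z1(1) by (auto simp: R_def Z_def)
    have "x0 \<in> Z" using x0 r by (auto simp: Z_def)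
    then have R4: "R < r/4" using z1(2)[of x0] x1 by (simp add: R_def dist_commute)
    \<comment> \<open>Hopf's tangent ball: the open ball of radius R about x1 misses Z, and the
      closed ball of radius R / 2 about the midpoint touches its boundary in z1 alone. So f < M on
      the smaller ball except at z1.\<close>
    define x2 where "x2 = midpoint x1 z1"
    define \<rho> where "\<rho> = R / 2"
    have \<rho>: "\<rho> > 0" using R by (simp add: \<rho>_def)
    have d2: "dist x1 x2 = \<rho>" "dist z1 x2 = \<rho>"
      by (simp_all add: x2_def \<rho>_def R_def dist_midpoint)
    have z1x0: "dist z1 x0 < r/2"
      using dist_triangle[of z1 x0 x1] x1 R4 by (simp add: R_def dist_commute)
    \<comment> \<open>The centre x2, where the gradient of the barrier vanishes, keeps distance at
      least \<rho> / 2 from the ball of this radius about z1.\<close>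
    define \<delta> where "\<delta> = \<rho> / 2"
    have \<delta>: "\<delta> > 0" "\<delta> < r/4" using \<rho> R4 by (auto simp: \<delta>_def \<rho>_def)
    have sub: "cball z1 \<delta> \<subseteq> cball x0 r"
    proof
      fix y assume "y \<in> cball z1 \<delta>"
      then show "y \<in> cball x0 r" using dist_triangle[of x0 y z1] z1x0 \<delta> by (simp add: dist_commute)
    qed
    have lt: "f y < M" if y: "y \<in> cball x2 \<rho>" "y \<in> cball x0 r" "y \<noteq> z1" for y
    proof (rule ccontr)
      assume "\<not> f y < M"
      then have "y \<in> Z" using le[of y] y r by (force simp: Z_def)
      then have ge: "R \<le> dist x1 y" using z1(2) by (simp add: R_def)
      have y2: "norm (y - x2) \<le> \<rho>" using y(1) by (simp add: dist_norm norm_minus_commute)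
      define p where "p = x2 - x1"
      define q where "q = y - x2"
      have p: "norm p = \<rho>" using d2(1) by (simp add: p_def dist_norm norm_minus_commute)
      have q: "norm q \<le> \<rho>" using y2 by (simp add: q_def)
      have z1q: "z1 - x2 = p" by (simp add: p_def x2_def midpoint_def algebra_simps)
          (simp flip: scaleR_add_left)
      \<comment> \<open>Equality in the triangle inequality: p and q are parallel and of the same
        length, so y = x2 + p = z1.\<close>
      have "norm (p + q) \<ge> 2 * \<rho>" using ge by (simp add: p_def q_def dist_norm norm_minus_commute \<rho>_def)
      then have eq: "norm (p + q) = norm p + norm q" "norm q = \<rho>" using norm_triangle_ineq[of p q] p q by auto
      then have "norm p *\<^sub>R q = norm q *\<^sub>R p" using norm_triangle_eq[of p q] by simp
      then have "q = p" using p eq \<rho> by simp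
      then show False using z1q y(3) unfolding q_def by (metis diff_add_cancel)
    qed
    \<comment> \<open>Up to the factor E, the quadratic term of the barrier contributes at least 4
      a^2 c \<rho>^2 / 4 and the others at worst -2 a C - 2 a (3 \<rho> / 2) C; divided by a, this
      choice leaves a margin of 1.\<close>
    define a where "a = (2 * C + 3 * \<rho> * C + 1) / (c * \<rho>\<^sup>2)"
    have a: "a > 0" "a * (c * \<rho>\<^sup>2) = 2 * C + 3 * \<rho> * C + 1"
      using C0 \<rho> r by (auto simp: a_def add_nonneg_pos)
    define E where "E = (\<lambda>y. exp (- a * ((y - x2) \<bullet> (y - x2))))"
    define h where "h = (\<lambda>y. E y - exp (- a * \<rho>\<^sup>2))"
    have E_d: "(E has_derivative (\<lambda>v. E y * (- 2 * a * ((y - x2) \<bullet> v)))) (at y)" for y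
      unfolding E_def by (auto intro!: derivative_eq_intros simp: inner_commute algebra_simps)
    have dE: "dd h y v = E y * (- 2 * a * ((y - x2) \<bullet> v))" for y v
      using dd_eqI[OF has_derivative_diff[OF E_d has_derivative_const]] by (simp add: h_def)
    have ddE: "dd (\<lambda>y. dd h y v) y v = E y * (4 * a\<^sup>2 * ((y - x2) \<bullet> v)\<^sup>2 - 2 * a * (v \<bullet> v))" for y v
    proof -
      have "((\<lambda>y. E y * (- 2 * a * ((y - x2) \<bullet> v))) has_derivative
         (\<lambda>w. E y * (- 2 * a * (w \<bullet> v)) + (E y * (- 2 * a * ((y - x2) \<bullet> w))) * (- 2 * a * ((y - x2) \<bullet> v)))) (at y)"
        by (rule has_derivative_mult[OF E_d]) (auto intro!: derivative_eq_intros)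
      then show ?thesis unfolding dE by (subst dd_eqI) (auto simp: algebra_simps power2_eq_square)
    qed
    have h_smooth: "smooth_on S h"
      unfolding h_def E_def
      by (intro smooth_on_diff smooth_on_const smooth_on_exp smooth_on_mult smooth_on_inner smooth_on_ident S)
    \<comment> \<open>On this part of the small sphere f stays below some m < M, and on the rest h <
      0. So f + \<epsilon> h < M on the whole sphere for small \<epsilon>, while its value at z1 is
      M: the maximum over the ball is attained inside.\<close>
    define A where "A = sphere z1 \<delta> \<inter> cball x2 \<rho>"
    have A: "compact A" by (auto simp: A_def intro: compact_Int_closed)
    have AM: "f y < M" if "y \<in> A" for y
      using that lt[of y] sub \<delta> by (auto simp: A_def)
    obtain m where m: "m < M" "\<And>y. y \<in> A \<Longrightarrow> f y \<le> m"
    proof (cases "A = {}")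
      case True then show ?thesis using that[of "M - 1"] by auto
    next
      case False
      have "continuous_on A f" by (rule continuous_on_subset[OF fc]) (use sub in \<open>auto simp: A_def\<close>)
      then obtain y where "y \<in> A" "\<And>z. z \<in> A \<Longrightarrow> f z \<le> f y"
        using continuous_attains_sup[OF A False] by blast
      then show ?thesis using that[of "f y"] AM by auto
    qed
    \<comment> \<open>Since h \<le> 1, adding \<epsilon> h to a value \<le> m still gives less than
      M.\<close>
    define \<epsilon> where "\<epsilon> = (M - m) / 2"
    have \<epsilon>: "\<epsilon> > 0" "m + \<epsilon> < M" using m by (auto simp: \<epsilon>_def field_simps)
    define w where "w = (\<lambda>y. f y + \<epsilon> * h y)"
    have w_smooth: "smooth_on S w"
      unfolding w_def by (intro smooth_on_add smooth_on_mult smooth_on_const S f h_smooth)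
    have hz: "h z1 = 0" using d2 by (simp add: h_def E_def dist_norm dot_square_norm)
    have wz: "w z1 = M" using hz z1(1) by (simp add: w_def Z_def)
    have "continuous_on (cball z1 \<delta>) w"
      by (rule continuous_on_subset[OF smooth_on_continuous[OF w_smooth]]) (use sub r in auto)
    then obtain p where p: "p \<in> cball z1 \<delta>" "\<And>y. y \<in> cball z1 \<delta> \<Longrightarrow> w y \<le> w p"
      using continuous_attains_sup[of "cball z1 \<delta>" w] \<delta> by auto
    have wp: "w p \<ge> M" using p(2)[of z1] wz \<delta> by simp
    have pS: "p \<in> S" "p \<in> cball x0 r" using p(1) sub r by auto
    show False
    proof (cases "dist z1 p = \<delta>")
      case True
      show False
      proof (cases "p \<in> cball x2 \<rho>")
        case pin: True
        have "h p \<le> 1" using a by (simp add: h_def E_def add_increasing2 diff_le_eq)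
        then have "w p \<le> m + \<epsilon>" using m(2)[of p] True pin \<epsilon> by (auto simp: w_def A_def intro!: add_mono)
        then show False using wp \<epsilon> by simp
      next
        case False
        then have "\<rho> < norm (p - x2)" by (simp add: dist_norm norm_minus_commute)
        then have "\<rho>\<^sup>2 < (p - x2) \<bullet> (p - x2)" using \<rho> by (simp add: dot_square_norm power_strict_mono)
        then have "h p < 0" using a by (simp add: h_def E_def)
        then have "\<epsilon> * h p < 0" using \<epsilon> by (simp add: mult_less_0_iff)
        then show False using wp le[OF pS(1)] by (simp add: w_def)
      qed
    next
      case False
      then have pb: "p \<in> ball z1 \<delta>" using p(1) by simp
      have bS: "ball z1 \<delta> \<subseteq> S" using sub r(3) by (meson ball_subset_cball order_trans)
      note max = second_derivative_at_max[OF open_ball smooth_on_subset[OF w_smooth bS] pb]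
      have max1: "dd w p v = 0" "dd (\<lambda>y. dd w y v) p v \<le> 0" for v
        using max p(2) by auto
      obtain I \<beta> where I: "finite I" "(\<Sum>e\<in>I. e \<bullet> e) \<le> C" "\<And>w. c * (w \<bullet> w) \<le> (\<Sum>e\<in>I. (e \<bullet> w)\<^sup>2)"
        "norm \<beta> \<le> C" "0 \<le> (\<Sum>e\<in>I. dd (\<lambda>y. dd f y e) p e) + dd f p \<beta>" using L[OF pS(2)] by blast
      have dw: "dd w y v = dd f y v + \<epsilon> * dd h y v" if "y \<in> S" for y v
        unfolding w_def using smooth_on_has_derivative[OF f that] smooth_on_has_derivative[OF h_smooth that]
        by (subst dd_eqI) (auto intro!: derivative_eq_intros)
      have ddw: "dd (\<lambda>y. dd w y v) p v = dd (\<lambda>y. dd f y v) p v + \<epsilon> * dd (\<lambda>y. dd h y v) p v" for v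
      proof -
        have "dd (\<lambda>y. dd w y v) p = dd (\<lambda>y. dd f y v + \<epsilon> * dd h y v) p"
          by (rule dd_cong[OF S pS(1) dw])
        moreover have "((\<lambda>y. dd f y v + \<epsilon> * dd h y v) has_derivative
            (\<lambda>u. dd (\<lambda>y. dd f y v) p u + \<epsilon> * dd (\<lambda>y. dd h y v) p u)) (at p)"
          by (intro has_derivative_add has_derivative_mult_right smooth_on_has_derivative[OF smooth_on_dd[OF f] pS(1)]
              smooth_on_has_derivative[OF smooth_on_dd[OF h_smooth] pS(1)])
        ultimately show ?thesis by (simp add: dd_eqI)
      qed
      \<comment> \<open>At the interior maximum p the operator is nonpositive on w and nonnegative
        on f, hence nonpositive on h; the choice of a excludes this.\<close>
      have "(\<Sum>e\<in>I. dd (\<lambda>y. dd w y e) p e) + dd w p \<beta> \<le> 0"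
        using max1 by (simp add: sum_nonpos)
      then have neg: "(\<Sum>e\<in>I. dd (\<lambda>y. dd h y e) p e) + dd h p \<beta> \<le> 0"
        using I(5) \<epsilon>(1) unfolding ddw dw[OF pS(1)] sum.distrib sum_distrib_left[symmetric]
        by (smt (verit) mult_pos_pos distrib_left)
      define q where "q = p - x2"
      have "norm (z1 - x2) = \<rho>" using d2 by (simp add: dist_norm)
      moreover have "norm (p - z1) \<le> \<rho> / 2" using p(1) by (simp add: \<delta>_def dist_norm norm_minus_commute)
      moreover have "q = (p - z1) + (z1 - x2)" by (simp add: q_def)
      ultimately have q: "\<rho> / 2 \<le> norm q" "norm q \<le> 3 * \<rho> / 2"
        using norm_triangle_ineq[of "p - z1" "z1 - x2"] norm_triangle_ineq4[of q "p - z1"] by auto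
      have qq: "q \<bullet> q \<ge> \<rho>\<^sup>2 / 4" using power_mono[OF q(1), of 2] \<rho> by (simp add: dot_square_norm power_divide)
      have "(\<Sum>e\<in>I. dd (\<lambda>y. dd h y e) p e) + dd h p \<beta>
          = E p * (4 * a\<^sup>2 * (\<Sum>e\<in>I. (q \<bullet> e)\<^sup>2) - 2 * a * (\<Sum>e\<in>I. e \<bullet> e) - 2 * a * (q \<bullet> \<beta>))"
        unfolding ddE unfolding dE q_def[symmetric]
        by (simp add: sum_distrib_left sum_subtractf right_diff_distrib mult.assoc mult.left_commute)
      moreover have "E p > 0" by (simp add: E_def)
      ultimately have "4 * a\<^sup>2 * (\<Sum>e\<in>I. (q \<bullet> e)\<^sup>2) - 2 * a * (\<Sum>e\<in>I. e \<bullet> e) - 2 * a * (q \<bullet> \<beta>) \<le> 0"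
        using neg by (simp add: mult_le_0_iff)
      moreover have "4 * a\<^sup>2 * (\<Sum>e\<in>I. (q \<bullet> e)\<^sup>2) \<ge> 4 * a\<^sup>2 * (c * (\<rho>\<^sup>2 / 4))"
      proof (intro mult_left_mono)
        have "c * (\<rho>\<^sup>2 / 4) \<le> c * (q \<bullet> q)" using qq r(2) by (intro mult_left_mono) auto
        also have "\<dots> \<le> (\<Sum>e\<in>I. (q \<bullet> e)\<^sup>2)" using I(3)[of q] by (simp add: inner_commute)
        finally show "c * (\<rho>\<^sup>2 / 4) \<le> (\<Sum>e\<in>I. (q \<bullet> e)\<^sup>2)" .
      qed simp
      moreover have "2 * a * (\<Sum>e\<in>I. e \<bullet> e) \<le> 2 * a * C" using I(2) a by simp
      moreover have "2 * a * (q \<bullet> \<beta>) \<le> 2 * a * ((3 * \<rho> / 2) * C)"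
      proof (rule mult_left_mono)
        show "q \<bullet> \<beta> \<le> (3 * \<rho> / 2) * C"
          by (rule order_trans[OF norm_cauchy_schwarz mult_mono[OF q(2) I(4)]]) (use \<rho> in auto)
      qed (use a in simp)
      ultimately have "a * (a * (c * \<rho>\<^sup>2)) \<le> a * (2 * C + 3 * \<rho> * C)"
        by (simp add: power2_eq_square algebra_simps)
      then show False using a by simp
    qed
  qed
  moreover have "ball x0 (r/4) \<subseteq> S" using r by (force intro: subset_trans[OF _ r(3)])
  ultimately show ?thesis using r(1) by (intro exI[of _ "r/4"]) auto
qed

section \<open>Linear differential equations\<close>

text \<open>Picard iteration. A short interval is enough, since of a parallel field only the initial
  velocity will be exploited.\<close>

lemma linear_ode_exists:
  fixes A :: "real \<Rightarrow> 'e::euclidean_space \<Rightarrow> 'e"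
  assumes "s0 > 0" and lin: "\<And>t. t \<in> {0..s0} \<Longrightarrow> linear (A t)" and cont: "\<And>v. continuous_on {0..s0} (\<lambda>t. A t v)"
  shows "\<exists>s V. 0 < s \<and> s \<le> s0 \<and> V 0 = v \<and>
    (\<forall>t\<in>{0..s}. (V has_vector_derivative A t (V t)) (at t within {0..s}))"
proof -
  \<comment> \<open>Linearity reduces continuity and boundedness to the finitely many curves t
    \<mapsto> A t b.\<close>
  have rep: "A t u = (\<Sum>b\<in>Basis. (u \<bullet> b) *\<^sub>R A t b)" if "t \<in> {0..s0}" for t u
    using linear_sum[OF lin[OF that], of "\<lambda>b. (u \<bullet> b) *\<^sub>R b" Basis] linear_scale[OF lin[OF that]]
    by (simp add: euclidean_representation)
  have "\<exists>C. \<forall>t\<in>{0..s0}. norm (A t b) \<le> C" for b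
    using compact_imp_bounded[OF compact_continuous_image[OF cont[of b]]] by (auto simp: bounded_iff)
  then obtain C where C: "\<And>b t. t \<in> {0..s0} \<Longrightarrow> norm (A t b) \<le> C b" by metis
  define K where "K = (\<Sum>b\<in>Basis. \<bar>C b\<bar>) + 1"
  have K: "K > 0" by (simp add: K_def add_nonneg_pos sum_nonneg)
  have bound: "norm (A t u) \<le> K * norm u" if t: "t \<in> {0..s0}" for t u
  proof -
    have "norm (A t u) \<le> (\<Sum>b\<in>Basis. norm ((u \<bullet> b) *\<^sub>R A t b))" by (subst rep[OF t]) (rule norm_sum)
    also have "\<dots> \<le> (\<Sum>b\<in>Basis. norm u * \<bar>C b\<bar>)"
    proof (intro sum_mono)
      fix b :: 'e assume "b \<in> Basis"
      then show "norm ((u \<bullet> b) *\<^sub>R A t b) \<le> norm u * \<bar>C b\<bar>"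
        using C[OF t, of b] by (auto intro!: mult_mono Basis_le_norm)
    qed
    also have "\<dots> = norm u * (\<Sum>b\<in>Basis. \<bar>C b\<bar>)" by (simp add: sum_distrib_left)
    also have "\<dots> \<le> K * norm u" by (simp add: K_def algebra_simps)
    finally show ?thesis .
  qed
  \<comment> \<open>The bound s K \<le> 1/2 makes the integral operator T a contraction with
    constant 1/2.\<close>
  define s where "s = min s0 (1 / (2 * K))"
  have s: "0 < s" "s \<le> s0" "s * K \<le> 1/2" using K assms(1) by (auto simp: s_def min_def field_simps)
  \<comment> \<open>Clamping the time to {0..s} turns functions on the interval into bounded
    continuous functions on the real line, which form a complete space.\<close>
  define cl where "cl = (\<lambda>t. max 0 (min s t))"
  have cl: "cl t \<in> {0..s}" "t \<in> {0..s} \<Longrightarrow> cl t = t" for t using s by (auto simp: cl_def)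
  have AV: "continuous_on {0..s} (\<lambda>t. A t (V t))" if V: "continuous_on {0..s} V" for V
  proof -
    have "continuous_on {0..s} (\<lambda>t. \<Sum>b\<in>Basis. (V t \<bullet> b) *\<^sub>R A t b)"
      by (intro continuous_intros V continuous_on_subset[OF cont]) (use s in auto)
    then show ?thesis by (rule continuous_on_eq) (use s rep in auto)
  qed
  define T where "T = (\<lambda>V :: real \<Rightarrow>\<^sub>C 'e. Bcontfun (\<lambda>t. v + integral {0..cl t} (\<lambda>\<tau>. A \<tau> (apply_bcontfun V \<tau>))))"
  have int: "(\<lambda>\<tau>. A \<tau> (apply_bcontfun V \<tau>)) integrable_on {0..t}" if "t \<in> {0..s}" for V t
    by (rule integrable_continuous_real, rule continuous_on_subset[OF AV]) (use that in auto)
  have T: "apply_bcontfun (T V) t = v + integral {0..cl t} (\<lambda>\<tau>. A \<tau> (apply_bcontfun V \<tau>))" for V t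
  proof -
    let ?h = "\<lambda>t. v + integral {0..t} (\<lambda>\<tau>. A \<tau> (apply_bcontfun V \<tau>))"
    have ch: "continuous_on {0..s} ?h"
      by (intro continuous_intros indefinite_integral_continuous_1 int) (use s in auto)
    have "continuous_on UNIV (\<lambda>t. ?h (cl t))"
      by (rule continuous_on_compose2[OF ch]) (use cl in \<open>auto simp: cl_def intro!: continuous_intros\<close>)
    moreover have "\<exists>B. \<forall>t. norm (?h (cl t)) \<le> B"
      using compact_imp_bounded[OF compact_continuous_image[OF ch]] cl(1) by (force simp: bounded_iff)
    ultimately have "(\<lambda>t. ?h (cl t)) \<in> bcontfun" by (auto intro: bcontfun_normI)
    then show ?thesis by (simp add: T_def Bcontfun_inverse)
  qed
  have "\<exists>!V. T V = V"
  proof (rule banach_fix_type[of "1/2"])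
    show "\<forall>V W. dist (T V) (T W) \<le> 1/2 * dist V W"
    proof (intro allI dist_bound)
      fix V W :: "real \<Rightarrow>\<^sub>C 'e" and t :: real
      have "dist (apply_bcontfun (T V) t) (apply_bcontfun (T W) t) =
          norm (integral {0..cl t} (\<lambda>\<tau>. A \<tau> (apply_bcontfun V \<tau>)) - integral {0..cl t} (\<lambda>\<tau>. A \<tau> (apply_bcontfun W \<tau>)))"
        by (simp add: T dist_norm)
      also have "\<dots> = norm (integral {0..cl t} (\<lambda>\<tau>. A \<tau> (apply_bcontfun V \<tau>) - A \<tau> (apply_bcontfun W \<tau>)))"
        using integral_diff[OF int[OF cl(1)] int[OF cl(1)]] by simp
      also have "\<dots> \<le> (K * dist V W) * (cl t - 0)"
      proof (rule integral_bound)
        show "0 \<le> cl t" using cl[of t] by simp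
        show "continuous_on {0..cl t} (\<lambda>\<tau>. A \<tau> (apply_bcontfun V \<tau>) - A \<tau> (apply_bcontfun W \<tau>))"
          by (intro continuous_intros continuous_on_subset[OF AV[OF continuous_on_apply_bcontfun]]) (use cl[of t] in auto)
        fix \<tau> assume "\<tau> \<in> {0..cl t}"
        then have \<tau>: "\<tau> \<in> {0..s0}" using cl[of t] s by auto
        have "A \<tau> (apply_bcontfun V \<tau>) - A \<tau> (apply_bcontfun W \<tau>) = A \<tau> (apply_bcontfun V \<tau> - apply_bcontfun W \<tau>)"
          by (simp add: linear_diff[OF lin[OF \<tau>]])
        then have "norm (A \<tau> (apply_bcontfun V \<tau>) - A \<tau> (apply_bcontfun W \<tau>)) \<le> K * dist (apply_bcontfun V \<tau>) (apply_bcontfun W \<tau>)"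
          using bound[OF \<tau>] by (simp add: dist_norm)
        also have "\<dots> \<le> K * dist V W" using K by (simp add: dist_bounded)
        finally show "norm (A \<tau> (apply_bcontfun V \<tau>) - A \<tau> (apply_bcontfun W \<tau>)) \<le> K * dist V W" .
      qed
      also have "\<dots> \<le> (K * dist V W) * s" using cl[of t] K by (intro mult_left_mono) auto
      also have "\<dots> = (s * K) * dist V W" by simp
      also have "\<dots> \<le> 1/2 * dist V W" using s(3) by (intro mult_right_mono) auto
      finally show "dist (apply_bcontfun (T V) t) (apply_bcontfun (T W) t) \<le> 1/2 * dist V W" .
    qed
  qed auto
  then obtain V where V: "T V = V" by blast
  have Veq: "apply_bcontfun V t = v + integral {0..t} (\<lambda>\<tau>. A \<tau> (apply_bcontfun V \<tau>))" if "t \<in> {0..s}" for t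
    using T[of V t] V cl(2)[OF that] by simp
  have "(apply_bcontfun V has_vector_derivative A t (apply_bcontfun V t)) (at t within {0..s})" if t: "t \<in> {0..s}" for t
  proof (rule has_vector_derivative_transform[OF t Veq])
    show "((\<lambda>t. v + integral {0..t} (\<lambda>\<tau>. A \<tau> (apply_bcontfun V \<tau>))) has_vector_derivative A t (apply_bcontfun V t)) (at t within {0..s})"
      using integral_has_vector_derivative[OF AV[OF continuous_on_apply_bcontfun] t]
      by (auto intro!: derivative_eq_intros)
  qed
  moreover have "apply_bcontfun V 0 = v" using Veq[of 0] s by simp
  ultimately show ?thesis using s by blast
qed

section \<open>Ricci curvature of a doubly warped metric in a product chart\<close>

text \<open>\<^const>\<open>ricci\<close> depends on the Christoffel symbols in the given chart only, hence the dummy chart.\<close>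
definition ric :: "('e::euclidean_space \<Rightarrow> 'e \<Rightarrow> 'e \<Rightarrow> 'e) \<Rightarrow> 'e \<Rightarrow> 'e \<Rightarrow> 'e \<Rightarrow> real" where
  "ric \<Gamma> = ricci (\<lambda>_ :: (unit, 'e) chart. \<Gamma>) undefined"

lemma ricci_eq_ric: "ricci \<Gamma> \<phi> = ric (\<Gamma> \<phi>)"
  by (simp add: fun_eq_iff ric_def ricci_def curvature_def)

text \<open>One sum of derivatives is gathered into the derivative of the contracted symbol. For a
  Levi-Civita connection this contraction is the derivative of the logarithm of the volume density,
  which has a short closed form (\<open>trace_\<Gamma>\<close>).\<close>

lemma ric_expand:
  assumes d: "\<And>u v. (\<lambda>y. \<Gamma> y u v) differentiable (at z)"
  shows "ric \<Gamma> z v w = (\<Sum>b\<in>Basis. dd (\<lambda>y. \<Gamma> y v w) z b \<bullet> b) + (\<Sum>b\<in>Basis. \<Gamma> z b (\<Gamma> z v w) \<bullet> b)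
    - dd (\<lambda>y. \<Sum>b\<in>Basis. \<Gamma> y b w \<bullet> b) z v - (\<Sum>b\<in>Basis. \<Gamma> z v (\<Gamma> z b w) \<bullet> b)"
proof -
  have "((\<lambda>y. \<Sum>b\<in>Basis. \<Gamma> y b w \<bullet> b) has_derivative (\<lambda>h. \<Sum>b\<in>Basis. dd (\<lambda>y. \<Gamma> y b w) z h \<bullet> b)) (at z)"
    by (intro has_derivative_sum has_derivative_inner_left dd_works d)
  then have "dd (\<lambda>y. \<Sum>b\<in>Basis. \<Gamma> y b w \<bullet> b) z v = (\<Sum>b\<in>Basis. dd (\<lambda>y. \<Gamma> y b w) z v \<bullet> b)"
    by (simp add: dd_eqI)
  then show ?thesis
    by (simp add: ric_def ricci_def curvature_def inner_diff_left inner_add_left sum.distrib sum_subtractf)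
qed

lemma sum_Basis_prod:
  fixes F :: "'e::euclidean_space \<times> 'f::euclidean_space \<Rightarrow> 'e \<times> 'f"
  shows "(\<Sum>c\<in>Basis. F c \<bullet> c) = (\<Sum>b\<in>Basis. fst (F (b, 0)) \<bullet> b) + (\<Sum>b\<in>Basis. snd (F (0, b)) \<bullet> b)"
proof -
  have "(\<Sum>c\<in>Basis. F c \<bullet> c) = (\<Sum>c\<in>(\<lambda>u. (u, 0)) ` Basis. F c \<bullet> c) + (\<Sum>c\<in>(\<lambda>v. (0, v)) ` Basis. F c \<bullet> c)"
    unfolding Basis_prod_def by (rule sum.union_disjoint) auto
  also have "(\<Sum>c\<in>(\<lambda>u. (u, 0)) ` Basis. F c \<bullet> c) = (\<Sum>b\<in>Basis. fst (F (b, 0)) \<bullet> b)"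
    by (subst sum.reindex) (auto simp: inj_on_def inner_prod_def)
  also have "(\<Sum>c\<in>(\<lambda>v. (0, v)) ` Basis. F c \<bullet> c) = (\<Sum>b\<in>Basis. snd (F (0, b)) \<bullet> b)"
    by (subst sum.reindex) (auto simp: inj_on_def inner_prod_def)
  finally show ?thesis .
qed

lemma trace_scaleR: "(\<Sum>b\<in>(Basis :: 'e::euclidean_space set). (c *\<^sub>R b) \<bullet> b) = DIM('e) * c"
  by (simp add: inner_Basis)

lemma trace_rank_one:
  fixes v :: "'e::euclidean_space"
  assumes "linear l"
  shows "(\<Sum>b\<in>Basis. (l b *\<^sub>R v) \<bullet> b) = l v"
proof -
  have "l v = l (\<Sum>b\<in>Basis. (v \<bullet> b) *\<^sub>R b)" by (simp add: euclidean_representation)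
  also have "\<dots> = (\<Sum>b\<in>Basis. (v \<bullet> b) *\<^sub>R l b)" by (simp add: linear_sum[OF assms] linear_scale[OF assms])
  finally show ?thesis by (simp add: mult.commute)
qed

text \<open>Product rule for a family known through its values on fixed vectors: in the expansion
  over the standard basis, each summand is a product of differentiable functions.\<close>

lemma has_derivative_linear_family:
  fixes B :: "'z::real_normed_vector \<Rightarrow> 'e::euclidean_space \<Rightarrow> 'g::real_normed_vector"
  assumes "open S" "z \<in> S" and lin: "\<And>y. y \<in> S \<Longrightarrow> linear (B y)"
    and d: "\<And>u. (\<lambda>y. B y u) differentiable (at z)" and v: "(v has_derivative v') (at z)"
  shows "((\<lambda>y. B y (v y)) has_derivative (\<lambda>h. B z (v' h) + dd (\<lambda>y. B y (v z)) z h)) (at z)"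
proof -
  have rep: "B y u = (\<Sum>b\<in>Basis. (u \<bullet> b) *\<^sub>R B y b)" if "y \<in> S" for y u
    using linear_sum[OF lin[OF that], of "\<lambda>b. (u \<bullet> b) *\<^sub>R b" Basis] linear_scale[OF lin[OF that]]
    by (simp add: euclidean_representation)
  have "((\<lambda>y. \<Sum>b\<in>Basis. (v z \<bullet> b) *\<^sub>R B y b) has_derivative (\<lambda>h. \<Sum>b\<in>Basis. (v z \<bullet> b) *\<^sub>R dd (\<lambda>y. B y b) z h)) (at z)"
    by (intro has_derivative_sum has_derivative_scaleR_right dd_works d)
  then have 1: "dd (\<lambda>y. B y (v z)) z h = (\<Sum>b\<in>Basis. (v z \<bullet> b) *\<^sub>R dd (\<lambda>y. B y b) z h)" for h
    using dd_cong[OF assms(1,2), of "\<lambda>y. B y (v z)" "\<lambda>y. \<Sum>b\<in>Basis. (v z \<bullet> b) *\<^sub>R B y b"] rep by (simp add: dd_eqI)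
  have "((\<lambda>y. \<Sum>b\<in>Basis. (v y \<bullet> b) *\<^sub>R B y b) has_derivative
      (\<lambda>h. \<Sum>b\<in>Basis. (v z \<bullet> b) *\<^sub>R dd (\<lambda>y. B y b) z h + (v' h \<bullet> b) *\<^sub>R B z b)) (at z)"
    by (intro has_derivative_sum has_derivative_scaleR has_derivative_inner_left dd_works d v)
  moreover have "(\<Sum>b\<in>Basis. (v z \<bullet> b) *\<^sub>R dd (\<lambda>y. B y b) z h + (v' h \<bullet> b) *\<^sub>R B z b) = B z (v' h) + dd (\<lambda>y. B y (v z)) z h" for h
    by (simp add: 1 sum.distrib flip: rep[OF assms(2)])
  ultimately have "((\<lambda>y. \<Sum>b\<in>Basis. (v y \<bullet> b) *\<^sub>R B y b) has_derivative (\<lambda>h. B z (v' h) + dd (\<lambda>y. B y (v z)) z h)) (at z)"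
    by simp
  then show ?thesis
    by (rule has_derivative_transform_within_open[OF _ assms(1,2)]) (simp add: rep[symmetric])
qed

text \<open>Koszul's formula on coordinate fields, solved for the covariant derivative by choice
  instead of an inverse matrix; \<open>christoffel_eqI\<close> shows that any solution is the chosen
  one.\<close>

definition christoffel :: "('e::euclidean_space \<Rightarrow> 'e \<Rightarrow> 'e \<Rightarrow> real) \<Rightarrow> 'e \<Rightarrow> 'e \<Rightarrow> 'e \<Rightarrow> 'e" where
  "christoffel G x u v = (SOME k. \<forall>w. 2 * G x k w =
     dd (\<lambda>x. G x v w) x u + dd (\<lambda>x. G x u w) x v - dd (\<lambda>x. G x u v) x w)"

lemma christoffel_eqI:
  assumes "inner_form (G x)"
    "\<And>w. 2 * G x k w = dd (\<lambda>x. G x v w) x u + dd (\<lambda>x. G x u w) x v - dd (\<lambda>x. G x u v) x w"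
  shows "christoffel G x u v = k"
proof (rule inner_form_eqI[OF assms(1)])
  fix w
  have "2 * G x (christoffel G x u v) w = dd (\<lambda>x. G x v w) x u + dd (\<lambda>x. G x u w) x v - dd (\<lambda>x. G x u v) x w"
    unfolding christoffel_def by (rule someI[of _ k, THEN spec]) (use assms(2) in blast)
  then show "G x (christoffel G x u v) w = G x k w" using assms(2)[of w] by simp
qed

text \<open>The situation in one product chart after the splitting of F1: \<open>b\<close> lives on
  the second factor alone, \<open>f\<close> on both. The connection is given, and
  \<open>torsion\<close> with \<open>compat\<close> pins it down as the Levi-Civita connection of
  g.\<close>

locale warped_chart =
  fixes U :: "'e::euclidean_space set" and V :: "'f::euclidean_space set"
    and G1 :: "'e \<Rightarrow> 'e \<Rightarrow> 'e \<Rightarrow> real" and G2 :: "'f \<Rightarrow> 'f \<Rightarrow> 'f \<Rightarrow> real"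
    and b :: "'f \<Rightarrow> real" and f :: "'e \<times> 'f \<Rightarrow> real"
    and \<Gamma> :: "'e \<times> 'f \<Rightarrow> 'e \<times> 'f \<Rightarrow> 'e \<times> 'f \<Rightarrow> 'e \<times> 'f"
    and g :: "'e \<times> 'f \<Rightarrow> 'e \<times> 'f \<Rightarrow> 'e \<times> 'f \<Rightarrow> real"
  assumes U: "open U" and V: "open V"
    and G1: "\<And>x. x \<in> U \<Longrightarrow> inner_form (G1 x)" and G2: "\<And>y. y \<in> V \<Longrightarrow> inner_form (G2 y)"
    and G1_smooth: "\<And>u v. smooth_on U (\<lambda>x. G1 x u v)" and G2_smooth: "\<And>u v. smooth_on V (\<lambda>y. G2 y u v)"
    and b_smooth: "smooth_on V b" and f_smooth: "smooth_on (U \<times> V) f"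
    and bilin: "\<And>z. z \<in> U \<times> V \<Longrightarrow> bilinear (\<Gamma> z)" and \<Gamma>_smooth: "\<And>u v. smooth_on (U \<times> V) (\<lambda>z. \<Gamma> z u v)"
    and torsion: "\<And>z u v. z \<in> U \<times> V \<Longrightarrow> \<Gamma> z u v = \<Gamma> z v u"
    and g_eq: "\<And>z u v. z \<in> U \<times> V \<Longrightarrow>
      g z u v = exp (2 * b (snd z)) * G1 (fst z) (fst u) (fst v) + exp (2 * f z) * G2 (snd z) (snd u) (snd v)"
    and compat: "\<And>z u v w. z \<in> U \<times> V \<Longrightarrow> dd (\<lambda>z. g z v w) z u = g z (\<Gamma> z u v) w + g z v (\<Gamma> z u w)"
begin

text \<open>The gradient of b for g, as \<open>exp (2 * f z) * G2\<close> is g on the second factor.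
  Likewise \<open>grad_f\<close> is the component along the first factor of the gradient of
  f.\<close>

definition grad_b :: "'e \<times> 'f \<Rightarrow> 'f" where
  "grad_b z = (SOME v. \<forall>w. exp (2 * f z) * G2 (snd z) v w = dd b (snd z) w)"

definition grad_f :: "'e \<times> 'f \<Rightarrow> 'e" where
  "grad_f z = (SOME v. \<forall>w. exp (2 * b (snd z)) * G1 (fst z) v w = dd f z (w, 0))"

definition \<gamma>2 :: "'e \<times> 'f \<Rightarrow> 'f \<Rightarrow> 'f \<Rightarrow> 'f" where
  "\<gamma>2 z u v = snd (\<Gamma> z (0, u) (0, v))"

abbreviation "\<gamma>1 \<equiv> christoffel G1"

text \<open>A contracted Christoffel symbol is the derivative of the logarithm of the volume
  density; \<open>\<tau>1\<close> belongs to G1 and \<open>\<tau>2\<close> to G2.\<close>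

definition \<tau>1 :: "'e \<Rightarrow> 'e \<Rightarrow> real" where "\<tau>1 x u = (\<Sum>e\<in>Basis. \<gamma>1 x e u \<bullet> e)"
definition \<tau>2 :: "'f \<Rightarrow> 'f \<Rightarrow> real" where "\<tau>2 y u = (\<Sum>e\<in>Basis. christoffel G2 y e u \<bullet> e)"

section \<open>Christoffel symbols of the warped metric, block by block\<close>

lemma open_UV: "open (U \<times> V)" using U V by (simp add: open_Times)

context
  fixes z assumes z: "z \<in> U \<times> V"
begin

lemma fst_mem: "fst z \<in> U" and snd_mem: "snd z \<in> V" using z by auto

lemma bl1: "bilinear (G1 (fst z))" and bl2: "bilinear (G2 (snd z))"
  using G1[OF fst_mem] G2[OF snd_mem] by (auto simp: inner_form_def)

lemma sym1: "G1 (fst z) u v = G1 (fst z) v u" and sym2: "G2 (snd z) u' v' = G2 (snd z) v' u'"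
  using G1[OF fst_mem] G2[OF snd_mem] by (auto simp: inner_form_def)

lemma df: "(f has_derivative dd f z) (at z)" by (rule smooth_on_has_derivative[OF f_smooth z])
lemma db: "(b has_derivative dd b (snd z)) (at (snd z))" by (rule smooth_on_has_derivative[OF b_smooth snd_mem])
lemma lin_df: "linear (dd f z)" by (rule smooth_on_linear_dd[OF f_smooth z])
lemma lin_db: "linear (dd b (snd z))" by (rule smooth_on_linear_dd[OF b_smooth snd_mem])

lemma lin_df1: "linear (\<lambda>u. dd f z (u, 0))" and lin_df2: "linear (\<lambda>v. dd f z (0, v))"
proof -
  have "dd f z (u + u', 0) = dd f z (u, 0) + dd f z (u', 0)" "dd f z (0, v + v') = dd f z (0, v) + dd f z (0, v')" for u u' v v'
    using linear_add[OF lin_df, of "(u,0)" "(u',0)"] linear_add[OF lin_df, of "(0,v)" "(0,v')"] by auto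
  moreover have "dd f z (c *\<^sub>R u, 0) = c * dd f z (u, 0)" "dd f z (0, c *\<^sub>R v) = c * dd f z (0, v)" for c u v
    using linear_scale[OF lin_df, of c "(u,0)"] linear_scale[OF lin_df, of c "(0,v)"] by auto
  ultimately show "linear (\<lambda>u. dd f z (u, 0))" "linear (\<lambda>v. dd f z (0, v))" by (auto intro!: linearI)
qed

lemma df_split: "dd f z u = dd f z (fst u, 0) + dd f z (0, snd u)"
  using linear_add[OF lin_df, of "(fst u, 0)" "(0, snd u)"] by simp

lemma grad_b: "exp (2 * f z) * G2 (snd z) (grad_b z) w = dd b (snd z) w"
proof -
  obtain v where "\<forall>w. exp (2 * f z) * G2 (snd z) v w = dd b (snd z) w"
    using inner_form_representation[OF inner_form_scale[OF G2[OF snd_mem]] lin_db, of "exp (2 * f z)"] by auto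
  then show ?thesis unfolding grad_b_def by (rule someI2) blast
qed

lemma grad_f: "exp (2 * b (snd z)) * G1 (fst z) (grad_f z) w = dd f z (w, 0)"
proof -
  obtain v where "\<forall>w. exp (2 * b (snd z)) * G1 (fst z) v w = dd f z (w, 0)"
    using inner_form_representation[OF inner_form_scale[OF G1[OF fst_mem]] lin_df1, of "exp (2 * b (snd z))"] by auto
  then show ?thesis unfolding grad_f_def by (rule someI2) blast
qed

lemma dg: "dd (\<lambda>z. g z v w) z u =
    exp (2 * b (snd z)) * (2 * dd b (snd z) (snd u) * G1 (fst z) (fst v) (fst w) + dd (\<lambda>x. G1 x (fst v) (fst w)) (fst z) (fst u))
  + exp (2 * f z) * (2 * dd f z u * G2 (snd z) (snd v) (snd w) + dd (\<lambda>y. G2 y (snd v) (snd w)) (snd z) (snd u))"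
proof -
  have 1: "((\<lambda>z. G1 (fst z) (fst v) (fst w)) has_derivative (\<lambda>u. dd (\<lambda>x. G1 x (fst v) (fst w)) (fst z) (fst u))) (at z)"
    by (rule has_derivative_compose[OF has_derivative_fst[OF has_derivative_ident] smooth_on_has_derivative[OF G1_smooth fst_mem]])
  have 2: "((\<lambda>z. G2 (snd z) (snd v) (snd w)) has_derivative (\<lambda>u. dd (\<lambda>y. G2 y (snd v) (snd w)) (snd z) (snd u))) (at z)"
    by (rule has_derivative_compose[OF has_derivative_snd[OF has_derivative_ident] smooth_on_has_derivative[OF G2_smooth snd_mem]])
  have 3: "((\<lambda>z. b (snd z)) has_derivative (\<lambda>u. dd b (snd z) (snd u))) (at z)"
    by (rule has_derivative_compose[OF has_derivative_snd[OF has_derivative_ident] db])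
  have "((\<lambda>z. exp (2 * b (snd z)) * G1 (fst z) (fst v) (fst w) + exp (2 * f z) * G2 (snd z) (snd v) (snd w)) has_derivative
     (\<lambda>u. exp (2 * b (snd z)) * (2 * dd b (snd z) (snd u) * G1 (fst z) (fst v) (fst w) + dd (\<lambda>x. G1 x (fst v) (fst w)) (fst z) (fst u))
  + exp (2 * f z) * (2 * dd f z u * G2 (snd z) (snd v) (snd w) + dd (\<lambda>y. G2 y (snd v) (snd w)) (snd z) (snd u)))) (at z)"
    by (rule derivative_eq_intros 1 2 3 df refl)+ (simp add: algebra_simps)
  then show ?thesis using dd_cong[OF open_UV z g_eq] by (simp add: dd_eqI)
qed

lemma inner_g: "inner_form (g z)"
proof -
  have "bilinear (g z)"
    unfolding bilinear_def
    by (auto intro!: linearI simp: g_eq[OF z] bilinear_ladd[OF bl1] bilinear_ladd[OF bl2] bilinear_radd[OF bl1]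
      bilinear_radd[OF bl2] bilinear_lmul[OF bl1] bilinear_lmul[OF bl2] bilinear_rmul[OF bl1] bilinear_rmul[OF bl2] algebra_simps)
  moreover have "g z u u > 0" if "u \<noteq> 0" for u
  proof -
    have 1: "G1 (fst z) (fst u) (fst u) \<ge> 0" "fst u \<noteq> 0 \<Longrightarrow> G1 (fst z) (fst u) (fst u) > 0"
      using G1[OF fst_mem] bilinear_lzero[OF bl1] by (cases "fst u = 0"; force simp: inner_form_def)+
    have 2: "G2 (snd z) (snd u) (snd u) \<ge> 0" "snd u \<noteq> 0 \<Longrightarrow> G2 (snd z) (snd u) (snd u) > 0"
      using G2[OF snd_mem] bilinear_lzero[OF bl2] by (cases "snd u = 0"; force simp: inner_form_def)+
    have "fst u \<noteq> 0 \<or> snd u \<noteq> 0" using that by (auto simp: prod_eq_iff)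
    then show ?thesis using 1 2 by (auto simp: g_eq[OF z] add_pos_nonneg add_nonneg_pos)
  qed
  ultimately show ?thesis using sym1 sym2 by (simp add: inner_form_def g_eq[OF z])
qed

text \<open>Cyclic permutation of the compatibility equation. As g is definite, the formula
  determines \<Gamma>, and each block below is verified by pairing it with vectors of both
  factors.\<close>

lemma koszul: "2 * g z (\<Gamma> z u v) w = dd (\<lambda>z. g z v w) z u + dd (\<lambda>z. g z u w) z v - dd (\<lambda>z. g z u v) z w"
proof -
  have s: "g z u v = g z v u" for u v using inner_g unfolding inner_form_def by blast
  show ?thesis unfolding compat[OF z]
    using torsion[OF z, of u v] torsion[OF z, of u w] torsion[OF z, of v w] s[of v "\<Gamma> z u w"] s[of u "\<Gamma> z v w"] s[of w "\<Gamma> z u v"]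
      s[of "\<Gamma> z w u" v] s[of "\<Gamma> z w v" u]
    by (simp add: s)
qed

lemma lzero: "G1 (fst z) 0 v = 0" "G1 (fst z) v 0 = 0" "G2 (snd z) 0 w = 0" "G2 (snd z) w 0 = 0"
  using bilinear_lzero[OF bl1] bilinear_rzero[OF bl1] bilinear_lzero[OF bl2] bilinear_rzero[OF bl2] by auto

lemma dd_G_zero: "dd (\<lambda>x. G1 x 0 v) (fst z) u = 0" "dd (\<lambda>x. G1 x v 0) (fst z) u = 0"
  "dd (\<lambda>y. G2 y 0 w) (snd z) s = 0" "dd (\<lambda>y. G2 y w 0) (snd z) s = 0"
proof -
  have "bilinear (G1 x)" if "x \<in> U" for x using G1[OF that] by (simp add: inner_form_def)
  then show "dd (\<lambda>x. G1 x 0 v) (fst z) u = 0" "dd (\<lambda>x. G1 x v 0) (fst z) u = 0"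
    using dd_cong[OF U fst_mem, of "\<lambda>x. G1 x 0 v" "\<lambda>_. 0"] dd_cong[OF U fst_mem, of "\<lambda>x. G1 x v 0" "\<lambda>_. 0"]
    by (simp_all add: bilinear_lzero bilinear_rzero)
  have "bilinear (G2 y)" if "y \<in> V" for y using G2[OF that] by (simp add: inner_form_def)
  then show "dd (\<lambda>y. G2 y 0 w) (snd z) s = 0" "dd (\<lambda>y. G2 y w 0) (snd z) s = 0"
    using dd_cong[OF V snd_mem, of "\<lambda>y. G2 y 0 w" "\<lambda>_. 0"] dd_cong[OF V snd_mem, of "\<lambda>y. G2 y w 0" "\<lambda>_. 0"]
    by (simp_all add: bilinear_lzero bilinear_rzero)
qed

lemmas lin_zeros = linear_0[OF lin_df1] linear_0[OF lin_df2] linear_0[OF lin_db]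
  linear_0[OF smooth_on_linear_dd[OF G1_smooth fst_mem]] linear_0[OF smooth_on_linear_dd[OF G2_smooth snd_mem]]

lemma dg_11: "dd (\<lambda>z. g z (u, 0) (v, 0)) z (w, 0) = exp (2 * b (snd z)) * dd (\<lambda>x. G1 x u v) (fst z) w"
  and dg_112: "dd (\<lambda>z. g z (u, 0) (v, 0)) z (0, w') = exp (2 * b (snd z)) * 2 * dd b (snd z) w' * G1 (fst z) u v"
  and dg_12: "dd (\<lambda>z. g z (u, 0) (0, w')) z t = 0" "dd (\<lambda>z. g z (0, w') (u, 0)) z t = 0"
  and dg_22: "dd (\<lambda>z. g z (0, u') (0, v')) z (0, w') =
    exp (2 * f z) * (2 * dd f z (0, w') * G2 (snd z) u' v' + dd (\<lambda>y. G2 y u' v') (snd z) w')"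
  and dg_221: "dd (\<lambda>z. g z (0, u') (0, v')) z (w, 0) = exp (2 * f z) * 2 * dd f z (w, 0) * G2 (snd z) u' v'"
  by (simp_all add: dg lzero dd_G_zero lin_zeros)

text \<open>b does not depend on the first variable, so its exponential cancels from Koszul's
  formula.\<close>

lemma christoffel_G1: "fst (\<Gamma> z (u, 0) (v, 0)) = \<gamma>1 (fst z) u v"
proof (rule christoffel_eqI[of G1 "fst z", OF G1[OF fst_mem], symmetric])
  fix w show "2 * G1 (fst z) (fst (\<Gamma> z (u, 0) (v, 0))) w = dd (\<lambda>x. G1 x v w) (fst z) u + dd (\<lambda>x. G1 x u w) (fst z) v - dd (\<lambda>x. G1 x u v) (fst z) w"
    using koszul[of "(u,0)" "(v,0)" "(w,0)"] by (simp add: dg_11 g_eq[OF z] lzero flip: distrib_left right_diff_distrib)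
qed

lemma eq_by_g: "(\<And>w. 2 * g z k (w, 0) = 2 * g z l (w, 0)) \<Longrightarrow> (\<And>w. 2 * g z k (0, w) = 2 * g z l (0, w)) \<Longrightarrow> k = l"
proof (rule inner_form_eqI[OF inner_g])
  fix w assume 1: "\<And>w. 2 * g z k (w, 0) = 2 * g z l (w, 0)" and 2: "\<And>w. 2 * g z k (0, w) = 2 * g z l (0, w)"
  have "bilinear (g z)" using inner_g by (simp add: inner_form_def)
  then show "g z k w = g z l w"
    using bilinear_radd[of "g z" k "(fst w, 0)" "(0, snd w)"] bilinear_radd[of "g z" l "(fst w, 0)" "(0, snd w)"] 1 2 by simp
qed

text \<open>The second component is the second fundamental form of the slices M1 x {y}. They are
  umbilical, since the metric induced on them changes with y by the factor e^(2 b) only.\<close>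

lemma \<Gamma>_11: "\<Gamma> z (u, 0) (v, 0) = (\<gamma>1 (fst z) u v, - (exp (2 * b (snd z)) * G1 (fst z) u v) *\<^sub>R grad_b z)"
proof (rule eq_by_g)
  fix w
  show "2 * g z (\<Gamma> z (u, 0) (v, 0)) (w, 0) = 2 * g z (\<gamma>1 (fst z) u v, - (exp (2 * b (snd z)) * G1 (fst z) u v) *\<^sub>R grad_b z) (w, 0)"
    by (simp add: g_eq[OF z] lzero christoffel_G1)
next
  fix w
  have "exp (2 * f z) * (G2 (snd z) ((- (exp (2 * b (snd z)) * G1 (fst z) u v)) *\<^sub>R grad_b z) w) =
    - (exp (2 * b (snd z)) * G1 (fst z) u v) * (exp (2 * f z) * G2 (snd z) (grad_b z) w)"
    by (subst bilinear_lmul[OF bl2]) simp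
  then show "2 * g z (\<Gamma> z (u, 0) (v, 0)) (0, w) = 2 * g z (\<gamma>1 (fst z) u v, - (exp (2 * b (snd z)) * G1 (fst z) u v) *\<^sub>R grad_b z) (0, w)"
    unfolding koszul dg_11 dg_112 dg_12 by (simp add: g_eq[OF z] lzero grad_b)
qed

lemma \<Gamma>_12: "\<Gamma> z (u, 0) (0, w) = (dd b (snd z) w *\<^sub>R u, dd f z (u, 0) *\<^sub>R w)"
proof (rule eq_by_g)
  fix v
  show "2 * g z (\<Gamma> z (u, 0) (0, w)) (v, 0) = 2 * g z (dd b (snd z) w *\<^sub>R u, dd f z (u, 0) *\<^sub>R w) (v, 0)"
    unfolding koszul dg_11 dg_112 dg_12 by (simp add: g_eq[OF z] lzero bilinear_lmul[OF bl1])
next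
  fix v
  show "2 * g z (\<Gamma> z (u, 0) (0, w)) (0, v) = 2 * g z (dd b (snd z) w *\<^sub>R u, dd f z (u, 0) *\<^sub>R w) (0, v)"
    unfolding koszul dg_221 dg_12 by (simp add: g_eq[OF z] lzero bilinear_lmul[OF bl2])
qed

lemma \<Gamma>_21: "\<Gamma> z (0, w) (u, 0) = (dd b (snd z) w *\<^sub>R u, dd f z (u, 0) *\<^sub>R w)"
  by (subst torsion[OF z]) (rule \<Gamma>_12)

lemma \<Gamma>_22: "\<Gamma> z (0, u) (0, v) = (- (exp (2 * f z) * G2 (snd z) u v) *\<^sub>R grad_f z, \<gamma>2 z u v)"
proof (rule eq_by_g)
  fix w
  have "exp (2 * b (snd z)) * (G1 (fst z) ((- (exp (2 * f z) * G2 (snd z) u v)) *\<^sub>R grad_f z) w) =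
    - (exp (2 * f z) * G2 (snd z) u v) * (exp (2 * b (snd z)) * G1 (fst z) (grad_f z) w)"
    by (subst bilinear_lmul[OF bl1]) simp
  then show "2 * g z (\<Gamma> z (0, u) (0, v)) (w, 0) = 2 * g z (- (exp (2 * f z) * G2 (snd z) u v) *\<^sub>R grad_f z, \<gamma>2 z u v) (w, 0)"
    unfolding koszul dg_221 dg_12 by (simp add: g_eq[OF z] lzero grad_f)
next
  fix w
  show "2 * g z (\<Gamma> z (0, u) (0, v)) (0, w) = 2 * g z (- (exp (2 * f z) * G2 (snd z) u v) *\<^sub>R grad_f z, \<gamma>2 z u v) (0, w)"
    by (simp add: g_eq[OF z] lzero \<gamma>2_def)
qed

text \<open>\<open>\<gamma>2\<close> belongs to the metric e^(2 f) G2 on {x} x M2, so it differs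
  from the symbols of G2 by the conformal terms df(u) v + df(v) u - G2(u, v) h, with h the
  G2-gradient of f. Their traces add up to 1 + n2 - 1 = n2 times df.\<close>

lemma trace_\<gamma>2: "(\<Sum>e\<in>Basis. \<gamma>2 z e w \<bullet> e) = \<tau>2 (snd z) w + DIM('f) * dd f z (0, w)"
proof -
  obtain h where h: "\<And>w. G2 (snd z) h w = dd f z (0, w)"
    using inner_form_representation[OF G2[OF snd_mem] lin_df2] by auto
  have "christoffel G2 (snd z) u v = \<gamma>2 z u v - dd f z (0, u) *\<^sub>R v - dd f z (0, v) *\<^sub>R u + G2 (snd z) u v *\<^sub>R h" for u v
  proof (rule christoffel_eqI[of G2 "snd z", OF G2[OF snd_mem]])
    fix w
    have "exp (2 * f z) * (2 * G2 (snd z) (\<gamma>2 z u v) w) = exp (2 * f z) * (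
        2 * dd f z (0, u) * G2 (snd z) v w + dd (\<lambda>y. G2 y v w) (snd z) u
      + (2 * dd f z (0, v) * G2 (snd z) u w + dd (\<lambda>y. G2 y u w) (snd z) v)
      - (2 * dd f z (0, w) * G2 (snd z) u v + dd (\<lambda>y. G2 y u v) (snd z) w))"
      using koszul[of "(0,u)" "(0,v)" "(0,w)"] unfolding dg_22 by (simp add: g_eq[OF z] lzero \<gamma>2_def algebra_simps)
    then have "2 * G2 (snd z) (\<gamma>2 z u v) w =
        2 * dd f z (0, u) * G2 (snd z) v w + dd (\<lambda>y. G2 y v w) (snd z) u
      + (2 * dd f z (0, v) * G2 (snd z) u w + dd (\<lambda>y. G2 y u w) (snd z) v)
      - (2 * dd f z (0, w) * G2 (snd z) u v + dd (\<lambda>y. G2 y u v) (snd z) w)"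
      by (simp only: mult_cancel_left exp_not_eq_zero simp_thms)
    then show "2 * G2 (snd z) (\<gamma>2 z u v - dd f z (0, u) *\<^sub>R v - dd f z (0, v) *\<^sub>R u + G2 (snd z) u v *\<^sub>R h) w
      = dd (\<lambda>y. G2 y v w) (snd z) u + dd (\<lambda>y. G2 y u w) (snd z) v - dd (\<lambda>y. G2 y u v) (snd z) w"
      by (simp add: bilinear_ladd[OF bl2] bilinear_lsub[OF bl2] bilinear_lmul[OF bl2] h algebra_simps)
  qed
  then have "\<tau>2 (snd z) w = (\<Sum>e\<in>Basis. (\<gamma>2 z e w - dd f z (0, e) *\<^sub>R w - dd f z (0, w) *\<^sub>R e + G2 (snd z) e w *\<^sub>R h) \<bullet> e)"
    by (simp add: \<tau>2_def)
  also have "\<dots> = (\<Sum>e\<in>Basis. \<gamma>2 z e w \<bullet> e) - (\<Sum>e\<in>Basis. (dd f z (0, e) *\<^sub>R w) \<bullet> e)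
    - (\<Sum>e\<in>(Basis :: 'f set). (dd f z (0, w) *\<^sub>R e) \<bullet> e) + (\<Sum>e\<in>Basis. (G2 (snd z) e w *\<^sub>R h) \<bullet> e)"
    by (simp add: inner_add_left inner_diff_left sum.distrib sum_subtractf del: inner_scaleR_left)
  also have "\<dots> = (\<Sum>e\<in>Basis. \<gamma>2 z e w \<bullet> e) - DIM('f) * dd f z (0, w)"
    unfolding trace_rank_one[OF lin_df2] trace_rank_one[OF bilinear_linear(2)[OF bl2]] trace_scaleR h by simp
  finally show ?thesis by simp
qed

text \<open>In accordance with the volume density of g, which is e^(n1 b + n2 f) times those of G1
  and G2.\<close>

lemma trace_\<Gamma>:
  "(\<Sum>e\<in>Basis. \<Gamma> z e w \<bullet> e) = \<tau>1 (fst z) (fst w) + \<tau>2 (snd z) (snd w) + DIM('f) * dd f z w + DIM('e) * dd b (snd z) (snd w)"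
proof -
  have 1: "\<Gamma> z u w = \<Gamma> z u (fst w, 0) + \<Gamma> z u (0, snd w)" for u
    using bilinear_radd[OF bilin[OF z], of u "(fst w, 0)" "(0, snd w)"] by simp
  have "(\<Sum>e\<in>Basis. \<Gamma> z e w \<bullet> e) =
    (\<Sum>e\<in>Basis. \<gamma>1 (fst z) e (fst w) \<bullet> e) + (\<Sum>e\<in>(Basis :: 'e set). (dd b (snd z) (snd w) *\<^sub>R e) \<bullet> e)
    + ((\<Sum>e\<in>(Basis :: 'f set). (dd f z (fst w, 0) *\<^sub>R e) \<bullet> e) + (\<Sum>e\<in>Basis. \<gamma>2 z e (snd w) \<bullet> e))"
    unfolding sum_Basis_prod 1
    by (simp add: \<Gamma>_11 \<Gamma>_12 \<Gamma>_21 \<Gamma>_22 sum.distrib inner_add_left del: inner_scaleR_left)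
  then show ?thesis
    unfolding trace_scaleR trace_\<gamma>2 df_split[of w] by (simp add: \<tau>1_def algebra_simps)
qed

end

lemma \<Gamma>_differentiable: "z \<in> U \<times> V \<Longrightarrow> (\<lambda>z. \<Gamma> z u v) differentiable (at z)"
  by (rule smooth_on_differentiable[OF \<Gamma>_smooth])

text \<open>Smoothness is inherited from a component of the smooth connection on the slice over y,
  so the inverse of the metric never enters.\<close>

lemma \<gamma>1_smooth: "y \<in> V \<Longrightarrow> smooth_on U (\<lambda>x. \<gamma>1 x u v)"
  by (rule smooth_on_cong[OF U _ smooth_on_slice1[OF U _ smooth_on_bounded_linear[OF bounded_linear_fst open_UV \<Gamma>_smooth[of "(u,0)" "(v,0)"]]]])
    (use christoffel_G1[of "(_, y)"] in auto)

lemma bilinear_\<gamma>1: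
  assumes "y \<in> V" "x \<in> U"
  shows "bilinear (\<gamma>1 x)"
proof -
  have z: "(x, y) \<in> U \<times> V" using assms by simp
  have eq: "\<gamma>1 x u v = fst (\<Gamma> (x, y) (u, 0) (v, 0))" for u v using christoffel_G1[OF z] by simp
  have 1: "(u + v, 0::'f) = (u, 0) + (v, 0)" "(c *\<^sub>R u, 0::'f) = c *\<^sub>R (u, 0)" for u v :: 'e and c by auto
  show ?thesis unfolding bilinear_def eq
    by (auto intro!: linearI simp: 1 bilinear_ladd[OF bilin[OF z]] bilinear_radd[OF bilin[OF z]] bilinear_lmul[OF bilin[OF z]]
      bilinear_rmul[OF bilin[OF z]] simp del: add_Pair scaleR_Pair)
qed

end

lemma dd_fst_comp:
  assumes "F differentiable (at z)"
  shows "fst (dd F z h) = dd (\<lambda>z. fst (F z)) z h"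
  by (simp add: dd_eqI[OF has_derivative_fst[OF dd_works[OF assms]]])

lemma dd_snd_comp:
  assumes "F differentiable (at z)"
  shows "snd (dd F z h) = dd (\<lambda>z. snd (F z)) z h"
  by (simp add: dd_eqI[OF has_derivative_snd[OF dd_works[OF assms]]])

lemma Pair_eq_add: "(u :: 'a::monoid_add, v :: 'b::monoid_add) = (u, 0) + (0, v)"
  by simp

section \<open>Ricci curvature of the warped metric, and the Laplacians it contains\<close>

context warped_chart
begin

lemma scale1_smooth: "smooth_on (U \<times> V) (\<lambda>z. exp (2 * b (snd z)) * G1 (fst z) u v)"
  by (intro smooth_on_mult smooth_on_exp smooth_on_const open_UV
      smooth_on_snd[OF U V b_smooth] smooth_on_fst[OF U V G1_smooth])

lemma scale2_smooth: "smooth_on (U \<times> V) (\<lambda>z. exp (2 * f z) * G2 (snd z) u v)"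
  by (intro smooth_on_mult smooth_on_exp smooth_on_const open_UV f_smooth
      smooth_on_snd[OF U V G2_smooth])

text \<open>The block \<open>\<Gamma>_11\<close> contains the gradient with a factor that does not
  vanish for u = v \<noteq> 0; dividing by it expresses the gradient through the smooth connection.
  For \<open>grad_f\<close> the block \<open>\<Gamma>_22\<close> serves the same purpose.\<close>

lemma grad_b_smooth: "smooth_on (U \<times> V) grad_b"
proof -
  obtain u :: 'e where "u \<in> Basis" using nonempty_Basis by blast
  then have u: "u \<noteq> 0" by auto
  let ?c = "\<lambda>z. exp (2 * b (snd z)) * G1 (fst z) u u"
  have pos: "?c z > 0" if "z \<in> U \<times> V" for z
    using G1[of "fst z"] that u by (auto simp: inner_form_def)
  have "smooth_on (U \<times> V) (\<lambda>z. (- 1 / ?c z) *\<^sub>R snd (\<Gamma> z (u, 0) (u, 0)))"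
    by (intro smooth_on_scaleR smooth_on_divide smooth_on_const open_UV scale1_smooth
        smooth_on_bounded_linear[OF bounded_linear_snd open_UV \<Gamma>_smooth]) (use pos in fastforce)
  then show ?thesis
    by (rule smooth_on_cong[OF open_UV, rotated]) (use pos in \<open>fastforce simp: \<Gamma>_11\<close>)
qed

lemma grad_f_smooth: "smooth_on (U \<times> V) grad_f"
proof -
  obtain u :: 'f where "u \<in> Basis" using nonempty_Basis by blast
  then have u: "u \<noteq> 0" by auto
  let ?c = "\<lambda>z. exp (2 * f z) * G2 (snd z) u u"
  have pos: "?c z > 0" if "z \<in> U \<times> V" for z
    using G2[of "snd z"] that u by (auto simp: inner_form_def)
  have "smooth_on (U \<times> V) (\<lambda>z. (- 1 / ?c z) *\<^sub>R fst (\<Gamma> z (0, u) (0, u)))"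
    by (intro smooth_on_scaleR smooth_on_divide smooth_on_const open_UV scale2_smooth
        smooth_on_bounded_linear[OF bounded_linear_fst open_UV \<Gamma>_smooth]) (use pos in fastforce)
  then show ?thesis
    by (rule smooth_on_cong[OF open_UV, rotated]) (use pos in \<open>fastforce simp: \<Gamma>_22\<close>)
qed

text \<open>The Laplacian of b for g: the coordinate divergence of the gradient plus
  \<open>trace_\<Gamma>\<close> evaluated at it.\<close>

definition \<kappa> :: "'e \<times> 'f \<Rightarrow> real" where
  "\<kappa> z = (\<Sum>e\<in>Basis. dd grad_b z (0, e) \<bullet> e) + \<tau>2 (snd z) (grad_b z) + DIM('f) * dd f z (0, grad_b z)
     + DIM('e) * dd b (snd z) (grad_b z)"

context
  fixes z assumes z: "z \<in> U \<times> V"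
begin

lemma trace_\<Gamma>_pair:
  "(\<Sum>e\<in>Basis. \<Gamma> z e (u, v) \<bullet> e) = \<tau>1 (fst z) u + \<tau>2 (snd z) v + DIM('f) * (dd f z (u, 0) + dd f z (0, v)) + DIM('e) * dd b (snd z) v"
  using trace_\<Gamma>[OF z, of "(u, v)"] df_split[OF z, of "(u, v)"] by simp

lemma lin_\<gamma>2: "linear (\<gamma>2 z w)" "linear (\<lambda>u. \<gamma>2 z u w)"
proof -
  have 1: "(0::'e, u + v) = (0, u) + (0, v)" "(0::'e, c *\<^sub>R u) = c *\<^sub>R (0, u)" for u v :: 'f and c by auto
  show "linear (\<gamma>2 z w)" "linear (\<lambda>u. \<gamma>2 z u w)"
    by (auto intro!: linearI simp: \<gamma>2_def 1 bilinear_ladd[OF bilin[OF z]] bilinear_radd[OF bilin[OF z]] bilinear_lmul[OF bilin[OF z]]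
      bilinear_rmul[OF bilin[OF z]] simp del: add_Pair scaleR_Pair)
qed

lemma lin_\<tau>2: "linear (\<tau>2 (snd z))"
proof -
  have eq: "\<tau>2 (snd z) = (\<lambda>w. (\<Sum>e\<in>Basis. \<gamma>2 z e w \<bullet> e) - DIM('f) * dd f z (0, w))"
    using trace_\<gamma>2[OF z] by (simp add: fun_eq_iff)
  show ?thesis unfolding eq
    by (intro linearI) (simp_all add: linear_add[OF lin_\<gamma>2(1)] linear_scale[OF lin_\<gamma>2(1)] linear_add[OF lin_df2[OF z]]
      linear_scale[OF lin_df2[OF z]] inner_add_left sum.distrib algebra_simps sum_distrib_left)
qed

lemma bil_\<gamma>1: "bilinear (\<gamma>1 (fst z))"
  using bilinear_\<gamma>1[of "snd z" "fst z"] z by auto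

lemma \<gamma>1_sym: "\<gamma>1 (fst z) u v = \<gamma>1 (fst z) v u"
  using christoffel_G1[OF z, of u v] christoffel_G1[OF z, of v u] torsion[OF z, of "(u,0)" "(v,0)"] by simp

lemma lin_\<tau>1: "linear (\<tau>1 (fst z))"
  by (intro linearI) (simp_all add: \<tau>1_def bilinear_radd[OF bil_\<gamma>1] bilinear_rmul[OF bil_\<gamma>1] inner_add_left sum.distrib
    sum_distrib_left)

lemma \<gamma>1_differentiable: "(\<lambda>x. \<gamma>1 x u v) differentiable (at (fst z))"
  using smooth_on_differentiable[OF \<gamma>1_smooth[of "snd z"], of "fst z"] z by auto

end

context
  fixes z assumes z: "z \<in> U \<times> V"
begin

lemma db_snd: "((\<lambda>z. b (snd z)) has_derivative (\<lambda>h. dd b (snd z) (snd h))) (at z)"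
  by (rule has_derivative_compose[OF has_derivative_snd[OF has_derivative_ident] db[OF z]])

lemma G1_fst: "((\<lambda>z. G1 (fst z) u v) has_derivative (\<lambda>h. dd (\<lambda>x. G1 x u v) (fst z) (fst h))) (at z)"
  by (rule has_derivative_compose[OF has_derivative_fst[OF has_derivative_ident] smooth_on_has_derivative[OF G1_smooth fst_mem[OF z]]])

lemma G2_snd: "((\<lambda>z. G2 (snd z) u v) has_derivative (\<lambda>h. dd (\<lambda>y. G2 y u v) (snd z) (snd h))) (at z)"
  by (rule has_derivative_compose[OF has_derivative_snd[OF has_derivative_ident] smooth_on_has_derivative[OF G2_smooth snd_mem[OF z]]])

lemma grad_b': "(grad_b has_derivative dd grad_b z) (at z)" by (rule smooth_on_has_derivative[OF grad_b_smooth z])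
lemma grad_f': "(grad_f has_derivative dd grad_f z) (at z)" by (rule smooth_on_has_derivative[OF grad_f_smooth z])

lemma ddf: "((\<lambda>z. dd f z v) has_derivative dd (\<lambda>z. dd f z v) z) (at z)"
  by (rule smooth_on_has_derivative[OF smooth_on_dd[OF f_smooth] z])

lemma ddb: "((\<lambda>z. dd b (snd z) v) has_derivative (\<lambda>h. dd (\<lambda>y. dd b y v) (snd z) (snd h))) (at z)"
  by (rule has_derivative_compose[OF has_derivative_snd[OF has_derivative_ident] smooth_on_has_derivative[OF smooth_on_dd[OF b_smooth] snd_mem[OF z]]])

lemma div_\<Gamma>_11:
  "(\<Sum>e\<in>Basis. dd (\<lambda>z. \<Gamma> z (u, 0) (v, 0)) z e \<bullet> e) = (\<Sum>e\<in>Basis. dd (\<lambda>x. \<gamma>1 x u v) (fst z) e \<bullet> e)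
    - exp (2 * b (snd z)) * G1 (fst z) u v * ((\<Sum>e\<in>Basis. dd grad_b z (0, e) \<bullet> e) + 2 * dd b (snd z) (grad_b z))"
proof -
  let ?c = "\<lambda>z. exp (2 * b (snd z)) * G1 (fst z) u v"
  have 1: "fst (dd (\<lambda>z. \<Gamma> z (u, 0) (v, 0)) z (e, 0)) = dd (\<lambda>x. \<gamma>1 x u v) (fst z) e" for e
    unfolding dd_fst_comp[OF \<Gamma>_differentiable[OF z]]
    by (subst dd_cong[OF open_UV z christoffel_G1]) (simp_all add: dd_fst[OF \<gamma>1_differentiable[OF z]])
  have "((\<lambda>z. - ?c z *\<^sub>R grad_b z) has_derivative
      (\<lambda>h. - ?c z *\<^sub>R dd grad_b z h + (- (exp (2 * b (snd z)) * (2 * dd b (snd z) (snd h)) * G1 (fst z) u v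
         + exp (2 * b (snd z)) * dd (\<lambda>x. G1 x u v) (fst z) (fst h))) *\<^sub>R grad_b z)) (at z)"
    by (rule derivative_eq_intros db_snd G1_fst grad_b' refl)+ (simp add: algebra_simps)
  then have 2: "dd (\<lambda>z. - ?c z *\<^sub>R grad_b z) z (0, e) = - ?c z *\<^sub>R dd grad_b z (0, e) + (- 2 * ?c z) *\<^sub>R dd b (snd z) e *\<^sub>R grad_b z" for e
    by (simp add: dd_eqI lin_zeros[OF z] algebra_simps)
  have 3: "snd (dd (\<lambda>z. \<Gamma> z (u, 0) (v, 0)) z (0, e)) = - ?c z *\<^sub>R dd grad_b z (0, e) + (- 2 * ?c z) *\<^sub>R dd b (snd z) e *\<^sub>R grad_b z" for e
    unfolding dd_snd_comp[OF \<Gamma>_differentiable[OF z]] 2[symmetric]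
    by (subst dd_cong[OF open_UV z, of _ "\<lambda>z. - ?c z *\<^sub>R grad_b z"]) (simp_all add: \<Gamma>_11)
  have 4: "(\<Sum>e\<in>Basis. (- ?c z *\<^sub>R dd grad_b z (0, e) + (- 2 * ?c z) *\<^sub>R dd b (snd z) e *\<^sub>R grad_b z) \<bullet> e)
     = - ?c z * (\<Sum>e\<in>Basis. dd grad_b z (0, e) \<bullet> e) + (- 2 * ?c z) * (\<Sum>e\<in>Basis. (dd b (snd z) e *\<^sub>R grad_b z) \<bullet> e)"
    unfolding inner_add_left sum.distrib inner_scaleR_left[of "- ?c z"] inner_scaleR_left[of "- 2 * ?c z"] sum_distrib_left ..
  show ?thesis unfolding sum_Basis_prod 1 3 4 trace_rank_one[OF lin_db[OF z]] by (simp add: algebra_simps)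
qed

text \<open>Besides the curvature of G1 there remain, with minus signs, n2 e^-f Hess(e^f) along the
  slice, in the form n2 (Hess f + df \<otimes> df), and the Laplacian of b times the metric. The
  terms 2 |db|^2 of the divergence and of \<open>T4\<close> cancel.\<close>

theorem ric_11:
  "ric \<Gamma> z (u, 0) (v, 0) = ric \<gamma>1 (fst z) u v
    - DIM('f) * (dd (\<lambda>z. dd f z (v, 0)) z (u, 0) - dd f z (\<gamma>1 (fst z) u v, 0) + dd f z (u, 0) * dd f z (v, 0))
    - exp (2 * b (snd z)) * G1 (fst z) u v * \<kappa> z"
proof -
  let ?B = "exp (2 * b (snd z))"
  let ?c = "?B * G1 (fst z) u v"
  have T2: "(\<Sum>e\<in>Basis. \<Gamma> z e (\<Gamma> z (u, 0) (v, 0)) \<bullet> e) = \<tau>1 (fst z) (\<gamma>1 (fst z) u v) + DIM('f) * dd f z (\<gamma>1 (fst z) u v, 0)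
     - ?c * (\<tau>2 (snd z) (grad_b z) + DIM('f) * dd f z (0, grad_b z) + DIM('e) * dd b (snd z) (grad_b z))"
    unfolding \<Gamma>_11[OF z] trace_\<Gamma>_pair[OF z]
      linear_scale[OF lin_\<tau>2[OF z]] linear_scale[OF lin_df2[OF z]] linear_scale[OF lin_db[OF z]]
    by (simp add: algebra_simps)
  have \<tau>1_has: "(\<lambda>x. \<tau>1 x v) differentiable (at (fst z))"
  proof (rule differentiableI)
    show "((\<lambda>x. \<tau>1 x v) has_derivative (\<lambda>h. \<Sum>e\<in>Basis. dd (\<lambda>x. \<gamma>1 x e v) (fst z) h \<bullet> e)) (at (fst z))"
      unfolding \<tau>1_def by (intro has_derivative_sum has_derivative_inner_left dd_works \<gamma>1_differentiable z)
  qed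
  have "((\<lambda>z. \<tau>1 (fst z) v + DIM('f) * dd f z (v, 0)) has_derivative
     (\<lambda>h. dd (\<lambda>x. \<tau>1 x v) (fst z) (fst h) + DIM('f) * dd (\<lambda>z. dd f z (v, 0)) z h)) (at z)"
    by (intro has_derivative_add has_derivative_mult_right ddf
        has_derivative_compose[OF has_derivative_fst[OF has_derivative_ident] dd_works[OF \<tau>1_has]])
  then have T3: "dd (\<lambda>z. \<Sum>e\<in>Basis. \<Gamma> z e (v, 0) \<bullet> e) z (u, 0) = dd (\<lambda>x. \<tau>1 x v) (fst z) u + DIM('f) * dd (\<lambda>z. dd f z (v, 0)) z (u, 0)"
    by (subst dd_cong[OF open_UV z, of _ "\<lambda>z. \<tau>1 (fst z) v + DIM('f) * dd f z (v, 0)"])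
      (simp_all add: trace_\<Gamma> dd_eqI linear_0[OF lin_\<tau>2] linear_0[OF lin_db] )
  have f1: "fst (\<Gamma> z (u, 0) (\<Gamma> z (e, 0) (v, 0))) = \<gamma>1 (fst z) u (\<gamma>1 (fst z) e v) + (- ?B * dd b (snd z) (grad_b z)) *\<^sub>R (G1 (fst z) e v *\<^sub>R u)" for e
    unfolding \<Gamma>_11[OF z, of e v] by (subst Pair_eq_add) (simp add: bilinear_radd[OF bilin[OF z]] \<Gamma>_11[OF z] \<Gamma>_12[OF z]
      linear_neg[OF lin_db[OF z]] linear_scale[OF lin_db[OF z]] algebra_simps del: add_Pair)
  have f2: "snd (\<Gamma> z (u, 0) (\<Gamma> z (0, e) (v, 0))) = (- ?c) *\<^sub>R (dd b (snd z) e *\<^sub>R grad_b z) + (dd f z (u, 0) * dd f z (v, 0)) *\<^sub>R e" for e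
    unfolding \<Gamma>_21[OF z, of e v] by (subst Pair_eq_add) (simp add: bilinear_radd[OF bilin[OF z]] \<Gamma>_11[OF z] \<Gamma>_12[OF z]
      bilinear_rmul[OF bl1[OF z]] algebra_simps del: add_Pair)
  have T4: "(\<Sum>e\<in>Basis. \<Gamma> z (u, 0) (\<Gamma> z e (v, 0)) \<bullet> e) = (\<Sum>e\<in>Basis. \<gamma>1 (fst z) u (\<gamma>1 (fst z) e v) \<bullet> e)
      - 2 * ?c * dd b (snd z) (grad_b z) + DIM('f) * (dd f z (u, 0) * dd f z (v, 0))"
  proof -
    have "(\<Sum>e\<in>Basis. \<Gamma> z (u, 0) (\<Gamma> z e (v, 0)) \<bullet> e) =
       (\<Sum>e\<in>Basis. \<gamma>1 (fst z) u (\<gamma>1 (fst z) e v) \<bullet> e) + (- ?B * dd b (snd z) (grad_b z)) * (\<Sum>e\<in>Basis. (G1 (fst z) e v *\<^sub>R u) \<bullet> e)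
      + (- ?c * (\<Sum>e\<in>Basis. (dd b (snd z) e *\<^sub>R grad_b z) \<bullet> e) + (\<Sum>e\<in>(Basis :: 'f set). ((dd f z (u, 0) * dd f z (v, 0)) *\<^sub>R e) \<bullet> e))"
      unfolding sum_Basis_prod f1 f2 inner_add_left sum.distrib inner_scaleR_left[of "- ?B * dd b (snd z) (grad_b z)"]
        inner_scaleR_left[of "- ?c"] sum_distrib_left ..
    then show ?thesis
      unfolding trace_scaleR trace_rank_one[OF lin_db[OF z]] trace_rank_one[OF bilinear_linear(2)[OF bl1[OF z]]]
      by (simp add: algebra_simps)
  qed
  show ?thesis
    unfolding ric_expand[OF \<Gamma>_differentiable[OF z]] ric_expand[of \<gamma>1, OF \<gamma>1_differentiable[OF z]] div_\<Gamma>_11 T2 T3 T4 \<kappa>_def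
    unfolding \<tau>1_def by (simp add: algebra_simps)
qed

text \<open>The mixed second derivative of f occurs once in the divergence \<open>T1\<close> and n2
  times in \<open>T3\<close>, hence n2 - 1. The product df db occurs n1 + n2 times in
  \<open>T2\<close> and twice in \<open>T4\<close>, hence n1 + n2 - 2.\<close>

theorem ric_12:
  "ric \<Gamma> z (u, 0) (0, w) = - (real DIM('f) - 1) * dd (\<lambda>z. dd f z (u, 0)) z (0, w)
     + (real DIM('e) + real DIM('f) - 2) * dd f z (u, 0) * dd b (snd z) w"
proof -
  let ?B = "exp (2 * b (snd z))" and ?D = "dd (\<lambda>z. dd f z (u, 0)) z"
  have linD: "linear ?D" by (rule smooth_on_linear_dd[OF smooth_on_dd[OF f_smooth] z])
  have linD2: "linear (\<lambda>w. ?D (0, w))"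
  proof (rule linearI)
    show "?D (0, v + w) = ?D (0, v) + ?D (0, w)" for v w using linear_add[OF linD, of "(0,v)" "(0,w)"] by simp
    show "?D (0, c *\<^sub>R v) = c *\<^sub>R ?D (0, v)" for c v using linear_scale[OF linD, of c "(0,v)"] by simp
  qed
  have "((\<lambda>z. (dd b (snd z) w *\<^sub>R u, dd f z (u, 0) *\<^sub>R w)) has_derivative
      (\<lambda>h. (dd (\<lambda>y. dd b y w) (snd z) (snd h) *\<^sub>R u, ?D h *\<^sub>R w))) (at z)"
    by (intro has_derivative_Pair has_derivative_scaleR_left ddb ddf)
  then have "dd (\<lambda>z. \<Gamma> z (u, 0) (0, w)) z h = (dd (\<lambda>y. dd b y w) (snd z) (snd h) *\<^sub>R u, ?D h *\<^sub>R w)" for h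
    by (subst dd_cong[OF open_UV z \<Gamma>_12]) (simp_all add: dd_eqI)
  then have T1: "(\<Sum>e\<in>Basis. dd (\<lambda>z. \<Gamma> z (u, 0) (0, w)) z e \<bullet> e) = ?D (0, w)"
    using linear_0[OF smooth_on_linear_dd[OF smooth_on_dd[OF b_smooth] snd_mem[OF z]]]
    unfolding sum_Basis_prod using trace_rank_one[OF linD2] by simp
  have T2: "(\<Sum>e\<in>Basis. \<Gamma> z e (\<Gamma> z (u, 0) (0, w)) \<bullet> e) = dd b (snd z) w * \<tau>1 (fst z) u + dd f z (u, 0) * \<tau>2 (snd z) w
     + DIM('f) * (dd b (snd z) w * dd f z (u, 0) + dd f z (u, 0) * dd f z (0, w)) + DIM('e) * (dd f z (u, 0) * dd b (snd z) w)"
    unfolding \<Gamma>_12[OF z] trace_\<Gamma>_pair[OF z] linear_scale[OF lin_\<tau>1[OF z]]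
      linear_scale[OF lin_\<tau>2[OF z]] linear_scale[OF lin_df2[OF z]] linear_scale[OF lin_df1[OF z]] linear_scale[OF lin_db[OF z]]
    by (simp add: algebra_simps)
  let ?F = "\<lambda>z. \<Sum>e\<in>Basis. \<Gamma> z e (0, w) \<bullet> e"
  have "?F differentiable (at z)"
  proof (rule differentiableI)
    show "(?F has_derivative (\<lambda>h. \<Sum>e\<in>Basis. dd (\<lambda>z. \<Gamma> z e (0, w)) z h \<bullet> e)) (at z)"
      by (intro has_derivative_sum has_derivative_inner_left dd_works \<Gamma>_differentiable z)
  qed
  then have dF: "(?F has_derivative dd ?F z) (at z)" by (rule dd_works)
  have dH: "((\<lambda>z. ?F z - DIM('f) * dd f z (0, w)) has_derivative (\<lambda>h. dd ?F z h - DIM('f) * dd (\<lambda>z. dd f z (0, w)) z h)) (at z)"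
    by (intro has_derivative_diff has_derivative_mult_right ddf dF)
  \<comment> \<open>By \<open>trace_\<Gamma>\<close> only the term with f depends on the first
    variable; subtracting it leaves a function that is constant along (u, 0), so
    \<open>\<tau>2\<close> need not be differentiated.\<close>
  have "dd (\<lambda>z. ?F z - DIM('f) * dd f z (0, w)) z (u, 0) = 0"
  proof (rule dd_eq_0_if_constant_along_line[OF _ open_UV z])
    show "(\<lambda>z. ?F z - DIM('f) * dd f z (0, w)) differentiable (at z)" using dH by (auto simp: differentiable_def)
    fix t assume "z + t *\<^sub>R (u, 0) \<in> U \<times> V"
    from trace_\<Gamma>[OF this] linear_0[OF lin_\<tau>1[OF this]]
    show "?F (z + t *\<^sub>R (u, 0)) - DIM('f) * dd f (z + t *\<^sub>R (u, 0)) (0, w) = \<tau>2 (snd z) w + DIM('e) * dd b (snd z) w"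
      by simp
  qed
  then have T3: "dd ?F z (u, 0) = DIM('f) * ?D (0, w)"
    using smooth_on_symmetric[OF open_UV f_smooth z, of "(u,0)" "(0,w)"] by (simp add: dd_eqI[OF dH])
  have f1: "fst (\<Gamma> z (u, 0) (\<Gamma> z (e, 0) (0, w))) = dd b (snd z) w *\<^sub>R \<gamma>1 (fst z) e u + dd b (snd z) w *\<^sub>R (dd f z (e, 0) *\<^sub>R u)" for e
    unfolding \<Gamma>_12[OF z, of e w] by (subst Pair_eq_add) (simp add: bilinear_radd[OF bilin[OF z]] \<Gamma>_11[OF z] \<Gamma>_12[OF z]
      linear_scale[OF lin_db[OF z]] bilinear_rmul[OF bil_\<gamma>1[OF z]] \<gamma>1_sym[OF z, of u e] algebra_simps del: add_Pair)
  have f2: "snd (\<Gamma> z (u, 0) (\<Gamma> z (0, e) (0, w))) = (exp (2 * f z) * dd f z (u, 0)) *\<^sub>R (G2 (snd z) e w *\<^sub>R grad_b z) + dd f z (u, 0) *\<^sub>R \<gamma>2 z e w" for e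
  proof -
    have 0: "?B * G1 (fst z) u (grad_f z) = dd f z (u, 0)" using grad_f[OF z, of u] sym1[OF z] by simp
    then have 1: "?B * (G1 (fst z) u (grad_f z) * t) = dd f z (u, 0) * t" for t by (simp flip: mult.assoc)
    show ?thesis
      unfolding \<Gamma>_22[OF z, of e w]
      by (subst Pair_eq_add[of "- (exp (2 * f z) * G2 (snd z) e w) *\<^sub>R grad_f z"]) (simp add: bilinear_radd[OF bilin[OF z]] \<Gamma>_11[OF z] \<Gamma>_12[OF z]
        bilinear_rmul[OF bl1[OF z]] bilinear_rneg[OF bl1[OF z]] 0 1 mult.commute mult.left_commute del: add_Pair)
  qed
  have T4: "(\<Sum>e\<in>Basis. \<Gamma> z (u, 0) (\<Gamma> z e (0, w)) \<bullet> e) = dd b (snd z) w * \<tau>1 (fst z) u + dd b (snd z) w * dd f z (u, 0)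
      + (dd f z (u, 0) * dd b (snd z) w + dd f z (u, 0) * (\<tau>2 (snd z) w + DIM('f) * dd f z (0, w)))"
  proof -
    have "(\<Sum>e\<in>Basis. \<Gamma> z (u, 0) (\<Gamma> z e (0, w)) \<bullet> e) =
      dd b (snd z) w * (\<Sum>e\<in>Basis. \<gamma>1 (fst z) e u \<bullet> e) + dd b (snd z) w * (\<Sum>e\<in>Basis. (dd f z (e, 0) *\<^sub>R u) \<bullet> e)
      + ((exp (2 * f z) * dd f z (u, 0)) * (\<Sum>e\<in>Basis. (G2 (snd z) e w *\<^sub>R grad_b z) \<bullet> e) + dd f z (u, 0) * (\<Sum>e\<in>Basis. \<gamma>2 z e w \<bullet> e))"
      unfolding sum_Basis_prod f1 f2 inner_add_left sum.distrib inner_scaleR_left[of "dd b (snd z) w"]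
        inner_scaleR_left[of "exp (2 * f z) * dd f z (u, 0)"] inner_scaleR_left[of "dd f z (u, 0)" "\<gamma>2 z _ w"] sum_distrib_left ..
    then show ?thesis
      unfolding trace_rank_one[OF lin_df1[OF z]] trace_rank_one[OF bilinear_linear(2)[OF bl2[OF z]]] trace_\<gamma>2[OF z]
      unfolding \<tau>1_def[symmetric] using grad_b[OF z, of w] by (simp add: mult.commute mult.left_commute)
  qed
  show ?thesis
    unfolding ric_expand[OF \<Gamma>_differentiable[OF z]] T1 T2 T3 T4 by (simp add: algebra_simps)
qed

text \<open>For n2 = 1 the fibre has no curvature of its own and \<open>\<gamma>2\<close> is a
  number times w. The bracket after G2 is e^-f Lap(e^f) on the slice M1 x {y}; the rest is n1 e^-b
  times the second covariant derivative of e^b along the fibre.\<close>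

theorem ric_22:
  assumes dim: "DIM('f) = 1" and w: "w \<in> Basis"
  shows "ric \<Gamma> z (0, w) (0, w) =
    - (exp (2 * f z) * G2 (snd z) w w * ((\<Sum>e\<in>Basis. dd grad_f z (e, 0) \<bullet> e) + \<tau>1 (fst z) (grad_f z) + dd f z (grad_f z, 0)))
    - DIM('e) * (dd (\<lambda>y. dd b y w) (snd z) w + (dd b (snd z) w)\<^sup>2 - dd b (snd z) w * (\<gamma>2 z w w \<bullet> w))"
proof -
  let ?E = "\<lambda>z. exp (2 * f z) * G2 (snd z) w w" and ?s = "\<gamma>2 z w w \<bullet> w" and ?\<xi> = "grad_f z"
  have Basis: "(Basis :: 'f set) = {w}" using dim w by (metis card_1_singletonE singletonD)
  have sw: "\<gamma>2 z w w = ?s *\<^sub>R w"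
    using euclidean_representation[of "\<gamma>2 z w w"] by (simp add: Basis)
  have ww: "w \<bullet> w = 1" using w by simp
  have dE: "((\<lambda>z. - ?E z *\<^sub>R grad_f z) has_derivative
      (\<lambda>h. - ?E z *\<^sub>R dd grad_f z h + (- (exp (2 * f z) * (2 * dd f z h) * G2 (snd z) w w
         + exp (2 * f z) * dd (\<lambda>x. G2 x w w) (snd z) (snd h))) *\<^sub>R grad_f z)) (at z)"
    by (rule derivative_eq_intros df[OF z] G2_snd grad_f' refl)+ (simp add: algebra_simps)
  have dE': "dd (\<lambda>z. - ?E z *\<^sub>R grad_f z) z (e, 0) = (- ?E z) *\<^sub>R dd grad_f z (e, 0) + (- 2 * ?E z) *\<^sub>R (dd f z (e, 0) *\<^sub>R ?\<xi>)" for e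
    by (subst dd_eqI[OF dE]) (simp add: lin_zeros[OF z] algebra_simps)
  have 1: "fst (dd (\<lambda>z. \<Gamma> z (0, w) (0, w)) z (e, 0)) = (- ?E z) *\<^sub>R dd grad_f z (e, 0) + (- 2 * ?E z) *\<^sub>R (dd f z (e, 0) *\<^sub>R ?\<xi>)" for e
    unfolding dd_fst_comp[OF \<Gamma>_differentiable[OF z]] dE'[symmetric]
    by (subst dd_cong[OF open_UV z, of _ "\<lambda>z. - ?E z *\<^sub>R grad_f z"]) (simp_all add: \<Gamma>_22)
  \<comment> \<open>The derivative of the fibre component in the direction w is left unevaluated: it
    reappears in \<open>T3\<close> and cancels.\<close>
  have T1: "(\<Sum>e\<in>Basis. dd (\<lambda>z. \<Gamma> z (0, w) (0, w)) z e \<bullet> e) =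
     - ?E z * (\<Sum>e\<in>Basis. dd grad_f z (e, 0) \<bullet> e) + (- 2 * ?E z) * dd f z (?\<xi>, 0) + snd (dd (\<lambda>z. \<Gamma> z (0, w) (0, w)) z (0, w)) \<bullet> w"
    unfolding sum_Basis_prod 1 inner_add_left sum.distrib inner_scaleR_left[of "- ?E z"] inner_scaleR_left[of "- 2 * ?E z"]
      sum_distrib_left[symmetric] trace_rank_one[OF lin_df1[OF z]] by (simp add: Basis)
  have tr2: "\<tau>2 (snd z) w + dd f z (0, w) = \<gamma>2 z w w \<bullet> w" if "z \<in> U \<times> V" for z
    using trace_\<gamma>2[OF that, of w] dim by (simp add: Basis)
  have T2: "(\<Sum>e\<in>Basis. \<Gamma> z e (\<Gamma> z (0, w) (0, w)) \<bullet> e) = - ?E z * (\<tau>1 (fst z) ?\<xi> + dd f z (?\<xi>, 0)) + ?s * (?s + DIM('e) * dd b (snd z) w)"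
  proof -
    have eq: "\<Gamma> z (0, w) (0, w) = ((- ?E z) *\<^sub>R ?\<xi>, ?s *\<^sub>R w)" using \<Gamma>_22[OF z, of w w] sw by simp
    have st: "?s * \<tau>2 (snd z) w + ?s * dd f z (0, w) = ?s * ?s" using tr2[OF z] by (simp flip: distrib_left)
    show ?thesis
      unfolding eq trace_\<Gamma>_pair[OF z] linear_scale[OF lin_\<tau>1[OF z]] linear_scale[OF lin_\<tau>2[OF z]] linear_scale[OF lin_df2[OF z]]
        linear_scale[OF lin_df1[OF z]] linear_scale[OF lin_db[OF z]]
      using st dim by (simp add: algebra_simps)
  qed
  have sd: "((\<lambda>z. snd (\<Gamma> z (0, w) (0, w)) \<bullet> w + DIM('e) * dd b (snd z) w) has_derivative
      (\<lambda>h. snd (dd (\<lambda>z. \<Gamma> z (0, w) (0, w)) z h) \<bullet> w + DIM('e) * dd (\<lambda>y. dd b y w) (snd z) (snd h))) (at z)"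
    by (intro has_derivative_add has_derivative_inner_left has_derivative_snd dd_works \<Gamma>_differentiable z has_derivative_mult_right ddb)
  have T3: "dd (\<lambda>z. \<Sum>e\<in>Basis. \<Gamma> z e (0, w) \<bullet> e) z (0, w) = snd (dd (\<lambda>z. \<Gamma> z (0, w) (0, w)) z (0, w)) \<bullet> w + DIM('e) * dd (\<lambda>y. dd b y w) (snd z) w"
  proof (subst dd_cong[OF open_UV z, of _ "\<lambda>z. snd (\<Gamma> z (0, w) (0, w)) \<bullet> w + DIM('e) * dd b (snd z) w"])
    fix z' assume z': "z' \<in> U \<times> V"
    show "(\<Sum>e\<in>Basis. \<Gamma> z' e (0, w) \<bullet> e) = snd (\<Gamma> z' (0, w) (0, w)) \<bullet> w + DIM('e) * dd b (snd z') w"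
      using trace_\<Gamma>[OF z', of "(0, w)"] tr2[OF z'] dim linear_0[OF lin_\<tau>1[OF z']] by (simp add: \<gamma>2_def)
  qed (simp add: dd_eqI[OF sd])
  have f1: "fst (\<Gamma> z (0, w) (\<Gamma> z (e, 0) (0, w))) = (dd b (snd z) w)\<^sup>2 *\<^sub>R e + (- ?E z) *\<^sub>R (dd f z (e, 0) *\<^sub>R ?\<xi>)" for e
    unfolding \<Gamma>_12[OF z, of e w] by (subst Pair_eq_add) (simp add: bilinear_radd[OF bilin[OF z]] \<Gamma>_21[OF z] \<Gamma>_22[OF z]
      bilinear_rmul[OF bl2[OF z]] power2_eq_square algebra_simps del: add_Pair)
  have f2: "snd (\<Gamma> z (0, w) (\<Gamma> z (0, w) (0, w))) \<bullet> w = - ?E z * dd f z (?\<xi>, 0) + ?s * ?s"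
  proof -
    have "snd (\<Gamma> z (0, w) (\<Gamma> z (0, w) (0, w))) = dd f z (- (exp (2 * f z) * G2 (snd z) w w) *\<^sub>R ?\<xi>, 0) *\<^sub>R w + \<gamma>2 z w (?s *\<^sub>R w)"
      unfolding \<Gamma>_22[OF z, of w w] by (subst sw, subst Pair_eq_add) (simp add: bilinear_radd[OF bilin[OF z]] \<Gamma>_21[OF z] \<Gamma>_22[OF z] del: add_Pair)
    then show ?thesis
      unfolding linear_scale[OF lin_\<gamma>2(1)[OF z]] linear_scale[OF lin_df1[OF z]] by (simp add: inner_add_left inner_diff_left ww)
  qed
  have T4: "(\<Sum>e\<in>Basis. \<Gamma> z (0, w) (\<Gamma> z e (0, w)) \<bullet> e) = DIM('e) * (dd b (snd z) w)\<^sup>2 - 2 * ?E z * dd f z (?\<xi>, 0) + ?s * ?s"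
    unfolding sum_Basis_prod f1 inner_add_left sum.distrib inner_scaleR_left[of "- ?E z"] sum_distrib_left[symmetric]
      trace_scaleR trace_rank_one[OF lin_df1[OF z]] by (simp add: Basis f2)
  show ?thesis
    unfolding ric_expand[OF \<Gamma>_differentiable[OF z]] T1 T2 T3 T4 by (simp add: algebra_simps power2_eq_square)
qed

lemma \<gamma>1_metric: "dd (\<lambda>x. G1 x u v) (fst z) w = G1 (fst z) (\<gamma>1 (fst z) w u) v + G1 (fst z) u (\<gamma>1 (fst z) w v)"
proof -
  have "exp (2 * b (snd z)) * dd (\<lambda>x. G1 x u v) (fst z) w = exp (2 * b (snd z)) * (G1 (fst z) (\<gamma>1 (fst z) w u) v + G1 (fst z) u (\<gamma>1 (fst z) w v))"
    using compat[OF z, of "(u,0)" "(v,0)" "(w,0)"] unfolding dg_11[OF z]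
    by (simp add: g_eq[OF z] \<Gamma>_11[OF z] lzero[OF z] algebra_simps)
  then show ?thesis by simp
qed

text \<open>Divergence of the gradient versus trace of the Hessian. Differentiating the equation
  that defines \<open>grad_f\<close> and using \<open>\<gamma>1_metric\<close> identifies the
  covariant derivative of the gradient with the Hessian; the frame form is the one the maximum
  principle takes.\<close>

lemma laplacian_f:
  assumes I: "frame (\<lambda>u v. exp (2 * b (snd z)) * G1 (fst z) u v) I"
  shows "(\<Sum>e\<in>Basis. dd grad_f z (e, 0) \<bullet> e) + \<tau>1 (fst z) (grad_f z) =
    (\<Sum>e\<in>I. dd (\<lambda>z. dd f z (e, 0)) z (e, 0) - dd f z (\<gamma>1 (fst z) e e, 0))"
proof -
  let ?H = "\<lambda>u v. exp (2 * b (snd z)) * G1 (fst z) u v" and ?A = "\<lambda>u. dd grad_f z (u, 0) + \<gamma>1 (fst z) u (grad_f z)"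
  have H: "bilinear ?H" using inner_form_scale[OF G1[OF fst_mem[OF z]], of "exp (2 * b (snd z))"] by (simp add: inner_form_def)
  have lin: "linear (dd grad_f z)" by (rule smooth_on_linear_dd[OF grad_f_smooth z])
  have linA: "linear ?A"
  proof (rule linearI)
    show "?A (u + v) = ?A u + ?A v" for u v
      using linear_add[OF lin, of "(u,0)" "(v,0)"] by (simp add: bilinear_ladd[OF bil_\<gamma>1[OF z]])
    show "?A (c *\<^sub>R v) = c *\<^sub>R ?A v" for c v
      using linear_scale[OF lin, of c "(v,0)"] by (simp add: bilinear_lmul[OF bil_\<gamma>1[OF z]] scaleR_add_right)
  qed
  have HA: "?H (?A u) v = dd (\<lambda>z. dd f z (v, 0)) z (u, 0) - dd f z (\<gamma>1 (fst z) u v, 0)" for u v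
  proof -
    have fam: "((\<lambda>z. G1 (fst z) (grad_f z) v) has_derivative (\<lambda>h. G1 (fst z) (dd grad_f z h) v + dd (\<lambda>x. G1 (fst x) (grad_f z) v) z h)) (at z)"
    proof (rule has_derivative_linear_family[OF open_UV z, of "\<lambda>z u. G1 (fst z) u v"])
      show "linear (\<lambda>u. G1 (fst y) u v)" if "y \<in> U \<times> V" for y by (rule bilinear_linear(2)[OF bl1[OF that]])
      show "(\<lambda>y. G1 (fst y) u v) differentiable at z" for u using G1_fst by (auto simp: differentiable_def)
    qed (rule grad_f')
    have "((\<lambda>z. exp (2 * b (snd z)) * G1 (fst z) (grad_f z) v) has_derivative
       (\<lambda>h. exp (2 * b (snd z)) * (G1 (fst z) (dd grad_f z h) v + dd (\<lambda>x. G1 (fst x) (grad_f z) v) z h)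
         + (exp (2 * b (snd z)) * (2 * dd b (snd z) (snd h))) * G1 (fst z) (grad_f z) v)) (at z)"
      by (rule derivative_eq_intros db_snd fam refl)+ (simp add: algebra_simps)
    then have "dd (\<lambda>z. exp (2 * b (snd z)) * G1 (fst z) (grad_f z) v) z (u, 0) =
      exp (2 * b (snd z)) * (G1 (fst z) (dd grad_f z (u, 0)) v + dd (\<lambda>x. G1 x (grad_f z) v) (fst z) u)"
      by (simp add: dd_eqI dd_eqI[OF G1_fst] lin_zeros[OF z])
    moreover have "dd (\<lambda>z. exp (2 * b (snd z)) * G1 (fst z) (grad_f z) v) z = dd (\<lambda>z. dd f z (v, 0)) z"
      by (rule dd_cong[OF open_UV z grad_f])
    ultimately show ?thesis
      using grad_f[OF z, of "\<gamma>1 (fst z) u v"] by (simp add: \<gamma>1_metric bilinear_ladd[OF bl1[OF z]] algebra_simps)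
  qed
  have "(\<Sum>e\<in>Basis. dd grad_f z (e, 0) \<bullet> e) + \<tau>1 (fst z) (grad_f z) = (\<Sum>e\<in>Basis. ?A e \<bullet> e)"
    by (simp add: \<tau>1_def inner_add_left sum.distrib)
  also have "\<dots> = (\<Sum>e\<in>I. ?H (?A e) e)" by (rule trace_frame[OF H I linA])
  finally show ?thesis unfolding HA .
qed

text \<open>At a critical point the gradient vanishes, and with it every Christoffel term, so the
  sign of the coordinate second derivatives of b decides the sign of its Laplacian.\<close>

lemma \<kappa>_critical:
  assumes crit: "\<And>w. dd b (snd z) w = 0" and I: "frame (\<lambda>u v. exp (2 * f z) * G2 (snd z) u v) I"
  shows "\<kappa> z = (\<Sum>e\<in>I. dd (\<lambda>y. dd b y e) (snd z) e)"
proof -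
  let ?H = "\<lambda>u v. exp (2 * f z) * G2 (snd z) u v" and ?A = "\<lambda>u. dd grad_b z (0, u)"
  have iH: "inner_form ?H" using inner_form_scale[OF G2[OF snd_mem[OF z]], of "exp (2 * f z)"] by simp
  then have H: "bilinear ?H" by (simp add: inner_form_def)
  have g0: "grad_b z = 0"
    by (rule inner_form_eqI[OF iH]) (use grad_b[OF z] crit lzero[OF z] in auto)
  have lin: "linear (dd grad_b z)" by (rule smooth_on_linear_dd[OF grad_b_smooth z])
  have linA: "linear ?A"
  proof (rule linearI)
    show "?A (u + v) = ?A u + ?A v" for u v using linear_add[OF lin, of "(0,u)" "(0,v)"] by simp
    show "?A (c *\<^sub>R v) = c *\<^sub>R ?A v" for c v using linear_scale[OF lin, of c "(0,v)"] by simp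
  qed
  have HA: "?H (?A u) v = dd (\<lambda>y. dd b y v) (snd z) u" for u v
  proof -
    have fam: "((\<lambda>z. G2 (snd z) (grad_b z) v) has_derivative (\<lambda>h. G2 (snd z) (dd grad_b z h) v + dd (\<lambda>x. G2 (snd x) (grad_b z) v) z h)) (at z)"
    proof (rule has_derivative_linear_family[OF open_UV z, of "\<lambda>z u. G2 (snd z) u v"])
      show "linear (\<lambda>u. G2 (snd y) u v)" if "y \<in> U \<times> V" for y by (rule bilinear_linear(2)[OF bl2[OF that]])
      show "(\<lambda>y. G2 (snd y) u v) differentiable at z" for u using G2_snd by (auto simp: differentiable_def)
    qed (rule grad_b')
    have "((\<lambda>z. exp (2 * f z) * G2 (snd z) (grad_b z) v) has_derivative
       (\<lambda>h. exp (2 * f z) * (G2 (snd z) (dd grad_b z h) v + dd (\<lambda>x. G2 (snd x) (grad_b z) v) z h)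
         + (exp (2 * f z) * (2 * dd f z h)) * G2 (snd z) (grad_b z) v)) (at z)"
      by (rule derivative_eq_intros df[OF z] fam refl)+ (simp add: algebra_simps)
    then have "dd (\<lambda>z. exp (2 * f z) * G2 (snd z) (grad_b z) v) z (0, u) = exp (2 * f z) * G2 (snd z) (dd grad_b z (0, u)) v"
      by (simp add: dd_eqI dd_eqI[OF G2_snd] lzero[OF z] g0 dd_G_zero[OF z])
    moreover have "dd (\<lambda>z. exp (2 * f z) * G2 (snd z) (grad_b z) v) z = dd (\<lambda>z. dd b (snd z) v) z"
      by (rule dd_cong[OF open_UV z grad_b])
    ultimately show ?thesis by (simp add: dd_eqI[OF ddb])
  qed
  have "\<kappa> z = (\<Sum>e\<in>Basis. ?A e \<bullet> e)"
    by (simp add: \<kappa>_def g0 crit linear_0[OF lin_\<tau>2[OF z]] linear_0[OF lin_df2[OF z]] lin_zeros[OF z])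
  also have "\<dots> = (\<Sum>e\<in>I. ?H (?A e) e)" by (rule trace_frame[OF H I linA])
  finally show ?thesis unfolding HA .
qed

end

end

text \<open>The trace has the single summand R(u, u) w = 0.\<close>

lemma ric_dim_1:
  fixes \<Gamma> :: "'e::euclidean_space \<Rightarrow> 'e \<Rightarrow> 'e \<Rightarrow> 'e"
  assumes "DIM('e) = 1" "u \<in> Basis"
  shows "ric \<Gamma> z u w = 0"
proof -
  have "(Basis :: 'e set) = {u}" using assms by (metis card_1_singletonE singletonD)
  note B = this
  show ?thesis unfolding ric_def ricci_def curvature_def B by simp
qed

section \<open>Charts and product charts\<close>

lemma is_chartD:
  assumes "is_chart \<phi>"
  shows "open (dom_of \<phi>)" "open (cod_of \<phi>)" "continuous_on (dom_of \<phi>) (coord \<phi>)" "continuous_on (cod_of \<phi>) (point \<phi>)"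
    "p \<in> dom_of \<phi> \<Longrightarrow> coord \<phi> p \<in> cod_of \<phi>" "p \<in> dom_of \<phi> \<Longrightarrow> point \<phi> (coord \<phi> p) = p"
    "x \<in> cod_of \<phi> \<Longrightarrow> point \<phi> x \<in> dom_of \<phi>" "x \<in> cod_of \<phi> \<Longrightarrow> coord \<phi> (point \<phi> x) = x"
proof -
  have h: "homeomorphism (dom_of \<phi>) (cod_of \<phi>) (coord \<phi>) (point \<phi>)" using assms by (simp add: is_chart_def)
  show "open (dom_of \<phi>)" "open (cod_of \<phi>)" using assms by (simp_all add: is_chart_def)
  show "continuous_on (dom_of \<phi>) (coord \<phi>)" "continuous_on (cod_of \<phi>) (point \<phi>)"
    using h by (simp_all add: homeomorphism_def)
  show "p \<in> dom_of \<phi> \<Longrightarrow> coord \<phi> p \<in> cod_of \<phi>" by (simp add: cod_of_def)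
  show "p \<in> dom_of \<phi> \<Longrightarrow> point \<phi> (coord \<phi> p) = p" by (rule homeomorphism_apply1[OF h])
  show "x \<in> cod_of \<phi> \<Longrightarrow> point \<phi> x \<in> dom_of \<phi>" using homeomorphism_image2[OF h] by blast
  show "x \<in> cod_of \<phi> \<Longrightarrow> coord \<phi> (point \<phi> x) = x" by (rule homeomorphism_apply2[OF h])
qed

lemma smooth_atlasD:
  assumes "smooth_atlas A"
  shows "\<phi> \<in> A \<Longrightarrow> is_chart \<phi>" "\<exists>\<phi>\<in>A. p \<in> dom_of \<phi>"
    "\<phi> \<in> A \<Longrightarrow> \<psi> \<in> A \<Longrightarrow> smooth_on (overlap \<phi> \<psi>) (transition \<phi> \<psi>)"
  using assms unfolding smooth_atlas_def by auto

lemma overlap_iff: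
  assumes "is_chart \<phi>"
  shows "x \<in> overlap \<phi> \<psi> \<longleftrightarrow> x \<in> cod_of \<phi> \<and> point \<phi> x \<in> dom_of \<psi>"
proof
  assume "x \<in> overlap \<phi> \<psi>"
  then obtain p where "p \<in> dom_of \<phi>" "p \<in> dom_of \<psi>" "x = coord \<phi> p" by (auto simp: overlap_def)
  then show "x \<in> cod_of \<phi> \<and> point \<phi> x \<in> dom_of \<psi>" using is_chartD(5,6)[OF assms] by simp
next
  assume "x \<in> cod_of \<phi> \<and> point \<phi> x \<in> dom_of \<psi>"
  then show "x \<in> overlap \<phi> \<psi>" using is_chartD(7,8)[OF assms, of x] unfolding overlap_def by (metis IntI imageI)
qed

lemma open_overlap:
  assumes "is_chart \<phi>" "is_chart \<psi>"
  shows "open (overlap \<phi> \<psi>)"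
proof -
  have "overlap \<phi> \<psi> = cod_of \<phi> \<inter> point \<phi> -` dom_of \<psi>" by (intro set_eqI) (simp add: overlap_iff[OF assms(1)])
  then show ?thesis
    using continuous_open_preimage[OF is_chartD(4,2)[OF assms(1)] is_chartD(1)[OF assms(2)]] by simp
qed

lemma transition_eq: "transition \<phi> \<psi> x = coord \<psi> (point \<phi> x)"
  by (simp add: local_rep_def)

lemma point_transition:
  assumes "is_chart \<phi>" "is_chart \<psi>" "x \<in> overlap \<phi> \<psi>"
  shows "point \<psi> (transition \<phi> \<psi> x) = point \<phi> x" "transition \<phi> \<psi> x \<in> cod_of \<psi>"
  using assms is_chartD[OF assms(2)] by (auto simp: transition_eq overlap_iff)

lemma Dtransition_eq: "Dtransition \<phi> \<psi> x = frechet_derivative (transition \<phi> \<psi>) (at x)"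
  by (simp add: differential_def)

lemma Dtransition_has_derivative:
  assumes "smooth_atlas A" "\<phi> \<in> A" "\<psi> \<in> A" "x \<in> overlap \<phi> \<psi>"
  shows "(transition \<phi> \<psi> has_derivative Dtransition \<phi> \<psi> x) (at x)"
  unfolding Dtransition_eq by (rule smooth_on_has_derivative[OF smooth_atlasD(3)[OF assms(1-3)] assms(4)])

lemma Dtransition_cocycle:
  assumes A: "smooth_atlas A" "\<phi> \<in> A" "\<psi> \<in> A" "\<eta> \<in> A" and x: "x \<in> overlap \<phi> \<psi>" "x \<in> overlap \<phi> \<eta>"
  shows "Dtransition \<psi> \<eta> (transition \<phi> \<psi> x) (Dtransition \<phi> \<psi> x u) = Dtransition \<phi> \<eta> x u"
proof -
  note c = smooth_atlasD(1)[OF A(1)]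
  have o: "transition \<phi> \<psi> x \<in> overlap \<psi> \<eta>"
    using x point_transition[OF c[OF A(2)] c[OF A(3)] x(1)] by (simp add: overlap_iff c A)
  have "((\<lambda>x. transition \<psi> \<eta> (transition \<phi> \<psi> x)) has_derivative
      (\<lambda>u. Dtransition \<psi> \<eta> (transition \<phi> \<psi> x) (Dtransition \<phi> \<psi> x u))) (at x)"
    by (rule has_derivative_compose[OF Dtransition_has_derivative[OF A(1-3) x(1)] Dtransition_has_derivative[OF A(1,3,4) o]])
  moreover have "transition \<psi> \<eta> (transition \<phi> \<psi> y) = transition \<phi> \<eta> y" if "y \<in> overlap \<phi> \<psi>" for y
    using point_transition[OF c[OF A(2)] c[OF A(3)] that] by (simp add: transition_eq)
  then have "frechet_derivative (\<lambda>x. transition \<psi> \<eta> (transition \<phi> \<psi> x)) (at x) = frechet_derivative (transition \<phi> \<eta>) (at x)"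
    by (rule dd_cong[OF open_overlap[OF c[OF A(2)] c[OF A(3)]] x(1)])
  ultimately show ?thesis
    unfolding Dtransition_eq[of \<phi> \<eta>] using dd_eqI by (metis (no_types, lifting))
qed

lemma Dtransition_same:
  assumes "is_chart \<phi>" "x \<in> cod_of \<phi>"
  shows "Dtransition \<phi> \<phi> x u = u"
proof -
  have "frechet_derivative (transition \<phi> \<phi>) (at x) = frechet_derivative (\<lambda>x. x) (at x)"
    by (rule dd_cong[OF is_chartD(2)[OF assms(1)] assms(2)]) (simp add: transition_eq is_chartD[OF assms(1)])
  then show ?thesis by (simp add: Dtransition_eq)
qed

lemma linear_Dtransition:
  assumes "smooth_atlas A" "\<phi> \<in> A" "\<psi> \<in> A" "x \<in> overlap \<phi> \<psi>"
  shows "linear (Dtransition \<phi> \<psi> x)"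
  using has_derivative_linear[OF Dtransition_has_derivative[OF assms]] .

section \<open>Product charts and the two tangent distributions\<close>

lemma dom_prod_chart [simp]: "dom_of (prod_chart \<phi> \<psi>) = dom_of \<phi> \<times> dom_of \<psi>"
  and coord_prod_chart [simp]: "coord (prod_chart \<phi> \<psi>) = map_prod (coord \<phi>) (coord \<psi>)"
  by (simp_all add: prod_chart_def)

lemma cod_prod_chart [simp]: "cod_of (prod_chart \<phi> \<psi>) = cod_of \<phi> \<times> cod_of \<psi>"
  by (auto simp: cod_of_def)

lemma point_prod_chart:
  assumes "is_chart \<phi>" "is_chart \<psi>" "x \<in> cod_of \<phi>" "y \<in> cod_of \<psi>"
  shows "point (prod_chart \<phi> \<psi>) (x, y) = (point \<phi> x, point \<psi> y)"
proof -
  note 1 = is_chartD[OF assms(1)] and 2 = is_chartD[OF assms(2)]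
  have "inj_on (coord (prod_chart \<phi> \<psi>)) (dom_of (prod_chart \<phi> \<psi>))"
    unfolding inj_on_def using 1(6) 2(6) by (auto simp: map_prod_def) metis+
  moreover have "(point \<phi> x, point \<psi> y) \<in> dom_of (prod_chart \<phi> \<psi>)" using 1(7) 2(7) assms by auto
  ultimately have "inv_into (dom_of (prod_chart \<phi> \<psi>)) (coord (prod_chart \<phi> \<psi>)) (coord (prod_chart \<phi> \<psi>) (point \<phi> x, point \<psi> y)) = (point \<phi> x, point \<psi> y)"
    by (rule inv_into_f_f)
  then show ?thesis using 1(8) 2(8) assms by (simp add: point_def)
qed

lemma is_chart_prod:
  assumes "is_chart \<phi>" "is_chart \<psi>"
  shows "is_chart (prod_chart \<phi> \<psi>)"
proof -
  note 1 = is_chartD[OF assms(1)] and 2 = is_chartD[OF assms(2)]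
  have pt: "point (prod_chart \<phi> \<psi>) z = (point \<phi> (fst z), point \<psi> (snd z))" if "z \<in> cod_of \<phi> \<times> cod_of \<psi>" for z
    using point_prod_chart[OF assms, of "fst z" "snd z"] that by auto
  have "continuous_on (dom_of \<phi> \<times> dom_of \<psi>) (map_prod (coord \<phi>) (coord \<psi>))"
    unfolding map_prod_def case_prod_unfold
    by (intro continuous_on_Pair continuous_on_compose2[OF 1(3)] continuous_on_compose2[OF 2(3)] continuous_intros) auto
  moreover have "continuous_on (cod_of \<phi> \<times> cod_of \<psi>) (\<lambda>z. (point \<phi> (fst z), point \<psi> (snd z)))"
    by (intro continuous_on_Pair continuous_on_compose2[OF 1(4)] continuous_on_compose2[OF 2(4)] continuous_intros) auto
  then have "continuous_on (cod_of \<phi> \<times> cod_of \<psi>) (point (prod_chart \<phi> \<psi>))"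
    by (rule continuous_on_eq) (use pt in auto)
  moreover have "map_prod (coord \<phi>) (coord \<psi>) ` (dom_of \<phi> \<times> dom_of \<psi>) = cod_of \<phi> \<times> cod_of \<psi>"
    by (auto simp: cod_of_def)
  moreover have "point (prod_chart \<phi> \<psi>) ` (cod_of \<phi> \<times> cod_of \<psi>) = dom_of \<phi> \<times> dom_of \<psi>"
  proof
    show "point (prod_chart \<phi> \<psi>) ` (cod_of \<phi> \<times> cod_of \<psi>) \<subseteq> dom_of \<phi> \<times> dom_of \<psi>"
      using pt 1(7) 2(7) by auto
    show "dom_of \<phi> \<times> dom_of \<psi> \<subseteq> point (prod_chart \<phi> \<psi>) ` (cod_of \<phi> \<times> cod_of \<psi>)"
    proof
      fix p assume p: "p \<in> dom_of \<phi> \<times> dom_of \<psi>"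
      then have i: "(coord \<phi> (fst p), coord \<psi> (snd p)) \<in> cod_of \<phi> \<times> cod_of \<psi>"
        using 1(5) 2(5) by (simp add: mem_Times_iff)
      then have "p = point (prod_chart \<phi> \<psi>) (coord \<phi> (fst p), coord \<psi> (snd p))"
        using pt[OF i] 1(6)[of "fst p"] 2(6)[of "snd p"] p by (simp add: mem_Times_iff)
      then show "p \<in> point (prod_chart \<phi> \<psi>) ` (cod_of \<phi> \<times> cod_of \<psi>)" using i by (rule image_eqI)
    qed
  qed
  moreover have "point (prod_chart \<phi> \<psi>) (map_prod (coord \<phi>) (coord \<psi>) p) = p" if "p \<in> dom_of \<phi> \<times> dom_of \<psi>" for p
    using that pt[of "map_prod (coord \<phi>) (coord \<psi>) p"] 1(5,6)[of "fst p"] 2(5,6)[of "snd p"] by (simp add: mem_Times_iff)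
  moreover have "map_prod (coord \<phi>) (coord \<psi>) (point (prod_chart \<phi> \<psi>) z) = z" if "z \<in> cod_of \<phi> \<times> cod_of \<psi>" for z
    using that pt[OF that] 1(8)[of "fst z"] 2(8)[of "snd z"] by (simp add: mem_Times_iff)
  moreover have "open (dom_of \<phi> \<times> dom_of \<psi>)" "open (cod_of \<phi> \<times> cod_of \<psi>)" by (intro open_Times 1 2)+
  ultimately show ?thesis
    unfolding is_chart_def homeomorphism_def dom_prod_chart cod_prod_chart coord_prod_chart by (intro conjI ballI)
qed

lemma overlap_prod: "overlap (prod_chart \<phi> \<psi>) (prod_chart \<phi>' \<psi>') = overlap \<phi> \<phi>' \<times> overlap \<psi> \<psi>'"
  unfolding overlap_def dom_prod_chart coord_prod_chart Times_Int_Times by auto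

lemma transition_prod:
  assumes "is_chart \<phi>" "is_chart \<psi>" "z \<in> cod_of \<phi> \<times> cod_of \<psi>"
  shows "transition (prod_chart \<phi> \<psi>) (prod_chart \<phi>' \<psi>') z = map_prod (transition \<phi> \<phi>') (transition \<psi> \<psi>') z"
  using assms point_prod_chart[OF assms(1,2), of "fst z" "snd z"] by (cases z) (auto simp: transition_eq)

lemma mem_prod_atlas: "P \<in> prod_atlas A B \<longleftrightarrow> (\<exists>\<phi>\<in>A. \<exists>\<psi>\<in>B. P = prod_chart \<phi> \<psi>)"
  by (auto simp: prod_atlas_def)

lemma smooth_atlas_prod:
  assumes A: "smooth_atlas A" and B: "smooth_atlas B"
  shows "smooth_atlas (prod_atlas A B)"
  unfolding smooth_atlas_def
proof (intro conjI ballI)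
  fix P assume "P \<in> prod_atlas A B"
  then obtain \<phi> \<psi> where "P = prod_chart \<phi> \<psi>" "\<phi> \<in> A" "\<psi> \<in> B" unfolding mem_prod_atlas by blast
  then show "is_chart P" by (simp add: is_chart_prod smooth_atlasD(1)[OF A] smooth_atlasD(1)[OF B])
next
  show "(\<Union>P\<in>prod_atlas A B. dom_of P) = UNIV"
  proof (intro set_eqI iffI UNIV_I)
    fix p :: "'a \<times> 'c"
    obtain \<phi> \<psi> where "\<phi> \<in> A" "\<psi> \<in> B" "fst p \<in> dom_of \<phi>" "snd p \<in> dom_of \<psi>"
      using smooth_atlasD(2)[OF A, of "fst p"] smooth_atlasD(2)[OF B, of "snd p"] by auto
    then show "p \<in> (\<Union>P\<in>prod_atlas A B. dom_of P)"
      by (intro UN_I[of "prod_chart \<phi> \<psi>"]) (auto simp: mem_prod_atlas mem_Times_iff)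
  qed
next
  fix P Q assume "P \<in> prod_atlas A B" "Q \<in> prod_atlas A B"
  then obtain \<phi> \<psi> \<phi>' \<psi>' where P: "P = prod_chart \<phi> \<psi>" "\<phi> \<in> A" "\<psi> \<in> B" and Q: "Q = prod_chart \<phi>' \<psi>'" "\<phi>' \<in> A" "\<psi>' \<in> B"
    by (auto simp: mem_prod_atlas)
  note c = smooth_atlasD(1)[OF A P(2)] smooth_atlasD(1)[OF B P(3)] smooth_atlasD(1)[OF A Q(2)] smooth_atlasD(1)[OF B Q(3)]
  have o: "open (overlap \<phi> \<phi>')" "open (overlap \<psi> \<psi>')" using c by (auto intro: open_overlap)
  have "smooth_on (overlap \<phi> \<phi>' \<times> overlap \<psi> \<psi>') (map_prod (transition \<phi> \<phi>') (transition \<psi> \<psi>'))"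
    by (intro smooth_on_map_prod o smooth_atlasD(3)[OF A] smooth_atlasD(3)[OF B] P Q)
  then show "smooth_on (overlap P Q) (transition P Q)"
    unfolding P(1) Q(1) overlap_prod
    by (rule smooth_on_cong[rotated 2]) (use o c in \<open>auto simp: open_Times transition_prod overlap_iff\<close>)
qed

lemma Dtransition_prod:
  assumes A: "smooth_atlas A" "\<phi> \<in> A" "\<phi>' \<in> A" and B: "smooth_atlas B" "\<psi> \<in> B" "\<psi>' \<in> B"
    and x: "x \<in> overlap \<phi> \<phi>'" and y: "y \<in> overlap \<psi> \<psi>'"
  shows "Dtransition (prod_chart \<phi> \<psi>) (prod_chart \<phi>' \<psi>') (x, y) u = (Dtransition \<phi> \<phi>' x (fst u), Dtransition \<psi> \<psi>' y (snd u))"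
proof -
  note c = smooth_atlasD(1)[OF A(1,2)] smooth_atlasD(1)[OF B(1,2)] smooth_atlasD(1)[OF A(1,3)] smooth_atlasD(1)[OF B(1,3)]
  have "((\<lambda>z. (transition \<phi> \<phi>' (fst z), transition \<psi> \<psi>' (snd z))) has_derivative
     (\<lambda>u. (Dtransition \<phi> \<phi>' x (fst u), Dtransition \<psi> \<psi>' y (snd u)))) (at (x, y))"
    by (intro has_derivative_Pair has_derivative_compose[OF has_derivative_fst[OF has_derivative_ident]]
      has_derivative_compose[OF has_derivative_snd[OF has_derivative_ident]])
      (use Dtransition_has_derivative[OF A x] Dtransition_has_derivative[OF B y] in auto)
  moreover have "frechet_derivative (transition (prod_chart \<phi> \<psi>) (prod_chart \<phi>' \<psi>')) (at (x, y)) =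
      frechet_derivative (\<lambda>z. (transition \<phi> \<phi>' (fst z), transition \<psi> \<psi>' (snd z))) (at (x, y))"
  proof (rule dd_cong)
    show "open (cod_of \<phi> \<times> cod_of \<psi>)" by (intro open_Times is_chartD(2) c)
    show "(x, y) \<in> cod_of \<phi> \<times> cod_of \<psi>" using x y c by (simp add: overlap_iff)
    show "transition (prod_chart \<phi> \<psi>) (prod_chart \<phi>' \<psi>') z = (transition \<phi> \<phi>' (fst z), transition \<psi> \<psi>' (snd z))"
      if "z \<in> cod_of \<phi> \<times> cod_of \<psi>" for z using transition_prod[OF c(1,2) that] by (cases z) simp
  qed
  ultimately show ?thesis by (simp add: Dtransition_eq dd_eqI)
qed

lemma differential_fst:
  assumes A: "smooth_atlas A" "\<phi> \<in> A" "\<phi>' \<in> A" and c: "is_chart \<psi>" and x: "x \<in> overlap \<phi> \<phi>'" and y: "y \<in> cod_of \<psi>"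
  shows "differential fst (prod_chart \<phi> \<psi>) \<phi>' (x, y) u = Dtransition \<phi> \<phi>' x (fst u)"
    and "local_rep fst (prod_chart \<phi> \<psi>) \<phi>' (x, y) = transition \<phi> \<phi>' x"
proof -
  note c1 = smooth_atlasD(1)[OF A(1,2)]
  have eq: "local_rep fst (prod_chart \<phi> \<psi>) \<phi>' z = transition \<phi> \<phi>' (fst z)" if "z \<in> cod_of \<phi> \<times> cod_of \<psi>" for z
    using that point_prod_chart[OF c1 c, of "fst z" "snd z"] by (cases z) (auto simp: local_rep_def)
  show "local_rep fst (prod_chart \<phi> \<psi>) \<phi>' (x, y) = transition \<phi> \<phi>' x" using eq[of "(x,y)"] x y by (simp add: overlap_iff c1)
  have "frechet_derivative (local_rep fst (prod_chart \<phi> \<psi>) \<phi>') (at (x, y)) = frechet_derivative (\<lambda>z. transition \<phi> \<phi>' (fst z)) (at (x, y))"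
  proof (rule dd_cong[OF _ _ eq])
    show "open (cod_of \<phi> \<times> cod_of \<psi>)" by (intro open_Times is_chartD(2) c c1)
    show "(x, y) \<in> cod_of \<phi> \<times> cod_of \<psi>" using x y c c1 by (simp add: overlap_iff)
  qed
  moreover have "(transition \<phi> \<phi>') differentiable (at x)"
    using Dtransition_has_derivative[OF A x] by (auto simp: differentiable_def)
  ultimately show "differential fst (prod_chart \<phi> \<psi>) \<phi>' (x, y) u = Dtransition \<phi> \<phi>' x (fst u)"
    using dd_fst[of "transition \<phi> \<phi>'" "(x,y)" u] by (simp add: differential_def)
qed

lemma differential_snd:
  assumes B: "smooth_atlas B" "\<psi> \<in> B" "\<psi>' \<in> B" and c: "is_chart \<phi>" and x: "x \<in> cod_of \<phi>" and y: "y \<in> overlap \<psi> \<psi>'"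
  shows "differential snd (prod_chart \<phi> \<psi>) \<psi>' (x, y) u = Dtransition \<psi> \<psi>' y (snd u)"
    and "local_rep snd (prod_chart \<phi> \<psi>) \<psi>' (x, y) = transition \<psi> \<psi>' y"
proof -
  note c1 = smooth_atlasD(1)[OF B(1,2)]
  have eq: "local_rep snd (prod_chart \<phi> \<psi>) \<psi>' z = transition \<psi> \<psi>' (snd z)" if "z \<in> cod_of \<phi> \<times> cod_of \<psi>" for z
    using that point_prod_chart[OF c c1, of "fst z" "snd z"] by (cases z) (auto simp: local_rep_def)
  show "local_rep snd (prod_chart \<phi> \<psi>) \<psi>' (x, y) = transition \<psi> \<psi>' y" using eq[of "(x,y)"] x y by (simp add: overlap_iff c1)
  have "frechet_derivative (local_rep snd (prod_chart \<phi> \<psi>) \<psi>') (at (x, y)) = frechet_derivative (\<lambda>z. transition \<psi> \<psi>' (snd z)) (at (x, y))"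
  proof (rule dd_cong[OF _ _ eq])
    show "open (cod_of \<phi> \<times> cod_of \<psi>)" by (intro open_Times is_chartD(2) c c1)
    show "(x, y) \<in> cod_of \<phi> \<times> cod_of \<psi>" using x y c c1 by (simp add: overlap_iff)
  qed
  moreover have "(transition \<psi> \<psi>') differentiable (at y)"
    using Dtransition_has_derivative[OF B y] by (auto simp: differentiable_def)
  ultimately show "differential snd (prod_chart \<phi> \<psi>) \<psi>' (x, y) u = Dtransition \<psi> \<psi>' y (snd u)"
    using dd_snd[of "transition \<psi> \<psi>'" "(x,y)" u] by (simp add: differential_def)
qed

text \<open>The kernel quantifies over all charts around the image point. In \<open>\<psi>\<close>
  itself the differential is the second projection, which gives one inclusion; in the other charts
  it factors through that projection, which gives the converse.\<close>

lemma TM1_eq: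
  assumes A: "smooth_atlas A" "\<phi> \<in> A" and B: "smooth_atlas B" "\<psi> \<in> B" and z: "z \<in> cod_of \<phi> \<times> cod_of \<psi>"
  shows "TM1 B (prod_chart \<phi> \<psi>) z = {u. snd u = 0}"
proof -
  obtain x y where z': "z = (x, y)" "x \<in> cod_of \<phi>" "y \<in> cod_of \<psi>" using z by auto
  note c = smooth_atlasD(1)[OF A] smooth_atlasD(1)[OF B]
  have pt: "snd (point (prod_chart \<phi> \<psi>) z) = point \<psi> y" using point_prod_chart[OF c] z' by simp
  have d: "differential snd (prod_chart \<phi> \<psi>) \<psi>' z u = Dtransition \<psi> \<psi>' y (snd u)"
    if "\<psi>' \<in> B" "point \<psi> y \<in> dom_of \<psi>'" for \<psi>' u
    using differential_snd(1)[OF B that(1) c(1) z'(2), of y u] that z' by (simp add: overlap_iff c)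
  show ?thesis
  proof (intro set_eqI iffI; simp)
    fix u assume "u \<in> TM1 B (prod_chart \<phi> \<psi>) z"
    then have "differential snd (prod_chart \<phi> \<psi>) \<psi> z u = 0"
      using pt is_chartD(7)[OF c(2) z'(3)] B(2) by (simp add: ker_differential_def)
    then show "snd u = 0" using d[OF B(2) is_chartD(7)[OF c(2) z'(3)]] Dtransition_same[OF c(2) z'(3)] by simp
  next
    fix u :: "'b \<times> 'd" assume u: "snd u = 0"
    show "u \<in> TM1 B (prod_chart \<phi> \<psi>) z"
      unfolding ker_differential_def mem_Collect_eq pt
    proof (intro ballI impI)
      fix \<psi>' assume \<psi>': "\<psi>' \<in> B" "point \<psi> y \<in> dom_of \<psi>'"
      then have "linear (Dtransition \<psi> \<psi>' y)" using linear_Dtransition[OF B \<psi>'(1)] z' by (simp add: overlap_iff c)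
      then show "differential snd (prod_chart \<phi> \<psi>) \<psi>' z u = 0" using d[OF \<psi>'] u by (simp add: linear_0)
    qed
  qed
qed

lemma TM2_eq:
  assumes A: "smooth_atlas A" "\<phi> \<in> A" and B: "smooth_atlas B" "\<psi> \<in> B" and z: "z \<in> cod_of \<phi> \<times> cod_of \<psi>"
  shows "TM2 A (prod_chart \<phi> \<psi>) z = {u. fst u = 0}"
proof -
  obtain x y where z': "z = (x, y)" "x \<in> cod_of \<phi>" "y \<in> cod_of \<psi>" using z by auto
  note c = smooth_atlasD(1)[OF A] smooth_atlasD(1)[OF B]
  have pt: "fst (point (prod_chart \<phi> \<psi>) z) = point \<phi> x" using point_prod_chart[OF c] z' by simp
  have d: "differential fst (prod_chart \<phi> \<psi>) \<phi>' z u = Dtransition \<phi> \<phi>' x (fst u)"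
    if "\<phi>' \<in> A" "point \<phi> x \<in> dom_of \<phi>'" for \<phi>' u
    using differential_fst(1)[OF A that(1) c(2), of x y u] that z' by (simp add: overlap_iff c)
  show ?thesis
  proof (intro set_eqI iffI; simp)
    fix u assume "u \<in> TM2 A (prod_chart \<phi> \<psi>) z"
    then have "differential fst (prod_chart \<phi> \<psi>) \<phi> z u = 0"
      using pt is_chartD(7)[OF c(1) z'(2)] A(2) by (simp add: ker_differential_def)
    then show "fst u = 0" using d[OF A(2) is_chartD(7)[OF c(1) z'(2)]] Dtransition_same[OF c(1) z'(2)] by simp
  next
    fix u :: "'b \<times> 'd" assume u: "fst u = 0"
    show "u \<in> TM2 A (prod_chart \<phi> \<psi>) z"
      unfolding ker_differential_def mem_Collect_eq pt
    proof (intro ballI impI)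
      fix \<phi>' assume \<phi>': "\<phi>' \<in> A" "point \<phi> x \<in> dom_of \<phi>'"
      then have "linear (Dtransition \<phi> \<phi>' x)" using linear_Dtransition[OF A \<phi>'(1)] z' by (simp add: overlap_iff c)
      then show "differential fst (prod_chart \<phi> \<psi>) \<phi>' z u = 0" using d[OF \<phi>'] u by (simp add: linear_0)
    qed
  qed
qed

section \<open>Parallel distributions\<close>

text \<open>The chain rule along s \<mapsto> (x s, v s) for (y, v) \<mapsto> B y v, a function of
  both arguments to which \<open>has_derivative_linear_family\<close> applies.\<close>

lemma has_vector_derivative_linear_family:
  fixes B :: "'z::real_normed_vector \<Rightarrow> 'e::euclidean_space \<Rightarrow> 'g::real_normed_vector"
  assumes "open S" "x t \<in> S" and lin: "\<And>y. y \<in> S \<Longrightarrow> linear (B y)"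
    and d: "\<And>u. (\<lambda>y. B y u) differentiable (at (x t))"
    and x: "(x has_vector_derivative x') (at t within T)" and v: "(v has_vector_derivative v') (at t within T)"
  shows "((\<lambda>s. B (x s) (v s)) has_vector_derivative B (x t) v' + dd (\<lambda>y. B y (v t)) (x t) x') (at t within T)"
proof -
  let ?F = "\<lambda>p. B (fst p) (snd p)"
  have F: "(?F has_derivative (\<lambda>h. B (x t) (snd h) + dd (\<lambda>y. B y (v t)) (x t) (fst h))) (at (x t, v t))"
  proof -
    have "(?F has_derivative (\<lambda>h. B (fst (x t, v t)) (snd h) + dd (\<lambda>p. B (fst p) (snd (x t, v t))) (x t, v t) h)) (at (x t, v t))"
    proof (rule has_derivative_linear_family[of "S \<times> UNIV"])
      show "(\<lambda>p. B (fst p) u) differentiable (at (x t, v t))" for u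
        using has_derivative_compose[OF has_derivative_fst[OF has_derivative_ident], of "\<lambda>y. B y u" _ "(x t, v t)" UNIV] d[of u]
        by (auto simp: differentiable_def)
      show "(snd has_derivative snd) (at (x t, v t))" using has_derivative_snd[OF has_derivative_ident] by blast
    qed (use assms in \<open>auto simp: open_Times\<close>)
    then show ?thesis using dd_fst[of "\<lambda>y. B y (v t)" "(x t, v t)"] d by simp
  qed
  have p: "((\<lambda>s. (x s, v s)) has_derivative (\<lambda>h. (h *\<^sub>R x', h *\<^sub>R v'))) (at t within T)"
    using x v unfolding has_vector_derivative_def by (rule has_derivative_Pair)
  have "((\<lambda>s. ?F (x s, v s)) has_derivative (\<lambda>h. B (x t) (h *\<^sub>R v') + dd (\<lambda>y. B y (v t)) (x t) (h *\<^sub>R x'))) (at t within T)"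
    using has_derivative_compose[OF p F] by simp
  moreover have "B (x t) (h *\<^sub>R v') + dd (\<lambda>y. B y (v t)) (x t) (h *\<^sub>R x') = h *\<^sub>R (B (x t) v' + dd (\<lambda>y. B y (v t)) (x t) x')" for h
    using linear_scale[OF lin[OF assms(2)]] linear_scale[OF linear_frechet_derivative[OF d]] by (simp add: scaleR_add_right)
  ultimately show ?thesis by (simp add: has_vector_derivative_def)
qed

text \<open>If parallel transport along the segments \<open>t \<mapsto> z + t\<sigma>u\<close> preserves \<open>E\<close>, then the parallel field starting
  at \<open>v\<close> stays in \<open>E\<close>, and so does its initial velocity \<open>- \<nabla>\<^sub>u v\<close>.\<close>
lemma holonomy_preserves_connection:
  fixes A :: "('a::topological_space, 'e::euclidean_space) chart set" and L :: "'e \<Rightarrow> 'g::euclidean_space"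
  assumes A: "smooth_atlas A" and conn: "linear_connection A \<Gamma>" and hol: "holonomy_preserves A \<Gamma> E"
    and E_trans: "\<And>\<phi> \<psi> x v. \<phi> \<in> A \<Longrightarrow> \<psi> \<in> A \<Longrightarrow> x \<in> overlap \<phi> \<psi> \<Longrightarrow> v \<in> E \<phi> x \<Longrightarrow> Dtransition \<phi> \<psi> x v \<in> E \<psi> (transition \<phi> \<psi> x)"
    and P: "P \<in> A" and z: "z \<in> cod_of P" and L: "linear L" "\<And>x. x \<in> cod_of P \<Longrightarrow> E P x = {v. L v = 0}"
    and v: "L v = 0"
  shows "L (\<Gamma> P z u v) = 0"
proof -
  note c = smooth_atlasD(1)[OF A] and cP = smooth_atlasD(1)[OF A P]
  have bl: "bilinear (\<Gamma> \<phi> x)" if "\<phi> \<in> A" "x \<in> cod_of \<phi>" for \<phi> x using conn that by (simp add: linear_connection_def)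
  have sm: "smooth_on (cod_of P) (\<lambda>x. \<Gamma> P x u v)" for u v using conn P by (simp add: linear_connection_def)
  obtain r where r: "r > 0" "ball z r \<subseteq> cod_of P" using is_chartD(2)[OF cP] z openE by blast
  \<comment> \<open>The segment up to time s0 has length at most r / 2 and stays in the chart; the
    summand 1 admits u = 0.\<close>
  define s0 where "s0 = r / (2 * (norm u + 1))"
  have nu: "norm u + 1 > 0" by (smt (verit) norm_ge_zero)
  have s0: "s0 > 0" using r nu by (simp add: s0_def)
  have cod: "z + t *\<^sub>R u \<in> cod_of P" if "t \<in> {0..s0}" for t
  proof -
    have "t * norm u \<le> s0 * (norm u + 1)" using that s0 by (intro mult_mono) auto
    also have "\<dots> = r / 2"
    proof -
      have "r / (2 * n) * n = r / 2" if "n > 0" for n using that by simp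
      from this[OF nu] show ?thesis unfolding s0_def .
    qed
    finally show ?thesis using r that by (auto simp: dist_norm subset_iff)
  qed
  have "\<exists>s V. 0 < s \<and> s \<le> s0 \<and> V 0 = v \<and>
    (\<forall>t\<in>{0..s}. (V has_vector_derivative - \<Gamma> P (z + t *\<^sub>R u) u (V t)) (at t within {0..s}))"
  proof (rule linear_ode_exists[OF s0])
    show "linear (\<lambda>w. - \<Gamma> P (z + t *\<^sub>R u) u w)" if "t \<in> {0..s0}" for t
      by (rule linear_compose_neg[OF bilinear_linear(1)[OF bl[OF P cod[OF that]]]])
    show "continuous_on {0..s0} (\<lambda>t. - \<Gamma> P (z + t *\<^sub>R u) u w)" for w
      by (intro continuous_on_minus continuous_on_compose2[OF smooth_on_continuous[OF sm]] continuous_intros) (use cod in auto)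
  qed
  then obtain s V where s: "0 < s" "s \<le> s0" and V0: "V 0 = v" and
    V: "\<And>t. t \<in> {0..s} \<Longrightarrow> (V has_vector_derivative - \<Gamma> P (z + t *\<^sub>R u) u (V t)) (at t within {0..s})" by blast
  have LV: "L (V \<sigma>) = 0" if \<sigma>: "\<sigma> \<in> {0..s}" for \<sigma>
  proof -
    \<comment> \<open>Transport is parametrized by [0, 1], so the segment up to time \<sigma> is
      traversed with velocity \<sigma> u. \<open>w\<close> and \<open>W\<close> below carry this
      velocity and the solution V from P to all charts.\<close>
    define x where "x = (\<lambda>t. z + (t * \<sigma>) *\<^sub>R u)"
    define \<gamma> where "\<gamma> = (\<lambda>t. point P (x t))"
    define w where "w = (\<lambda>\<phi> t. Dtransition P \<phi> (x t) (\<sigma> *\<^sub>R u))"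
    define W where "W = (\<lambda>\<phi> t. Dtransition P \<phi> (x t) (V (t * \<sigma>)))"
    have ts: "t * \<sigma> \<in> {0..s}" if "t \<in> {0..1}" for t
      using \<sigma> that mult_mono[of t 1 \<sigma> s] by auto
    have xc: "x t \<in> cod_of P" if "t \<in> {0..1}" for t
      using cod[of "t * \<sigma>"] ts[OF that] s by (simp add: x_def)
    have xo: "x t \<in> overlap P \<phi>" if "t \<in> {0..1}" "\<gamma> t \<in> dom_of \<phi>" for t \<phi>
      using that xc by (simp add: overlap_iff[OF cP] \<gamma>_def)
    have x_cont: "continuous_on T x" for T unfolding x_def by (intro continuous_intros)
    have x_deriv: "(x has_vector_derivative \<sigma> *\<^sub>R u) (at t within T)" for t T
      unfolding x_def by (auto intro!: derivative_eq_intros simp: mult.commute)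
    have V_deriv: "((\<lambda>t. V (t * \<sigma>)) has_vector_derivative \<sigma> *\<^sub>R - \<Gamma> P (x t) u (V (t * \<sigma>))) (at t within {0..1})"
      if t: "t \<in> {0..1}" for t
    proof -
      have 1: "((\<lambda>t. t * \<sigma>) has_vector_derivative \<sigma>) (at t within {0..1})"
        by (auto intro!: derivative_eq_intros simp flip: has_real_derivative_iff_has_vector_derivative)
      have 2: "(V has_vector_derivative - \<Gamma> P (x t) u (V (t * \<sigma>))) (at (t * \<sigma>) within (\<lambda>t. t * \<sigma>) ` {0..1})"
        unfolding x_def by (rule has_vector_derivative_within_subset[OF V[OF ts[OF t]]]) (use ts in auto)
      show ?thesis using vector_diff_chain_within[OF 1 2] by (simp add: o_def)
    qed
    have C1: "C1_curve A \<gamma> w"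
      unfolding C1_curve_def
    proof (intro conjI ballI impI)
      show "continuous_on {0..1} \<gamma>"
        unfolding \<gamma>_def by (rule continuous_on_compose2[OF is_chartD(4)[OF cP] x_cont]) (use xc in auto)
      fix \<phi> assume \<phi>: "\<phi> \<in> A"
      have "continuous_on (overlap P \<phi>) (\<lambda>y. Dtransition P \<phi> y (\<sigma> *\<^sub>R u))"
        unfolding Dtransition_eq by (rule smooth_on_continuous[OF smooth_on_dd[OF smooth_atlasD(3)[OF A P \<phi>]]])
      then show "continuous_on {t \<in> {0..1}. \<gamma> t \<in> dom_of \<phi>} (w \<phi>)"
        unfolding w_def by (rule continuous_on_compose2[OF _ x_cont]) (simp add: image_subset_iff xo)
      fix t assume t: "t \<in> {0..1::real}" "\<gamma> t \<in> dom_of \<phi>"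
      have "((\<lambda>s. transition P \<phi> (x s)) has_derivative (\<lambda>h. Dtransition P \<phi> (x t) (h *\<^sub>R (\<sigma> *\<^sub>R u)))) (at t within {0..1})"
        by (rule has_derivative_compose[OF x_deriv[unfolded has_vector_derivative_def] Dtransition_has_derivative[OF A P \<phi> xo[OF t]]])
      then show "((\<lambda>s. coord \<phi> (\<gamma> s)) has_vector_derivative w \<phi> t) (at t within {0..1})"
        using linear_scale[OF linear_Dtransition[OF A P \<phi> xo[OF t]]]
        by (simp add: transition_eq \<gamma>_def w_def has_vector_derivative_def)
    qed
    have par: "parallel_field A \<Gamma> \<gamma> w W"
      unfolding parallel_field_def
    proof (intro conjI ballI impI)
      fix \<phi> \<psi> t assume h: "\<phi> \<in> A" "\<psi> \<in> A" "t \<in> {0..1::real}" "\<gamma> t \<in> dom_of \<phi> \<inter> dom_of \<psi>"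
      then show "W \<psi> t = Dtransition \<phi> \<psi> (coord \<phi> (\<gamma> t)) (W \<phi> t)"
        using Dtransition_cocycle[OF A P h(1,2) xo[of t \<phi>] xo[of t \<psi>]] by (simp add: W_def \<gamma>_def transition_eq)
    next
      fix \<phi> t assume \<phi>: "\<phi> \<in> A" and t: "t \<in> {0..1::real}" "\<gamma> t \<in> dom_of \<phi>"
      note o = xo[OF t]
      let ?V = "V (t * \<sigma>)"
      have "((\<lambda>s. Dtransition P \<phi> (x s) (V (s * \<sigma>))) has_vector_derivative
         Dtransition P \<phi> (x t) (\<sigma> *\<^sub>R - \<Gamma> P (x t) u ?V) + dd (\<lambda>y. Dtransition P \<phi> y ?V) (x t) (\<sigma> *\<^sub>R u)) (at t within {0..1})"
      proof (rule has_vector_derivative_linear_family[OF open_overlap[OF cP c[OF \<phi>]], of x t "\<lambda>y. Dtransition P \<phi> y", OF o _ _ x_deriv V_deriv[OF t(1)]])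
        show "linear (Dtransition P \<phi> y)" if "y \<in> overlap P \<phi>" for y by (rule linear_Dtransition[OF A P \<phi> that])
        show "(\<lambda>y. Dtransition P \<phi> y u) differentiable (at (x t))" for u
          unfolding Dtransition_eq by (rule smooth_on_differentiable[OF smooth_on_dd[OF smooth_atlasD(3)[OF A P \<phi>]] o])
      qed
      \<comment> \<open>The transformation law of the connection makes a field that is parallel in
        the chart P parallel in every chart.\<close>
      moreover have "Dtransition P \<phi> (x t) (\<Gamma> P (x t) (\<sigma> *\<^sub>R u) ?V) = dd (\<lambda>y. Dtransition P \<phi> y ?V) (x t) (\<sigma> *\<^sub>R u)
          + \<Gamma> \<phi> (transition P \<phi> (x t)) (Dtransition P \<phi> (x t) (\<sigma> *\<^sub>R u)) (Dtransition P \<phi> (x t) ?V)"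
        using conn P \<phi> o unfolding linear_connection_def by blast
      moreover have "Dtransition P \<phi> (x t) (\<sigma> *\<^sub>R - \<Gamma> P (x t) u ?V) = - Dtransition P \<phi> (x t) (\<Gamma> P (x t) (\<sigma> *\<^sub>R u) ?V)"
        using linear_neg[OF linear_Dtransition[OF A P \<phi> o]] bilinear_lmul[OF bl[OF P xc[OF t(1)]]] by simp
      ultimately show "(W \<phi> has_vector_derivative - \<Gamma> \<phi> (coord \<phi> (\<gamma> t)) (w \<phi> t) (W \<phi> t)) (at t within {0..1})"
        unfolding W_def w_def \<gamma>_def transition_eq[symmetric] by simp
    qed
    have "W \<phi> 0 \<in> E \<phi> (coord \<phi> (\<gamma> 0))" if "\<phi> \<in> A" "\<gamma> 0 \<in> dom_of \<phi>" for \<phi>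
      using E_trans[OF P that(1) xo[OF _ that(2)], of v] L(2)[OF xc[of 0]] v V0 by (simp add: W_def \<gamma>_def transition_eq)
    then have "\<forall>\<phi>\<in>A. \<gamma> 1 \<in> dom_of \<phi> \<longrightarrow> W \<phi> 1 \<in> E \<phi> (coord \<phi> (\<gamma> 1))"
      using hol C1 par unfolding holonomy_preserves_def by blast
    then have "W P 1 \<in> E P (x 1)"
      using P is_chartD(7,8)[OF cP xc[of 1]] by (auto simp: \<gamma>_def)
    then have "V \<sigma> \<in> E P (x 1)" using Dtransition_same[OF cP xc[of 1]] by (simp add: W_def)
    then show "L (V \<sigma>) = 0" using L(2)[OF xc[of 1]] by simp
  qed
  have bL: "bounded_linear L" using L(1) by (simp add: linear_conv_bounded_linear)
  have "(V has_vector_derivative - \<Gamma> P z u v) (at 0 within {0..s})" using V[of 0] V0 s by simp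
  from bounded_linear.has_vector_derivative[OF bL this]
  have "((\<lambda>t. L (V t)) has_vector_derivative L (- \<Gamma> P z u v)) (at 0 within {0..s})" .
  moreover have "((\<lambda>t. L (V t)) has_vector_derivative 0) (at 0 within {0..s})"
    by (rule has_vector_derivative_transform[of 0 "{0..s}" _ "\<lambda>t. 0"]) (use s LV in auto)
  moreover have "at (0::real) within {0..s} \<noteq> bot" using s by (simp add: at_within_Icc_at_right)
  ultimately have "L (- \<Gamma> P z u v) = 0" using vector_derivative_unique_within by blast
  then show ?thesis using linear_neg[OF L(1)] by simp
qed

text \<open>Coordinate fields commute, so torsion-freeness identifies the two derivatives.
  Preservation of TM1 puts one of them into TM1, preservation of TM2 the other into TM2, and these
  meet in 0.\<close>

lemma adapted_mixed_zero:
  fixes A1 :: "('a::topological_space, 'e::euclidean_space) chart set" and A2 :: "('b::topological_space, 'f::euclidean_space) chart set"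
  assumes A: "smooth_atlas A1" "smooth_atlas A2" and ad: "adapted_weyl_connection A1 A2 c \<Gamma>"
    and \<phi>: "\<phi> \<in> A1" "\<psi> \<in> A2" and z: "z \<in> cod_of \<phi> \<times> cod_of \<psi>"
  shows "\<Gamma> (prod_chart \<phi> \<psi>) z (u, 0) (0, w) = 0" "\<Gamma> (prod_chart \<phi> \<psi>) z (0, w) (u, 0) = 0"
proof -
  let ?A = "prod_atlas A1 A2" and ?P = "prod_chart \<phi> \<psi>"
  have P: "?P \<in> ?A" using \<phi> by (auto simp: mem_prod_atlas)
  have conn: "linear_connection ?A \<Gamma>" and tor: "torsion_free ?A \<Gamma>" and hol: "holonomy_preserves ?A \<Gamma> (TM1 A2)" "holonomy_preserves ?A \<Gamma> (TM2 A1)"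
    using ad by (auto simp: adapted_weyl_connection_def weyl_connection_def)
  have tr: "Dtransition Q R x v \<in> TM1 A2 R (transition Q R x)" if h: "Q \<in> ?A" "R \<in> ?A" "x \<in> overlap Q R" "v \<in> TM1 A2 Q x" for Q R x v
  proof -
    obtain \<alpha> \<beta> \<alpha>' \<beta>' where Q: "Q = prod_chart \<alpha> \<beta>" "\<alpha> \<in> A1" "\<beta> \<in> A2" and R: "R = prod_chart \<alpha>' \<beta>'" "\<alpha>' \<in> A1" "\<beta>' \<in> A2"
      using h by (auto simp: mem_prod_atlas)
    have o: "fst x \<in> overlap \<alpha> \<alpha>'" "snd x \<in> overlap \<beta> \<beta>'" using h(3) by (auto simp: Q R overlap_prod)
    have "x \<in> cod_of \<alpha> \<times> cod_of \<beta>" using o smooth_atlasD(1)[OF A(1) Q(2)] smooth_atlasD(1)[OF A(2) Q(3)] by (auto simp: overlap_iff mem_Times_iff)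
    then have "snd v = 0" using h(4) TM1_eq[OF A(1) Q(2) A(2) Q(3)] Q(1) by auto
    then have "snd (Dtransition Q R x v) = 0"
      using Dtransition_prod[OF A(1) Q(2) R(2) A(2) Q(3) R(3) o, of v] linear_0[OF linear_Dtransition[OF A(2) Q(3) R(3) o(2)]]
      by (simp add: Q R)
    moreover have "transition Q R x \<in> cod_of \<alpha>' \<times> cod_of \<beta>'"
      using point_transition(2)[OF _ _ h(3)] smooth_atlasD(1)[OF smooth_atlas_prod[OF A]] h(1,2) by (simp add: R(1))
    ultimately show ?thesis using TM1_eq[OF A(1) R(2) A(2) R(3)] R(1) by auto
  qed
  have tr2: "Dtransition Q R x v \<in> TM2 A1 R (transition Q R x)" if h: "Q \<in> ?A" "R \<in> ?A" "x \<in> overlap Q R" "v \<in> TM2 A1 Q x" for Q R x v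
  proof -
    obtain \<alpha> \<beta> \<alpha>' \<beta>' where Q: "Q = prod_chart \<alpha> \<beta>" "\<alpha> \<in> A1" "\<beta> \<in> A2" and R: "R = prod_chart \<alpha>' \<beta>'" "\<alpha>' \<in> A1" "\<beta>' \<in> A2"
      using h by (auto simp: mem_prod_atlas)
    have o: "fst x \<in> overlap \<alpha> \<alpha>'" "snd x \<in> overlap \<beta> \<beta>'" using h(3) by (auto simp: Q R overlap_prod)
    have "x \<in> cod_of \<alpha> \<times> cod_of \<beta>" using o smooth_atlasD(1)[OF A(1) Q(2)] smooth_atlasD(1)[OF A(2) Q(3)] by (auto simp: overlap_iff mem_Times_iff)
    then have "fst v = 0" using h(4) TM2_eq[OF A(1) Q(2) A(2) Q(3)] Q(1) by auto
    then have "fst (Dtransition Q R x v) = 0"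
      using Dtransition_prod[OF A(1) Q(2) R(2) A(2) Q(3) R(3) o, of v] linear_0[OF linear_Dtransition[OF A(1) Q(2) R(2) o(1)]]
      by (simp add: Q R)
    moreover have "transition Q R x \<in> cod_of \<alpha>' \<times> cod_of \<beta>'"
      using point_transition(2)[OF _ _ h(3)] smooth_atlasD(1)[OF smooth_atlas_prod[OF A]] h(1,2) by (simp add: R(1))
    ultimately show ?thesis using TM2_eq[OF A(1) R(2) A(2) R(3)] R(1) by auto
  qed
  have zP: "z \<in> cod_of ?P" using z by simp
  have 1: "snd (\<Gamma> ?P z (0, w) (u, 0)) = 0"
    by (rule holonomy_preserves_connection[OF smooth_atlas_prod[OF A] conn hol(1) tr P zP, of snd])
      (use TM1_eq[OF A(1) \<phi>(1) A(2) \<phi>(2)] in \<open>auto simp: linear_snd\<close>)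
  have 2: "fst (\<Gamma> ?P z (u, 0) (0, w)) = 0"
    by (rule holonomy_preserves_connection[OF smooth_atlas_prod[OF A] conn hol(2) tr2 P zP, of fst])
      (use TM2_eq[OF A(1) \<phi>(1) A(2) \<phi>(2)] in \<open>auto simp: linear_fst\<close>)
  have 3: "\<Gamma> ?P z (0, w) (u, 0) = \<Gamma> ?P z (u, 0) (0, w)" using tor P zP by (simp add: torsion_free_def)
  show "\<Gamma> ?P z (u, 0) (0, w) = 0" "\<Gamma> ?P z (0, w) (u, 0) = 0" using 1 2 3 by (auto simp: prod_eq_iff)
qed

section \<open>Smooth functions on manifolds\<close>

lemma smooth_funD: "smooth_fun A F \<Longrightarrow> \<phi> \<in> A \<Longrightarrow> smooth_on (cod_of \<phi>) (\<lambda>x. F (point \<phi> x))"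
  by (simp add: smooth_fun_def o_def)

lemma smooth_funI: "(\<And>\<phi>. \<phi> \<in> A \<Longrightarrow> smooth_on (cod_of \<phi>) (\<lambda>x. F (point \<phi> x))) \<Longrightarrow> smooth_fun A F"
  by (simp add: smooth_fun_def o_def)

lemma smooth_fun_const: "smooth_fun A (\<lambda>p. c)"
  by (intro smooth_funI smooth_on_const)

lemma smooth_fun_add:
  assumes "smooth_atlas A" "smooth_fun A F" "smooth_fun A H"
  shows "smooth_fun A (\<lambda>p. F p + H p)"
  by (intro smooth_funI smooth_on_add smooth_funD[OF assms(2)] smooth_funD[OF assms(3)] is_chartD(2) smooth_atlasD(1)[OF assms(1)])

lemma smooth_fun_diff:
  assumes "smooth_atlas A" "smooth_fun A F" "smooth_fun A H"
  shows "smooth_fun A (\<lambda>p. F p - H p)"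
  by (intro smooth_funI smooth_on_diff smooth_funD[OF assms(2)] smooth_funD[OF assms(3)] is_chartD(2) smooth_atlasD(1)[OF assms(1)])

lemma smooth_fun_continuous:
  assumes A: "smooth_atlas A" and F: "smooth_fun A F"
  shows "continuous_on UNIV F"
proof -
  have "continuous_on (\<Union>\<phi>\<in>A. dom_of \<phi>) F"
  proof (rule continuous_on_open_UN)
    fix \<phi> assume \<phi>: "\<phi> \<in> A"
    note c = is_chartD[OF smooth_atlasD(1)[OF A \<phi>]]
    show "open (dom_of \<phi>)" by (rule c)
    have "continuous_on (dom_of \<phi>) (\<lambda>p. F (point \<phi> (coord \<phi> p)))"
      by (rule continuous_on_compose2[OF smooth_on_continuous[OF smooth_funD[OF F \<phi>]] c(3)]) (use c in blast)
    then show "continuous_on (dom_of \<phi>) F" by (rule continuous_on_eq) (simp add: c)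
  qed
  moreover have "(\<Union>\<phi>\<in>A. dom_of \<phi>) = UNIV" using A by (simp add: smooth_atlas_def)
  ultimately show ?thesis by simp
qed

lemma open_point_image:
  assumes "is_chart \<phi>" "open S" "S \<subseteq> cod_of \<phi>"
  shows "open (point \<phi> ` S)"
proof -
  note c = is_chartD[OF assms(1)]
  have "point \<phi> ` S = dom_of \<phi> \<inter> coord \<phi> -` S"
  proof (intro set_eqI iffI)
    fix p assume "p \<in> point \<phi> ` S"
    then obtain x where "x \<in> S" "p = point \<phi> x" by blast
    then show "p \<in> dom_of \<phi> \<inter> coord \<phi> -` S" using c(7,8)[of x] assms(3) by auto
  next
    fix p assume "p \<in> dom_of \<phi> \<inter> coord \<phi> -` S"
    then show "p \<in> point \<phi> ` S" using c(6)[of p] by (intro image_eqI[of _ _ "coord \<phi> p"]) auto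
  qed
  then show ?thesis using continuous_open_preimage[OF c(3,1) assms(2)] by simp
qed

lemma constant_if_locally_constant:
  fixes F :: "'a::topological_space \<Rightarrow> 'c"
  assumes "connected (UNIV :: 'a set)" "\<And>p. \<exists>T. open T \<and> p \<in> T \<and> (\<forall>q\<in>T. F q = F p)"
  shows "F p = F q"
proof (rule connected_local_const[OF assms(1)])
  show "\<forall>a\<in>UNIV. \<forall>\<^sub>F b in at a within UNIV. F a = F b"
  proof
    fix a obtain T where "open T" "a \<in> T" "\<forall>q\<in>T. F q = F a" using assms(2) by blast
    then show "\<forall>\<^sub>F b in at a within UNIV. F a = F b" unfolding eventually_at_topological by metis
  qed
qed auto

text \<open>F is constant on coordinate balls, and connectedness does the rest. In the applications
  F may itself be a derivative along the other factor, taken at a fixed point of it.\<close>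

lemma constant_if_dd_zero:
  fixes A :: "('a::topological_space, 'e::euclidean_space) chart set" and F :: "'a \<Rightarrow> real"
  assumes A: "smooth_atlas A" and conn: "connected (UNIV :: 'a set)"
    and d: "\<And>\<phi> x. \<phi> \<in> A \<Longrightarrow> x \<in> cod_of \<phi> \<Longrightarrow> (\<lambda>x. F (point \<phi> x)) differentiable (at x)"
    and z: "\<And>\<phi> x v. \<phi> \<in> A \<Longrightarrow> x \<in> cod_of \<phi> \<Longrightarrow> dd (\<lambda>x. F (point \<phi> x)) x v = 0"
  shows "F p = F q"
proof (rule constant_if_locally_constant[OF conn])
  fix p
  obtain \<phi> where \<phi>: "\<phi> \<in> A" "p \<in> dom_of \<phi>" using smooth_atlasD(2)[OF A] by blast
  note c = smooth_atlasD(1)[OF A \<phi>(1)]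
  note c' = is_chartD[OF c]
  obtain r where r: "r > 0" "ball (coord \<phi> p) r \<subseteq> cod_of \<phi>" using openE[OF c'(2) c'(5)[OF \<phi>(2)]] by blast
  show "\<exists>T. open T \<and> p \<in> T \<and> (\<forall>q\<in>T. F q = F p)"
  proof (intro exI conjI ballI)
    show "open (point \<phi> ` ball (coord \<phi> p) r)" by (rule open_point_image[OF c open_ball r(2)])
    show "p \<in> point \<phi> ` ball (coord \<phi> p) r"
      by (rule image_eqI[of _ _ "coord \<phi> p"]) (use c'(6)[OF \<phi>(2)] r(1) in auto)
    fix q assume "q \<in> point \<phi> ` ball (coord \<phi> p) r"
    then obtain x where x: "x \<in> ball (coord \<phi> p) r" "q = point \<phi> x" by blast
    have "\<exists>k. \<forall>x\<in>ball (coord \<phi> p) r. F (point \<phi> x) = k"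
    proof (rule has_derivative_zero_constant[OF convex_ball])
      fix x assume x: "x \<in> ball (coord \<phi> p) r"
      then have "x \<in> cod_of \<phi>" using r by auto
      then have "((\<lambda>x. F (point \<phi> x)) has_derivative (\<lambda>h. 0)) (at x)" using dd_works[OF d[OF \<phi>(1)], of x] z[OF \<phi>(1), of x] by (simp add: ext[of "dd (\<lambda>x. F (point \<phi> x)) x" "\<lambda>_. 0"])
      then show "((\<lambda>x. F (point \<phi> x)) has_derivative (\<lambda>h. 0)) (at x within ball (coord \<phi> p) r)" by (rule has_derivative_at_withinI)
    qed
    then obtain k where "\<And>x. x \<in> ball (coord \<phi> p) r \<Longrightarrow> F (point \<phi> x) = k" by blast
    from this[OF x(1)] this[of "coord \<phi> p"] show "F q = F p" using r(1) x(2) c'(6)[OF \<phi>(2)] by simp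
  qed
qed

text \<open>The set where the maximum is attained is nonempty by compactness, closed by continuity,
  and open by the local principle.\<close>

theorem strong_maximum_principle:
  fixes A :: "('a::{t2_space, second_countable_topology}, 'e::euclidean_space) chart set" and F :: "'a \<Rightarrow> real"
  assumes A: "compact_manifold A" and F: "smooth_fun A F"
    and ell: "\<And>\<phi>. \<phi> \<in> A \<Longrightarrow> elliptic_subsolution (cod_of \<phi>) (\<lambda>x. F (point \<phi> x))"
  shows "F p = F q"
proof -
  have sa: "smooth_atlas A" and conn: "connected (UNIV :: 'a set)" and comp: "compact (UNIV :: 'a set)"
    using A by (auto simp: compact_manifold_def smooth_manifold_def)
  have cont: "continuous_on UNIV F" by (rule smooth_fun_continuous[OF sa F])
  obtain m where m: "\<And>p. F p \<le> F m" using continuous_attains_sup[OF comp _ cont] by auto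
  let ?Z = "{p. F p = F m}"
  have "open ?Z"
  proof (subst open_subopen, intro ballI)
    fix p assume p: "p \<in> ?Z"
    obtain \<phi> where \<phi>: "\<phi> \<in> A" "p \<in> dom_of \<phi>" using smooth_atlasD(2)[OF sa] by blast
    note c = smooth_atlasD(1)[OF sa \<phi>(1)]
    note c' = is_chartD[OF c]
    obtain d where d: "d > 0" "\<forall>x\<in>ball (coord \<phi> p) d. x \<in> cod_of \<phi> \<and> F (point \<phi> x) = F m"
      using strong_maximum_principle_local[OF c'(2) smooth_funD[OF F \<phi>(1)] m ell[OF \<phi>(1)] c'(5)[OF \<phi>(2)]] p c'(6)[OF \<phi>(2)] by auto
    have "open (point \<phi> ` ball (coord \<phi> p) d)" by (rule open_point_image[OF c open_ball]) (use d in blast)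
    moreover have "p \<in> point \<phi> ` ball (coord \<phi> p) d"
      by (rule image_eqI[of _ _ "coord \<phi> p"]) (use c'(6)[OF \<phi>(2)] d(1) in auto)
    ultimately show "\<exists>T. open T \<and> p \<in> T \<and> T \<subseteq> ?Z" using d by (intro exI[of _ "point \<phi> ` ball (coord \<phi> p) d"]) auto
  qed
  moreover have "closed ?Z" using continuous_closed_preimage_constant[OF cont, of "F m"] by simp
  ultimately have "?Z = {} \<or> ?Z = UNIV" using conn unfolding connected_clopen by auto
  then have "F p = F m" for p by blast
  then show ?thesis by metis
qed

text \<open>Built from the inverses of the two factor charts, so that slices are obtained by
  plugging in; it agrees with the expression in the product chart on the coordinate range.\<close>

abbreviation local2 :: "('a \<times> 'b \<Rightarrow> real) \<Rightarrow> ('a, 'e) chart \<Rightarrow> ('b, 'f) chart \<Rightarrow> 'e \<times> 'f \<Rightarrow> real" where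
  "local2 F \<phi> \<psi> z \<equiv> F (point \<phi> (fst z), point \<psi> (snd z))"

section \<open>Functions on a product: smoothness, slices, splitting\<close>

lemma smooth_on_local2:
  assumes A: "smooth_atlas A" "\<phi> \<in> A" and B: "smooth_atlas B" "\<psi> \<in> B" and F: "smooth_fun (prod_atlas A B) F"
  shows "smooth_on (cod_of \<phi> \<times> cod_of \<psi>) (local2 F \<phi> \<psi>)"
proof -
  note c = smooth_atlasD(1)[OF A] smooth_atlasD(1)[OF B]
  have P: "prod_chart \<phi> \<psi> \<in> prod_atlas A B" using A B unfolding mem_prod_atlas by blast
  show ?thesis
  proof (rule smooth_on_cong)
    show "open (cod_of \<phi> \<times> cod_of \<psi>)" by (intro open_Times is_chartD(2) c)
    show "smooth_on (cod_of \<phi> \<times> cod_of \<psi>) (\<lambda>z. F (point (prod_chart \<phi> \<psi>) z))"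
      using smooth_funD[OF F P] by simp
    show "F (point (prod_chart \<phi> \<psi>) z) = local2 F \<phi> \<psi> z" if "z \<in> cod_of \<phi> \<times> cod_of \<psi>" for z
      using that point_prod_chart[OF c, of "fst z" "snd z"] by (simp add: mem_Times_iff)
  qed
qed

lemma smooth_fun_prodI:
  assumes A: "smooth_atlas A" and B: "smooth_atlas B"
    and F: "\<And>\<phi> \<psi>. \<phi> \<in> A \<Longrightarrow> \<psi> \<in> B \<Longrightarrow> smooth_on (cod_of \<phi> \<times> cod_of \<psi>) (local2 F \<phi> \<psi>)"
  shows "smooth_fun (prod_atlas A B) F"
proof (rule smooth_funI)
  fix P assume "P \<in> prod_atlas A B"
  then obtain \<phi> \<psi> where P: "P = prod_chart \<phi> \<psi>" "\<phi> \<in> A" "\<psi> \<in> B" unfolding mem_prod_atlas by blast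
  note c = smooth_atlasD(1)[OF A P(2)] smooth_atlasD(1)[OF B P(3)]
  show "smooth_on (cod_of P) (\<lambda>z. F (point P z))"
    unfolding P(1) cod_prod_chart
  proof (rule smooth_on_cong[OF _ _ F[OF P(2,3)]])
    show "open (cod_of \<phi> \<times> cod_of \<psi>)" by (intro open_Times is_chartD(2) c)
    show "local2 F \<phi> \<psi> z = F (point (prod_chart \<phi> \<psi>) z)" if "z \<in> cod_of \<phi> \<times> cod_of \<psi>" for z
      using that point_prod_chart[OF c, of "fst z" "snd z"] by (simp add: mem_Times_iff)
  qed
qed

lemma smooth_fun_slices:
  assumes A: "smooth_atlas A" and B: "smooth_atlas B" and F: "smooth_fun (prod_atlas A B) F"
  shows "smooth_fun A (\<lambda>p. F (p, q))" "smooth_fun B (\<lambda>q. F (p, q))"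
proof -
  obtain \<psi> where \<psi>: "\<psi> \<in> B" "q \<in> dom_of \<psi>" using smooth_atlasD(2)[OF B] by blast
  note c = is_chartD[OF smooth_atlasD(1)[OF B \<psi>(1)]]
  show "smooth_fun A (\<lambda>p. F (p, q))"
  proof (rule smooth_funI)
    fix \<phi> assume \<phi>: "\<phi> \<in> A"
    from smooth_on_slice1[OF is_chartD(2)[OF smooth_atlasD(1)[OF A \<phi>]] c(5)[OF \<psi>(2)] smooth_on_local2[OF A \<phi> B \<psi>(1) F]]
    show "smooth_on (cod_of \<phi>) (\<lambda>x. F (point \<phi> x, q))" by (simp add: c(6)[OF \<psi>(2)])
  qed
next
  obtain \<phi> where \<phi>: "\<phi> \<in> A" "p \<in> dom_of \<phi>" using smooth_atlasD(2)[OF A] by blast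
  note c = is_chartD[OF smooth_atlasD(1)[OF A \<phi>(1)]]
  show "smooth_fun B (\<lambda>q. F (p, q))"
  proof (rule smooth_funI)
    fix \<psi> assume \<psi>: "\<psi> \<in> B"
    from smooth_on_slice2[OF is_chartD(2)[OF smooth_atlasD(1)[OF B \<psi>]] c(5)[OF \<phi>(2)] smooth_on_local2[OF A \<phi>(1) B \<psi> F]]
    show "smooth_on (cod_of \<psi>) (\<lambda>y. F (p, point \<psi> y))" by (simp add: c(6)[OF \<phi>(2)])
  qed
qed

text \<open>Says that F is a function of p plus a function of q, without choosing the
  summands.\<close>

definition splits :: "('a \<times> 'b \<Rightarrow> real) \<Rightarrow> bool" where
  "splits F \<longleftrightarrow> (\<forall>p p' q q'. F (p, q) - F (p', q) = F (p, q') - F (p', q'))"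

text \<open>Two integrations: the derivative along M1 does not depend on q because M2 is connected,
  so F(., q) - F(., q') has zero derivative and is constant because M1 is connected.\<close>

lemma splits_if_mixed_zero:
  fixes A :: "('a::topological_space, 'e::euclidean_space) chart set" and B :: "('b::topological_space, 'f::euclidean_space) chart set"
  assumes A: "smooth_atlas A" and B: "smooth_atlas B" and conn: "connected (UNIV :: 'a set)" "connected (UNIV :: 'b set)"
    and F: "smooth_fun (prod_atlas A B) F"
    and mixed: "\<And>\<phi> \<psi> z u w. \<phi> \<in> A \<Longrightarrow> \<psi> \<in> B \<Longrightarrow> z \<in> cod_of \<phi> \<times> cod_of \<psi> \<Longrightarrow> dd (\<lambda>z. dd (local2 F \<phi> \<psi>) z (u, 0)) z (0, w) = 0"
  shows "splits F"
proof -
  have d: "dd (\<lambda>x. F (point \<phi> x, q)) x u = dd (\<lambda>x. F (point \<phi> x, q')) x u"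
    if \<phi>: "\<phi> \<in> A" "x \<in> cod_of \<phi>" for \<phi> x u q q'
  proof (rule constant_if_dd_zero[OF B conn(2), of "\<lambda>q. dd (\<lambda>x. F (point \<phi> x, q)) x u"])
    fix \<psi> y w assume \<psi>: "\<psi> \<in> B" "y \<in> cod_of \<psi>"
    note c = is_chartD[OF smooth_atlasD(1)[OF A \<phi>(1)]] is_chartD[OF smooth_atlasD(1)[OF B \<psi>(1)]]
    note sm = smooth_on_local2[OF A \<phi>(1) B \<psi>(1) F]
    have eq: "dd (\<lambda>x. F (point \<phi> x, point \<psi> y)) x u = dd (local2 F \<phi> \<psi>) (x, y) (u, 0)" if "y \<in> cod_of \<psi>" for y
      using dd_slice1(1)[OF smooth_on_differentiable[OF sm, of "(x, y)"]] \<phi>(2) that by simp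
    have df: "(\<lambda>z. dd (local2 F \<phi> \<psi>) z (u, 0)) differentiable (at (x, y))"
      using smooth_on_differentiable[OF smooth_on_dd[OF sm], of "(x, y)"] \<phi>(2) \<psi>(2) by simp
    show "(\<lambda>y. dd (\<lambda>x. F (point \<phi> x, point \<psi> y)) x u) differentiable at y"
      by (rule differentiable_cong[OF c(10) \<psi>(2) _ dd_slice2(2)[OF df]]) (simp add: eq)
    show "dd (\<lambda>y. dd (\<lambda>x. F (point \<phi> x, point \<psi> y)) x u) y w = 0"
      using dd_cong[OF c(10) \<psi>(2), of "\<lambda>y. dd (\<lambda>x. F (point \<phi> x, point \<psi> y)) x u", OF eq] dd_slice2(1)[OF df, of w]
        mixed[OF \<phi>(1) \<psi>(1), of "(x, y)" u w] \<phi>(2) \<psi>(2) by simp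
  qed
  have sp: "F (p, q) - F (p, q') = F (p', q) - F (p', q')" for p p' q q'
  proof (rule constant_if_dd_zero[OF A conn(1), of "\<lambda>p. F (p, q) - F (p, q')"])
    fix \<phi> x u assume \<phi>: "\<phi> \<in> A" "x \<in> cod_of \<phi>"
    have s: "((\<lambda>x. F (point \<phi> x, q)) has_derivative dd (\<lambda>x. F (point \<phi> x, q)) x) (at x)" for q
      by (rule smooth_on_has_derivative[OF smooth_funD[OF smooth_fun_slices(1)[OF A B F] \<phi>(1)] \<phi>(2)])
    have h: "((\<lambda>x. F (point \<phi> x, q) - F (point \<phi> x, q')) has_derivative
      (\<lambda>u. dd (\<lambda>x. F (point \<phi> x, q)) x u - dd (\<lambda>x. F (point \<phi> x, q')) x u)) (at x)"
      by (intro has_derivative_diff s)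
    show "(\<lambda>x. F (point \<phi> x, q) - F (point \<phi> x, q')) differentiable at x" using h by (rule differentiableI)
    show "dd (\<lambda>x. F (point \<phi> x, q) - F (point \<phi> x, q')) x u = 0" using d[OF \<phi>, of q u q'] by (simp add: dd_eqI[OF h])
  qed
  have "F (p, q) - F (p', q) = F (p, q') - F (p', q')" for p p' q q'
    using sp[of p q q' p'] by linarith
  then show ?thesis unfolding splits_def by blast
qed

text \<open>The charts are indexed by \<open>J\<close>, since a product chart does not determine its factors when its domain
  is empty.\<close>
lemma conformal_factor_exists:
  fixes ch :: "'j \<Rightarrow> ('m::topological_space, 'h::euclidean_space) chart" and q r :: "'j \<Rightarrow> 'h \<Rightarrow> 'k::euclidean_space \<Rightarrow> 'k \<Rightarrow> real"
  assumes A: "smooth_atlas (ch ` J)"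
    and proportional: "\<And>i x. i \<in> J \<Longrightarrow> x \<in> cod_of (ch i) \<Longrightarrow> \<exists>\<rho>>0. \<forall>u v. q i x u v = \<rho> * r i x u v"
    and pos: "\<And>i x u. i \<in> J \<Longrightarrow> x \<in> cod_of (ch i) \<Longrightarrow> u \<noteq> 0 \<Longrightarrow> r i x u u > 0"
    and inv: "\<And>i j x. i \<in> J \<Longrightarrow> j \<in> J \<Longrightarrow> x \<in> overlap (ch i) (ch j) \<Longrightarrow>
      \<exists>T. \<forall>u v. q i x u v = q j (transition (ch i) (ch j) x) (T u) (T v) \<and> r i x u v = r j (transition (ch i) (ch j) x) (T u) (T v)"
    and smooth: "\<And>i u v. i \<in> J \<Longrightarrow> smooth_on (cod_of (ch i)) (\<lambda>x. q i x u v)" "\<And>i u v. i \<in> J \<Longrightarrow> smooth_on (cod_of (ch i)) (\<lambda>x. r i x u v)"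
  shows "\<exists>F. smooth_fun (ch ` J) F \<and> (\<forall>i\<in>J. \<forall>x\<in>cod_of (ch i). \<forall>u v. q i x u v = exp (2 * F (point (ch i) x)) * r i x u v)"
proof -
  have c: "is_chart (ch i)" if "i \<in> J" for i using smooth_atlasD(1)[OF A] that by blast
  \<comment> \<open>By \<open>inv\<close> the ratio of q to r found in one chart around p is the
    ratio in every chart, hence a function of p.\<close>
  have "\<exists>s>0. \<forall>i\<in>J. p \<in> dom_of (ch i) \<longrightarrow> (\<forall>u v. q i (coord (ch i) p) u v = s * r i (coord (ch i) p) u v)" for p
  proof -
    obtain i0 where i0: "i0 \<in> J" "p \<in> dom_of (ch i0)" using smooth_atlasD(2)[OF A, of p] by blast
    obtain s where s: "s > 0" "\<And>u v. q i0 (coord (ch i0) p) u v = s * r i0 (coord (ch i0) p) u v"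
      using proportional[OF i0(1) is_chartD(5)[OF c[OF i0(1)] i0(2)]] by blast
    have "q i (coord (ch i) p) u v = s * r i (coord (ch i) p) u v" if i: "i \<in> J" "p \<in> dom_of (ch i)" for i u v
    proof -
      have o: "coord (ch i) p \<in> overlap (ch i) (ch i0)" using i i0 by (auto simp: overlap_def)
      have "transition (ch i) (ch i0) (coord (ch i) p) = coord (ch i0) p" by (simp add: transition_eq is_chartD(6)[OF c[OF i(1)] i(2)])
      then show ?thesis using inv[OF i(1) i0(1) o] s(2) by metis
    qed
    then show ?thesis using s(1) by blast
  qed
  then obtain s where s: "\<And>p. s p > 0"
    "\<And>p i u v. i \<in> J \<Longrightarrow> p \<in> dom_of (ch i) \<Longrightarrow> q i (coord (ch i) p) u v = s p * r i (coord (ch i) p) u v" by metis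
  define F where "F = (\<lambda>p. (1/2) * ln (s p))"
  have eq: "q i x u v = exp (2 * F (point (ch i) x)) * r i x u v" if "i \<in> J" "x \<in> cod_of (ch i)" for i x u v
    using s(2)[OF that(1) is_chartD(7)[OF c[OF that(1)] that(2)], of u v] is_chartD(8)[OF c[OF that(1)] that(2)]
      s(1)[of "point (ch i) x"] by (simp add: F_def)
  have "smooth_fun (ch ` J) F"
  proof (rule smooth_funI, elim imageE)
    fix \<phi> i assume i: "\<phi> = ch i" "i \<in> J"
    \<comment> \<open>The ratio on a single nonzero vector already exhibits the factor as
      smooth.\<close>
    obtain b :: 'k where "b \<in> Basis" using nonempty_Basis by blast
    then have b: "b \<noteq> 0" by auto
    note o = is_chartD(2)[OF c[OF i(2)]]
    have rp: "r i x b b > 0" if "x \<in> cod_of (ch i)" for x by (rule pos[OF i(2) that b])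
    have ratio: "q i x b b / r i x b b = s (point (ch i) x)" if "x \<in> cod_of (ch i)" for x
      using eq[OF i(2) that, of b b] rp[OF that] s(1)[of "point (ch i) x"] by (simp add: F_def)
    have "smooth_on (cod_of (ch i)) (\<lambda>x. (1/2) * ln (q i x b b / r i x b b))"
      by (intro smooth_on_mult smooth_on_const smooth_on_ln smooth_on_divide smooth i o)
        (use rp ratio s(1) in \<open>auto simp: less_le\<close>)
    then show "smooth_on (cod_of \<phi>) (\<lambda>x. F (point \<phi> x))"
      unfolding i(1) by (rule smooth_on_cong[OF o, rotated]) (simp add: ratio F_def)
  qed
  then show ?thesis using eq by blast
qed

section \<open>Riemannian metrics and their conformal changes\<close>

lemma riemannian_metricD:
  assumes "riemannian_metric A g" "\<phi> \<in> A"
  shows "x \<in> cod_of \<phi> \<Longrightarrow> inner_form (g \<phi> x)" "smooth_on (cod_of \<phi>) (\<lambda>x. g \<phi> x u v)"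
    "\<psi> \<in> A \<Longrightarrow> x \<in> overlap \<phi> \<psi> \<Longrightarrow> g \<phi> x u v = g \<psi> (transition \<phi> \<psi> x) (Dtransition \<phi> \<psi> x u) (Dtransition \<phi> \<psi> x v)"
  using assms unfolding riemannian_metric_def inner_form_def by blast+

lemma riemannian_metric_conformal:
  assumes A: "smooth_atlas A" and g: "riemannian_metric A g" and F: "smooth_fun A F"
  shows "riemannian_metric A (\<lambda>\<phi> x u v. exp (2 * F (point \<phi> x)) * g \<phi> x u v)"
  unfolding riemannian_metric_def
proof (intro conjI ballI allI)
  fix \<phi> assume \<phi>: "\<phi> \<in> A"
  note c = smooth_atlasD(1)[OF A \<phi>]
  { fix x assume "x \<in> cod_of \<phi>"
    then have i: "inner_form (\<lambda>u v. exp (2 * F (point \<phi> x)) * g \<phi> x u v)"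
      by (intro inner_form_scale riemannian_metricD(1)[OF g \<phi>]) auto
    show "bilinear (\<lambda>u v. exp (2 * F (point \<phi> x)) * g \<phi> x u v)" using i by (simp add: inner_form_def)
    fix u v show "exp (2 * F (point \<phi> x)) * g \<phi> x u v = exp (2 * F (point \<phi> x)) * g \<phi> x v u" using i unfolding inner_form_def by blast
    show "u \<noteq> 0 \<longrightarrow> 0 < exp (2 * F (point \<phi> x)) * g \<phi> x u u" using i unfolding inner_form_def by blast }
  fix u v show "smooth_on (cod_of \<phi>) (\<lambda>x. exp (2 * F (point \<phi> x)) * g \<phi> x u v)"
    by (intro smooth_on_mult smooth_on_exp smooth_on_const smooth_funD[OF F \<phi>] riemannian_metricD(2)[OF g \<phi>] is_chartD(2)[OF c])
next
  fix \<phi> \<psi> x u v assume h: "\<phi> \<in> A" "\<psi> \<in> A" "x \<in> overlap \<phi> \<psi>"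
  show "exp (2 * F (point \<phi> x)) * g \<phi> x u v = exp (2 * F (point \<psi> (transition \<phi> \<psi> x))) *
     g \<psi> (transition \<phi> \<psi> x) (Dtransition \<phi> \<psi> x u) (Dtransition \<phi> \<psi> x v)"
    using riemannian_metricD(3)[OF g h(1,2,3)] point_transition(1)[OF smooth_atlasD(1)[OF A h(1)] smooth_atlasD(1)[OF A h(2)] h(3)] by simp
qed

section \<open>Einstein metrics \<open>e\<^sup>2\<^sup>b G\<^sub>1 + e\<^sup>2\<^sup>f G\<^sub>2\<close> with \<open>b\<close> a function on \<open>M\<^sub>2\<close>\<close>

context warped_chart
begin

lemma slice_derivatives:
  assumes "x \<in> U" "y \<in> V"
  shows "dd (\<lambda>x. f (x, y)) x u = dd f (x, y) (u, 0)"
    and "dd (\<lambda>x'. dd (\<lambda>x. f (x, y)) x' u) x v = dd (\<lambda>z. dd f z (u, 0)) (x, y) (v, 0)"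
proof -
  have eq: "dd (\<lambda>x. f (x, y)) x u = dd f (x, y) (u, 0)" if "x \<in> U" for x
    using dd_slice1(1)[OF smooth_on_differentiable[OF f_smooth, of "(x, y)"]] that assms by simp
  show "dd (\<lambda>x. f (x, y)) x u = dd f (x, y) (u, 0)" by (rule eq[OF assms(1)])
  have "dd (\<lambda>x'. dd (\<lambda>x. f (x, y)) x' u) x v = dd (\<lambda>x. dd f (x, y) (u, 0)) x v"
    using dd_cong[OF U assms(1) eq] by simp
  also have "\<dots> = dd (\<lambda>z. dd f z (u, 0)) (x, y) (v, 0)"
    using dd_slice1(1)[OF smooth_on_differentiable[OF smooth_on_dd[OF f_smooth], of "(x, y)"]] assms by simp
  finally show "dd (\<lambda>x'. dd (\<lambda>x. f (x, y)) x' u) x v = dd (\<lambda>z. dd f z (u, 0)) (x, y) (v, 0)" .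
qed

text \<open>\<open>\<Delta> f + |df|\<^sup>2 = e\<^sup>-\<^sup>f \<Delta> e\<^sup>f\<close> for the restriction of \<open>f\<close> to a slice.\<close>
definition lap :: "'e \<times> 'f \<Rightarrow> real" where
  "lap z = (\<Sum>e\<in>Basis. dd grad_f z (e, 0) \<bullet> e) + \<tau>1 (fst z) (grad_f z) + dd f z (grad_f z, 0)"

text \<open>The quadratic term of \<open>lap\<close> is df applied to \<open>grad_f\<close>. Read as
  a first-order term with the locally bounded coefficient \<open>grad_f\<close>, it leaves a linear
  elliptic operator, so the maximum principle applies to f itself. The factor s treats sub- and
  supersolutions at once.\<close>

lemma slice_subsolution:
  assumes y: "y \<in> V" and s: "\<And>x. x \<in> U \<Longrightarrow> s * lap (x, y) \<ge> 0"
  shows "elliptic_subsolution U (\<lambda>x. s * f (x, y))"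
  unfolding elliptic_subsolution_def
proof
  fix x0 assume x0: "x0 \<in> U"
  obtain r where r: "r > 0" "cball x0 r \<subseteq> U" using U x0 open_contains_cball by blast
  let ?K = "cball x0 r"
  let ?G = "\<lambda>x u v. exp (2 * b y) * G1 x u v"
  have G: "inner_form (?G x)" if "x \<in> U" for x using inner_form_scale[OF G1[OF that], of "exp (2 * b y)"] by simp
  have blG: "bilinear (?G x)" if "x \<in> U" for x using G[OF that] by (simp add: inner_form_def)
  have G_cont: "continuous_on ?K (\<lambda>x. ?G x u v)" for u v
    by (intro continuous_intros continuous_on_subset[OF smooth_on_continuous[OF G1_smooth] r(2)])
  obtain c where c: "c > 0" "\<And>x u. x \<in> ?K \<Longrightarrow> c * (u \<bullet> u) \<le> ?G x u u"
    using inner_form_uniform_lower_bound[OF compact_cball, of x0 r ?G] G r G_cont by (metis subsetD)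
  obtain C where C: "C > 0" "\<And>x u v. x \<in> ?K \<Longrightarrow> norm (?G x u v) \<le> C * (norm u * norm v)"
    using bilinear_uniform_bound[OF compact_cball, of x0 r ?G] blG r G_cont by (metis subsetD)
  obtain C' where C': "C' > 0" "\<And>x u v. x \<in> ?K \<Longrightarrow> norm (\<gamma>1 x u v) \<le> C' * (norm u * norm v)"
    using bilinear_uniform_bound[OF compact_cball, of x0 r \<gamma>1] bilinear_\<gamma>1[OF y] r
      continuous_on_subset[OF smooth_on_continuous[OF \<gamma>1_smooth[OF y]] r(2)] by (metis subsetD)
  have "continuous_on ?K (\<lambda>x. grad_f (x, y))"
    by (rule continuous_on_compose2[OF smooth_on_continuous[OF grad_f_smooth]]) (use r y in \<open>auto intro!: continuous_intros\<close>)
  then have "bounded ((\<lambda>x. grad_f (x, y)) ` ?K)"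
    by (intro compact_imp_bounded compact_continuous_image compact_cball)
  then obtain C'' where C'': "\<And>x. x \<in> ?K \<Longrightarrow> norm (grad_f (x, y)) \<le> C''" unfolding bounded_iff by blast
  define D where "D = max (DIM('e) / c) (C' * (DIM('e) / c) + C'')"
  have "\<exists>I \<beta>. finite I \<and> (\<Sum>e\<in>I. e \<bullet> e) \<le> D \<and> (\<forall>w. (1 / C) * (w \<bullet> w) \<le> (\<Sum>e\<in>I. (e \<bullet> w)\<^sup>2)) \<and> norm \<beta> \<le> D \<and>
     0 \<le> (\<Sum>e\<in>I. dd (\<lambda>x'. dd (\<lambda>x. s * f (x, y)) x' e) x e) + dd (\<lambda>x. s * f (x, y)) x \<beta>" if xK: "x \<in> ?K" for x
  proof -
    have x: "x \<in> U" using xK r by auto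
    have z: "(x, y) \<in> U \<times> V" using x y by simp
    obtain I where I: "frame (?G x) I" using frame_exists[OF G[OF x]] by blast
    have up: "?G x u u \<le> C * (u \<bullet> u)" for u using C(2)[OF xK, of u u] by (simp add: dot_square_norm power2_eq_square)
    note ell = frame_elliptic[OF G[OF x] I c(2)[OF xK] up c(1) C(1)]
    \<comment> \<open>Collects the first-order terms: the quadratic term and the Christoffel part of
      the Hessian trace.\<close>
    define \<beta> where "\<beta> = grad_f (x, y) - (\<Sum>e\<in>I. \<gamma>1 x e e)"
    have "norm (\<Sum>e\<in>I. \<gamma>1 x e e) \<le> (\<Sum>e\<in>I. C' * (e \<bullet> e))"
      by (rule sum_norm_le) (use C'(2)[OF xK] in \<open>simp add: dot_square_norm power2_eq_square\<close>)
    also have "\<dots> \<le> C' * (DIM('e) / c)"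
      unfolding sum_distrib_left[symmetric] using ell(2) C'(1) by (intro mult_left_mono) auto
    finally have \<beta>: "norm \<beta> \<le> D"
      using C''[OF xK] norm_triangle_ineq4[of "grad_f (x, y)" "\<Sum>e\<in>I. \<gamma>1 x e e"] by (simp add: \<beta>_def D_def)
    have df: "f differentiable (at (x, y))" "(\<lambda>z. dd f z u) differentiable (at (x, y))" for u
      using smooth_on_differentiable[OF f_smooth z] smooth_on_differentiable[OF smooth_on_dd[OF f_smooth] z] by auto
    have sm: "smooth_on U (\<lambda>x. f (x, y))" by (rule smooth_on_slice1[OF U y f_smooth])
    have d1: "dd (\<lambda>x. s * f (x, y)) x u = s * dd f (x, y) (u, 0)" if "x \<in> U" for x u
      using slice_derivatives(1)[OF that y] by (simp add: dd_eqI[OF has_derivative_mult_right[OF smooth_on_has_derivative[OF sm that]]])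
    have d2: "dd (\<lambda>x'. dd (\<lambda>x. s * f (x, y)) x' u) x u = s * dd (\<lambda>z. dd f z (u, 0)) (x, y) (u, 0)" for u
    proof -
      have "dd (\<lambda>x'. dd (\<lambda>x. s * f (x, y)) x' u) x u = dd (\<lambda>x'. s * dd (\<lambda>x. f (x, y)) x' u) x u"
        using dd_cong[OF U x, of "\<lambda>x'. dd (\<lambda>x. s * f (x, y)) x' u" "\<lambda>x'. s * dd (\<lambda>x. f (x, y)) x' u"] d1 slice_derivatives(1)[OF _ y] by simp
      also have "\<dots> = s * dd (\<lambda>x'. dd (\<lambda>x. f (x, y)) x' u) x u"
        by (simp add: dd_eqI[OF has_derivative_mult_right[OF smooth_on_has_derivative[OF smooth_on_dd[OF sm] x]]])
      finally show ?thesis using slice_derivatives(2)[OF x y] by simp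
    qed
    have "dd f (x, y) (\<beta>, 0) = dd f (x, y) (grad_f (x, y), 0) - (\<Sum>e\<in>I. dd f (x, y) (\<gamma>1 x e e, 0))"
      unfolding \<beta>_def using linear_diff[OF lin_df1[OF z]] linear_sum[OF lin_df1[OF z]] by simp
    then have L: "(\<Sum>e\<in>I. dd (\<lambda>z. dd f z (e, 0)) (x, y) (e, 0)) + dd f (x, y) (\<beta>, 0) = lap (x, y)"
      using laplacian_f[OF z, of I] I by (simp add: lap_def sum_subtractf)
    have "(\<Sum>e\<in>I. dd (\<lambda>x'. dd (\<lambda>x. s * f (x, y)) x' e) x e) + dd (\<lambda>x. s * f (x, y)) x \<beta> = s * lap (x, y)"
      unfolding d2 d1[OF x] by (simp only: sum_distrib_left[symmetric] distrib_left[symmetric] L)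
    then show ?thesis
      using ell \<beta> s[OF x] by (intro exI[of _ I] exI[of _ \<beta>]) (auto simp: D_def)
  qed
  moreover have "1 / C > 0" using C by simp
  ultimately show "\<exists>r>0. \<exists>c>0. \<exists>C. cball x0 r \<subseteq> U \<and> (\<forall>x\<in>cball x0 r. \<exists>I \<beta>.
     finite I \<and> (\<Sum>e\<in>I. e \<bullet> e) \<le> C \<and> (\<forall>w. c * (w \<bullet> w) \<le> (\<Sum>e\<in>I. (e \<bullet> w)\<^sup>2)) \<and> norm \<beta> \<le> C \<and>
     0 \<le> (\<Sum>e\<in>I. dd (\<lambda>x'. dd (\<lambda>x. s * f (x, y)) x' e) x e) + dd (\<lambda>x. s * f (x, y)) x \<beta>)"
    using r by blast
qed

text \<open>The frame is the single vector u / |u|. Multiplying by the squared length of u clears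
  the normalization and gives the expression that appears in \<open>ric_11\<close>.\<close>

lemma lap_dim_1:
  assumes dim: "DIM('e) = 1" and u: "u \<in> Basis" and z: "z \<in> U \<times> V"
  shows "exp (2 * b (snd z)) * G1 (fst z) u u * lap z = dd (\<lambda>z. dd f z (u, 0)) z (u, 0) - dd f z (\<gamma>1 (fst z) u u, 0) + (dd f z (u, 0))\<^sup>2"
proof -
  let ?G = "\<lambda>u v. exp (2 * b (snd z)) * G1 (fst z) u v"
  have B: "(Basis :: 'e set) = {u}" using dim u by (metis card_1_singletonE singletonD)
  have G: "inner_form ?G" using inner_form_scale[OF G1[OF fst_mem[OF z]], of "exp (2 * b (snd z))"] by simp
  have bl: "bilinear ?G" using G by (simp add: inner_form_def)
  have u0: "u \<noteq> 0" using u by auto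
  then have pos: "?G u u > 0" using G by (simp add: inner_form_def)
  define k where "k = 1 / sqrt (?G u u)"
  have "1 / sqrt t * (1 / sqrt t) * t = 1" if "t > 0" for t using that by simp
  from this[OF pos] have k: "k * k * ?G u u = 1" by (simp only: k_def)
  have rep: "w = (w \<bullet> u) *\<^sub>R u" for w using euclidean_representation[of w] by (simp add: B)
  have "frame ?G {k *\<^sub>R u}"
    unfolding frame_def orthonormal_def
  proof (intro conjI ballI allI)
    fix w
    have "?G w (k *\<^sub>R u) = (w \<bullet> u) * (k * ?G u u)"
      by (subst rep[of w]) (simp only: bilinear_lmul[OF bl] bilinear_rmul[OF bl] real_scaleR_def mult.left_commute)
    then have "(\<Sum>e\<in>{k *\<^sub>R u}. ?G w e *\<^sub>R e) = ((w \<bullet> u) * (k * k * ?G u u)) *\<^sub>R u" by (simp add: mult.commute mult.left_commute)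
    then show "w = (\<Sum>e\<in>{k *\<^sub>R u}. ?G w e *\<^sub>R e)" using k rep[of w] by simp
  next
    fix e e' assume "e \<in> {k *\<^sub>R u}" "e' \<in> {k *\<^sub>R u}"
    then have e: "e = k *\<^sub>R u" "e' = k *\<^sub>R u" by auto
    have "?G (k *\<^sub>R u) (k *\<^sub>R u) = k * k * ?G u u"
      by (simp only: bilinear_lmul[OF bl] bilinear_rmul[OF bl] real_scaleR_def mult.assoc)
    then show "?G e e' = (if e = e' then 1 else 0)" unfolding e k by simp
  qed simp
  note l = laplacian_f[OF z this]
  have "dd (\<lambda>z. dd f z (k *\<^sub>R u, 0)) z (k *\<^sub>R u, 0) = k * k * dd (\<lambda>z. dd f z (u, 0)) z (u, 0)"
  proof -
    have "dd (\<lambda>z. dd f z (k *\<^sub>R u, 0)) z = dd (\<lambda>z. k * dd f z (u, 0)) z"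
      by (rule dd_cong[OF open_UV z]) (use linear_scale[OF lin_df1] in simp)
    also have "\<dots> = (\<lambda>h. k * dd (\<lambda>z. dd f z (u, 0)) z h)"
      by (rule dd_eqI[OF has_derivative_mult_right[OF ddf[OF z]]])
    finally show ?thesis
      using linear_scale[OF smooth_on_linear_dd[OF smooth_on_dd[OF f_smooth, of "(u, 0)"] z], of k "(u, 0)"] by simp
  qed
  moreover have "\<gamma>1 (fst z) (k *\<^sub>R u) (k *\<^sub>R u) = (k * k) *\<^sub>R \<gamma>1 (fst z) u u"
    by (simp add: bilinear_lmul[OF bil_\<gamma>1[OF z]] bilinear_rmul[OF bil_\<gamma>1[OF z]])
  ultimately have 1: "(\<Sum>e\<in>Basis. dd grad_f z (e, 0) \<bullet> e) + \<tau>1 (fst z) (grad_f z) =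
    k * k * (dd (\<lambda>z. dd f z (u, 0)) z (u, 0) - dd f z (\<gamma>1 (fst z) u u, 0))"
    using l linear_scale[OF lin_df1[OF z], of "k * k"] by (simp add: algebra_simps)
  define a where "a = grad_f z \<bullet> u"
  have \<xi>: "grad_f z = a *\<^sub>R u" using rep[of "grad_f z"] by (simp add: a_def)
  have "dd f z (u, 0) = ?G (grad_f z) u" using grad_f[OF z] by simp
  also have "\<dots> = a * ?G u u" by (simp only: \<xi> bilinear_lmul[OF bl] real_scaleR_def)
  finally have df: "dd f z (u, 0) = a * ?G u u" .
  have 2: "dd f z (grad_f z, 0) = a * dd f z (u, 0)" using linear_scale[OF lin_df1[OF z], of a u] by (simp add: \<xi>)
  have "?G u u * lap z = (k * k * ?G u u) * (dd (\<lambda>z. dd f z (u, 0)) z (u, 0) - dd f z (\<gamma>1 (fst z) u u, 0)) + (a * ?G u u) * dd f z (u, 0)"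
    unfolding lap_def 1 2 by (simp add: algebra_simps)
  then show ?thesis unfolding k df[symmetric] by (simp add: power2_eq_square)
qed

lemma mixed_equation:
  assumes z: "z \<in> U \<times> V" and E: "\<And>u v. ric \<Gamma> z u v = lam * g z u v"
  shows "(real DIM('f) - 1) * dd (\<lambda>z. dd f z (u, 0)) z (0, w) =
    (real DIM('e) + real DIM('f) - 2) * (dd f z (u, 0) * dd b (snd z) w)"
proof -
  have "g z (u, 0) (0, w) = 0" using lzero[OF z] by (simp add: g_eq[OF z])
  then have "ric \<Gamma> z (u, 0) (0, w) = 0" using E by simp
  then show ?thesis using ric_12[OF z, of u w] by (simp add: algebra_simps)
qed

text \<open>With b' = b'' = 0 all terms with b disappear from \<open>ric_22\<close>, and g(w, w) can
  be divided out.\<close>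

lemma lap_critical_dim_1:
  assumes z: "z \<in> U \<times> V" and E: "\<And>u v. ric \<Gamma> z u v = lam * g z u v"
    and dim: "DIM('f) = 1" and w: "w \<in> Basis" and crit: "dd b (snd z) w = 0" "dd (\<lambda>y. dd b y w) (snd z) w = 0"
  shows "lap z = - lam"
proof -
  let ?E = "exp (2 * f z) * G2 (snd z) w w"
  have "w \<noteq> 0" using w by auto
  then have "?E > 0" using G2[OF snd_mem[OF z]] by (simp add: inner_form_def)
  moreover have "- (?E * lap z) = lam * ?E"
    using ric_22[OF z dim w] crit E[of "(0, w)" "(0, w)"] lzero[OF z] by (simp add: lap_def g_eq[OF z])
  then have "?E * (lap z + lam) = 0" by (simp add: algebra_simps)
  ultimately show ?thesis by auto
qed

text \<open>A one-dimensional base contributes no curvature, so \<open>ric_11\<close> and the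
  Einstein equation give \<open>DIM('f) * lap z = - (\<kappa> z + lam)\<close>;
  \<open>\<kappa>_critical\<close> supplies the sign of \<open>\<kappa> z\<close>.\<close>

lemma lap_critical:
  assumes z: "z \<in> U \<times> V" and E: "\<And>u v. ric \<Gamma> z u v = lam * g z u v" and dim: "DIM('e) = 1"
    and crit: "\<And>w. dd b (snd z) w = 0"
  shows "(\<And>w. dd (\<lambda>y. dd b y w) (snd z) w \<ge> 0) \<Longrightarrow> lam \<ge> 0 \<Longrightarrow> lap z \<le> 0"
    and "(\<And>w. dd (\<lambda>y. dd b y w) (snd z) w \<le> 0) \<Longrightarrow> lam \<le> 0 \<Longrightarrow> lap z \<ge> 0"
proof -
  obtain u :: 'e where u: "u \<in> Basis" using nonempty_Basis by blast
  have u0: "u \<noteq> 0" using u by auto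
  let ?B = "exp (2 * b (snd z)) * G1 (fst z) u u"
  have pos: "?B > 0" using G1[OF fst_mem[OF z]] u0 by (simp add: inner_form_def)
  obtain I where I: "frame (\<lambda>u v. exp (2 * f z) * G2 (snd z) u v) I"
    using frame_exists[OF inner_form_scale[OF G2[OF snd_mem[OF z]]], of "exp (2 * f z)"] by auto
  note \<kappa> = \<kappa>_critical[OF z crit I]
  have "- (DIM('f) * (?B * lap z)) - ?B * \<kappa> z = lam * ?B"
    using ric_11[OF z, of u u] E[of "(u,0)" "(u,0)"] lzero[OF z] ric_dim_1[OF dim u, of \<gamma>1 "fst z" u]
    unfolding lap_dim_1[OF dim u z] by (simp add: g_eq[OF z] power2_eq_square)
  then have "?B * (DIM('f) * lap z + (\<kappa> z + lam)) = 0" by (simp add: algebra_simps)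
  then have eq: "DIM('f) * lap z = - (\<kappa> z + lam)" using pos by auto
  have n: "real DIM('f) > 0" by simp
  show "lap z \<le> 0" if "\<And>w. dd (\<lambda>y. dd b y w) (snd z) w \<ge> 0" "lam \<ge> 0"
  proof -
    have "\<kappa> z \<ge> 0" unfolding \<kappa> by (intro sum_nonneg that)
    then have "DIM('f) * lap z \<le> 0" using eq that(2) by simp
    then show ?thesis using n by (simp add: mult_le_0_iff)
  qed
  show "lap z \<ge> 0" if "\<And>w. dd (\<lambda>y. dd b y w) (snd z) w \<le> 0" "lam \<le> 0"
  proof -
    have "\<kappa> z \<le> 0" unfolding \<kappa> by (intro sum_nonpos that)
    then have "DIM('f) * lap z \<ge> 0" using eq that(2) by simp
    then show ?thesis using n by (simp add: zero_le_mult_iff)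
  qed
qed

end

text \<open>Divided differences: subtracting the equations in pairs removes p, subtracting once more
  removes q.\<close>

lemma quadratic_zero:
  fixes r :: real
  assumes "x1 \<noteq> x2" "x1 \<noteq> x3" "x2 \<noteq> x3"
    and "p + q * x1 + r * x1\<^sup>2 = 0" "p + q * x2 + r * x2\<^sup>2 = 0" "p + q * x3 + r * x3\<^sup>2 = 0"
  shows "r = 0"
proof -
  have "(x1 - x2) * (q + r * (x1 + x2)) = 0" "(x1 - x3) * (q + r * (x1 + x3)) = 0"
    using assms(4-6) by (simp_all add: algebra_simps power2_eq_square)
  then have "q + r * (x1 + x2) = 0" "q + r * (x1 + x3) = 0" using assms by auto
  moreover have "r * (x2 - x3) = (q + r * (x1 + x2)) - (q + r * (x1 + x3))" by (simp add: algebra_simps)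
  ultimately have "r * (x2 - x3) = 0" by simp
  then show ?thesis using assms(3) by simp
qed

text \<open>For such a v the vectors u + v and u - v are orthogonal again; a bilinear form that
  vanishes on orthogonal pairs then takes the same value on u and on v.\<close>

lemma orthogonal_same_length_exists:
  fixes G :: "'e::euclidean_space \<Rightarrow> 'e \<Rightarrow> real"
  assumes G: "inner_form G" and dim: "DIM('e) \<ge> 2" and u: "u \<noteq> 0"
  shows "\<exists>v. G u v = 0 \<and> G v v = G u u"
proof -
  have bl: "bilinear G" using G by (simp add: inner_form_def)
  have "\<exists>w. w \<notin> span {u}"
  proof (rule ccontr)
    assume "\<nexists>w. w \<notin> span {u}"
    then have "dim (UNIV :: 'e set) \<le> card {u}" by (intro dim_le_card) auto
    then show False using dim by simp
  qed
  then obtain w where w: "w \<notin> span {u}" by blast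
  have uu: "G u u > 0" using G u by (simp add: inner_form_def)
  define v where "v = w - (G u w / G u u) *\<^sub>R u"
  have "v \<noteq> 0" using w span_scale[OF span_base[of u "{u}"], of "G u w / G u u"] by (auto simp: v_def)
  then have vv: "G v v > 0" using G by (simp add: inner_form_def)
  have uv: "G u v = 0" using uu by (simp add: v_def bilinear_rsub[OF bl] bilinear_rmul[OF bl])
  have "sqrt (G u u / G v v) * (sqrt (G u u / G v v) * G v v) = G u u"
    using uu vv by (simp add: mult.assoc[symmetric] del: real_sqrt_divide)
  then show ?thesis
    by (intro exI[of _ "sqrt (G u u / G v v) *\<^sub>R v"]) (simp add: uv bilinear_rmul[OF bl] bilinear_lmul[OF bl] del: real_sqrt_divide)
qed

text \<open>The global counterpart of \<open>warped_chart\<close>. In the application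
  \<open>G1\<close> is a metric in the first class rescaled by the M1-part of the first exponent,
  which leaves \<open>b\<close> on M2.\<close>

locale einstein_warped =
  fixes A1 :: "('a::{t2_space, second_countable_topology}, 'e::euclidean_space) chart set"
    and A2 :: "('b::{t2_space, second_countable_topology}, 'f::euclidean_space) chart set"
    and G1 :: "('a, 'e) metric_field" and G2 :: "('b, 'f) metric_field" and g :: "('a \<times> 'b, 'e \<times> 'f) metric_field"
    and b :: "'b \<Rightarrow> real" and f :: "'a \<times> 'b \<Rightarrow> real"
    and \<Gamma> :: "('a \<times> 'b, 'e \<times> 'f) connection_field" and lam :: real
  assumes A1: "compact_manifold A1" and A2: "compact_manifold A2" and dim: "DIM('e) + DIM('f) \<ge> 3"
    and G1: "riemannian_metric A1 G1" and G2: "riemannian_metric A2 G2"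
    and b: "smooth_fun A2 b" and f: "smooth_fun (prod_atlas A1 A2) f"
    and g_eq: "\<And>\<phi> \<psi> z u v. \<phi> \<in> A1 \<Longrightarrow> \<psi> \<in> A2 \<Longrightarrow> z \<in> cod_of \<phi> \<times> cod_of \<psi> \<Longrightarrow> g (prod_chart \<phi> \<psi>) z u v =
      exp (2 * b (point \<psi> (snd z))) * G1 \<phi> (fst z) (fst u) (fst v) + exp (2 * local2 f \<phi> \<psi> z) * G2 \<psi> (snd z) (snd u) (snd v)"
    and LC: "levi_civita (prod_atlas A1 A2) g \<Gamma>"
    and ricci: "\<And>P z u v. P \<in> prod_atlas A1 A2 \<Longrightarrow> z \<in> cod_of P \<Longrightarrow> ricci \<Gamma> P z u v = lam * g P z u v"
begin

section \<open>The Einstein equation on the compact product, by dimensions of the factors\<close>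

lemma atlas: "smooth_atlas A1" "smooth_atlas A2" "connected (UNIV :: 'a set)" "connected (UNIV :: 'b set)" "compact (UNIV :: 'b set)"
  using A1 A2 by (auto simp: compact_manifold_def smooth_manifold_def)

context
  fixes \<phi> \<psi> assumes \<phi>: "\<phi> \<in> A1" and \<psi>: "\<psi> \<in> A2"
begin

lemma charts: "is_chart \<phi>" "is_chart \<psi>" and P: "prod_chart \<phi> \<psi> \<in> prod_atlas A1 A2"
  using smooth_atlasD(1)[OF atlas(1) \<phi>] smooth_atlasD(1)[OF atlas(2) \<psi>] \<phi> \<psi> unfolding mem_prod_atlas by blast+

lemma local_f_smooth: "smooth_on (cod_of \<phi> \<times> cod_of \<psi>) (local2 f \<phi> \<psi>)"
  by (rule smooth_on_local2[OF atlas(1) \<phi> atlas(2) \<psi> f])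

lemma chart: "warped_chart (cod_of \<phi>) (cod_of \<psi>) (G1 \<phi>) (G2 \<psi>) (\<lambda>y. b (point \<psi> y)) (local2 f \<phi> \<psi>) (\<Gamma> (prod_chart \<phi> \<psi>)) (g (prod_chart \<phi> \<psi>))"
proof
  show "open (cod_of \<phi>)" "open (cod_of \<psi>)" using is_chartD(2) charts by blast+
  show "x \<in> cod_of \<phi> \<Longrightarrow> inner_form (G1 \<phi> x)" "smooth_on (cod_of \<phi>) (\<lambda>x. G1 \<phi> x u v)" for x u v
    using riemannian_metricD[OF G1 \<phi>] by blast+
  show "y \<in> cod_of \<psi> \<Longrightarrow> inner_form (G2 \<psi> y)" "smooth_on (cod_of \<psi>) (\<lambda>y. G2 \<psi> y u' v')" for y u' v'
    using riemannian_metricD[OF G2 \<psi>] by blast+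
  show "smooth_on (cod_of \<psi>) (\<lambda>y. b (point \<psi> y))" by (rule smooth_funD[OF b \<psi>])
  show "smooth_on (cod_of \<phi> \<times> cod_of \<psi>) (local2 f \<phi> \<psi>)" by (rule local_f_smooth)
  have conn: "linear_connection (prod_atlas A1 A2) \<Gamma>" and tor: "torsion_free (prod_atlas A1 A2) \<Gamma>"
    and met: "\<And>z u v w. z \<in> cod_of (prod_chart \<phi> \<psi>) \<Longrightarrow> nabla_metric \<Gamma> g (prod_chart \<phi> \<psi>) z u v w = 0"
    using LC P unfolding levi_civita_def by blast+
  show "smooth_on (cod_of \<phi> \<times> cod_of \<psi>) (\<lambda>z. \<Gamma> (prod_chart \<phi> \<psi>) z u v)" for u v
  proof -
    have "smooth_on (cod_of (prod_chart \<phi> \<psi>)) (\<lambda>z. \<Gamma> (prod_chart \<phi> \<psi>) z u v)"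
      using conn P unfolding linear_connection_def by blast
    then show ?thesis by simp
  qed
  fix z u v w assume z: "z \<in> cod_of \<phi> \<times> cod_of \<psi>"
  then have zP: "z \<in> cod_of (prod_chart \<phi> \<psi>)" by simp
  show "bilinear (\<Gamma> (prod_chart \<phi> \<psi>) z)" using conn P zP unfolding linear_connection_def by blast
  show "\<Gamma> (prod_chart \<phi> \<psi>) z u v = \<Gamma> (prod_chart \<phi> \<psi>) z v u" using tor P zP unfolding torsion_free_def by blast
  show "g (prod_chart \<phi> \<psi>) z u v = exp (2 * b (point \<psi> (snd z))) * G1 \<phi> (fst z) (fst u) (fst v) + exp (2 * local2 f \<phi> \<psi> z) * G2 \<psi> (snd z) (snd u) (snd v)"
    by (rule g_eq[OF \<phi> \<psi> z])
  show "dd (\<lambda>z. g (prod_chart \<phi> \<psi>) z v w) z u = g (prod_chart \<phi> \<psi>) z (\<Gamma> (prod_chart \<phi> \<psi>) z u v) w + g (prod_chart \<phi> \<psi>) z v (\<Gamma> (prod_chart \<phi> \<psi>) z u w)"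
    using met[OF zP, of u v w] by (simp add: nabla_metric_def)
qed

lemma einstein: "z \<in> cod_of \<phi> \<times> cod_of \<psi> \<Longrightarrow> ric (\<Gamma> (prod_chart \<phi> \<psi>)) z u v = lam * g (prod_chart \<phi> \<psi>) z u v"
  using ricci[OF P] by (simp add: ricci_eq_ric)

lemma mixed:
  assumes z: "z \<in> cod_of \<phi> \<times> cod_of \<psi>"
  shows "(real DIM('f) - 1) * dd (\<lambda>z. dd (local2 f \<phi> \<psi>) z (u, 0)) z (0, w) =
    (real DIM('e) + real DIM('f) - 2) * (dd (local2 f \<phi> \<psi>) z (u, 0) * dd (\<lambda>y. b (point \<psi> y)) (snd z) w)"
  by (rule warped_chart.mixed_equation[OF chart z einstein[OF z]])

end

text \<open>The slice over y is a copy of the compact manifold M1, so the maximum principle applies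
  to s f there; a negative s turns supersolutions into subsolutions.\<close>

lemma constant_slice:
  assumes s: "s \<noteq> 0" and q: "\<psi> \<in> A2" "y \<in> cod_of \<psi>"
    and lap: "\<And>\<phi> x. \<phi> \<in> A1 \<Longrightarrow> x \<in> cod_of \<phi> \<Longrightarrow>
      s * warped_chart.lap (G1 \<phi>) (\<lambda>y. b (point \<psi> y)) (local2 f \<phi> \<psi>) (x, y) \<ge> 0"
  shows "f (p, point \<psi> y) = f (p', point \<psi> y)"
proof -
  have fs: "smooth_fun A1 (\<lambda>p. f (p, point \<psi> y))" by (rule smooth_fun_slices(1)[OF atlas(1,2) f])
  have "s * f (p, point \<psi> y) = s * f (p', point \<psi> y)"
  proof (rule strong_maximum_principle[OF A1])
    show "smooth_fun A1 (\<lambda>p. s * f (p, point \<psi> y))"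
      by (intro smooth_funI smooth_on_mult smooth_on_const smooth_funD[OF fs] is_chartD(2) smooth_atlasD(1)[OF atlas(1)])
    fix \<phi> assume \<phi>: "\<phi> \<in> A1"
    show "elliptic_subsolution (cod_of \<phi>) (\<lambda>x. s * f (point \<phi> x, point \<psi> y))"
      using warped_chart.slice_subsolution[OF chart[OF \<phi> q(1)] q(2), of s] lap[OF \<phi>] by simp
  qed
  then show ?thesis using s by simp
qed

lemma df_zero_if_constant_slice:
  assumes \<phi>: "\<phi> \<in> A1" "x \<in> cod_of \<phi>" and \<psi>: "\<psi> \<in> A2" "y \<in> cod_of \<psi>"
    and c: "\<And>p p'. f (p, point \<psi> y) = f (p', point \<psi> y)"
  shows "dd (local2 f \<phi> \<psi>) (x, y) (u, 0) = 0"
proof -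
  have "dd (local2 f \<phi> \<psi>) (x, y) (u, 0) = dd (\<lambda>x. f (point \<phi> x, point \<psi> y)) x u"
    using dd_slice1(1)[OF smooth_on_differentiable[OF local_f_smooth[OF \<phi>(1) \<psi>(1)], of "(x, y)"]] \<phi>(2) \<psi>(2) by simp
  also have "(\<lambda>x. f (point \<phi> x, point \<psi> y)) = (\<lambda>x. f (point \<phi> x0, point \<psi> y))" for x0 using c by blast
  finally show ?thesis by simp
qed

lemma df_zero_fibre_dim_1:
  assumes dimf: "DIM('f) = 1" and \<phi>: "\<phi> \<in> A1" "x \<in> cod_of \<phi>" and \<psi>: "\<psi> \<in> A2" "y \<in> cod_of \<psi>"
  shows "dd (local2 f \<phi> \<psi>) (x, y) (u, 0) = 0"
proof -
  obtain w :: 'f where w: "w \<in> Basis" using nonempty_Basis by blast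
  let ?b = "\<lambda>y. b (point \<psi> y)" and ?f = "local2 f \<phi> \<psi>"
  note sb = smooth_funD[OF b \<psi>(1)] and sf = local_f_smooth[OF \<phi>(1) \<psi>(1)]
  \<comment> \<open>The left side of the mixed equation has the factor n2 - 1 = 0, the right side n1
    + n2 - 2 > 0 because the total dimension is at least 3.\<close>
  have nz: "dd ?f (x, y') (u, 0) = 0" if "y' \<in> cod_of \<psi>" "dd ?b y' w \<noteq> 0" for y'
    using mixed[OF \<phi>(1) \<psi>(1), of "(x, y')" u w] that \<phi>(2) dim dimf by simp
  consider "dd ?b y w \<noteq> 0" | "dd ?b y w = 0" "dd (\<lambda>y. dd ?b y w) y w \<noteq> 0" | "dd ?b y w = 0" "dd (\<lambda>y. dd ?b y w) y w = 0" by blast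
  then show ?thesis
  proof cases
    case 1 then show ?thesis using nz \<psi>(2) by blast
  next
    case 2
    \<comment> \<open>b' vanishes at y with nonzero derivative, so it is nonzero just beyond y along
      w. There \<open>nz\<close> applies, and continuity carries the conclusion back to y.\<close>
    let ?h = "\<lambda>t. dd ?b (y + t *\<^sub>R w) w" and ?k = "\<lambda>t. dd ?f (x, y + t *\<^sub>R w) (u, 0)"
    have h: "(?h has_real_derivative dd (\<lambda>y. dd ?b y w) y w) (at 0)"
      using has_real_derivative_along_line[of "\<lambda>y. dd ?b y w" y 0 w] smooth_on_differentiable[OF smooth_on_dd[OF sb] \<psi>(2)] by simp
    have "\<exists>d>0. \<forall>t>0. t < d \<longrightarrow> ?h t \<noteq> 0"
    proof (cases "dd (\<lambda>y. dd ?b y w) y w > 0")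
      case True
      from DERIV_pos_inc_right[OF h True] show ?thesis using 2(1) by force
    next
      case False
      then have "dd (\<lambda>y. dd ?b y w) y w < 0" using 2(2) by simp
      from DERIV_neg_dec_right[OF h this] show ?thesis using 2(1) by force
    qed
    then obtain d where d: "d > 0" "\<And>t. 0 < t \<Longrightarrow> t < d \<Longrightarrow> ?h t \<noteq> 0" by blast
    have "open ((\<lambda>t. y + t *\<^sub>R w) -` cod_of \<psi>)"
      using is_chartD(2)[OF charts(2)[OF \<phi>(1) \<psi>(1)]] by (auto intro!: open_vimage continuous_intros)
    then obtain r where r: "r > 0" "ball 0 r \<subseteq> (\<lambda>t. y + t *\<^sub>R w) -` cod_of \<psi>"
      using \<psi>(2) openE[of "(\<lambda>t. y + t *\<^sub>R w) -` cod_of \<psi>" 0] by auto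
    have kz: "?k t = 0" if "0 < t" "t < min d r" for t
      using nz[of "y + t *\<^sub>R w"] d(2)[of t] r(2) that by (force simp: dist_real_def)
    have "continuous_on (ball 0 r) ?k"
      by (rule continuous_on_compose2[OF smooth_on_continuous[OF smooth_on_dd[OF sf]]])
        (use r(2) \<phi>(2) in \<open>auto intro!: continuous_intros\<close>)
    then have "isCont ?k 0" using r(1) by (simp add: continuous_on_eq_continuous_at)
    then have "(?k \<longlongrightarrow> ?k 0) (at_right 0)" by (simp add: continuous_within filterlim_at_split isCont_def)
    moreover have "(?k \<longlongrightarrow> 0) (at_right 0)"
    proof (rule tendsto_eventually)
      show "\<forall>\<^sub>F t in at_right 0. ?k t = 0"
        unfolding eventually_at_right_field using kz d(1) r(1) by (intro exI[of _ "min d r"]) auto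
    qed
    ultimately have "?k 0 = 0" using tendsto_unique trivial_limit_at_right_real by blast
    then show ?thesis by simp
  next
    case 3
    have lap: "warped_chart.lap (G1 \<phi>') ?b (local2 f \<phi>' \<psi>) (x', y) = - lam" if "\<phi>' \<in> A1" "x' \<in> cod_of \<phi>'" for \<phi>' x'
      using warped_chart.lap_critical_dim_1[OF chart[OF that(1) \<psi>(1)] _ einstein[OF that(1) \<psi>(1)] dimf w, of "(x', y)"] 3 that(2) \<psi>(2) by simp
    have "f (p, point \<psi> y) = f (p', point \<psi> y)" for p p'
      \<comment> \<open>Here \<open>lap\<close> is the constant - lam on the slice, so this sign
        makes s * lap nonnegative.\<close>
      by (rule constant_slice[of "if lam \<le> 0 then 1 else - 1", OF _ \<psi>]) (auto simp: lap)
    then show ?thesis by (rule df_zero_if_constant_slice[OF \<phi> \<psi>])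
  qed
qed

text \<open>For n2 \<ge> 2 the mixed equation can be divided by n2 - 1 and becomes linear in D1 f:
  its derivative along M2 is k Db times D1 f. The integrating factor is e^(-k b), and connectedness
  of M2 links points in different charts.\<close>

lemma df_transport:
  assumes dimf: "DIM('f) \<ge> 2" and \<phi>: "\<phi> \<in> A1" "x \<in> cod_of \<phi>"
  defines "k \<equiv> (real DIM('e) + real DIM('f) - 2) / (real DIM('f) - 1)"
  shows "exp (- k * b q) * dd (\<lambda>x. f (point \<phi> x, q)) x u = exp (- k * b q') * dd (\<lambda>x. f (point \<phi> x, q')) x u"
proof (rule constant_if_dd_zero[OF atlas(2,4), of "\<lambda>q. exp (- k * b q) * dd (\<lambda>x. f (point \<phi> x, q)) x u"])
  fix \<psi> y w assume \<psi>: "\<psi> \<in> A2" "y \<in> cod_of \<psi>"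
  let ?b = "\<lambda>y. b (point \<psi> y)" and ?f = "local2 f \<phi> \<psi>"
  note sb = smooth_funD[OF b \<psi>(1)] and sf = local_f_smooth[OF \<phi>(1) \<psi>(1)]
  note o = is_chartD(2)[OF charts(2)[OF \<phi>(1) \<psi>(1)]]
  have eq: "exp (- k * ?b y) * dd (\<lambda>x. f (point \<phi> x, point \<psi> y)) x u = exp (- k * ?b y) * dd ?f (x, y) (u, 0)" if "y \<in> cod_of \<psi>" for y
    using dd_slice1(1)[OF smooth_on_differentiable[OF sf, of "(x, y)"]] \<phi>(2) that by simp
  have z: "(x, y) \<in> cod_of \<phi> \<times> cod_of \<psi>" using \<phi> \<psi> by simp
  have df: "(\<lambda>z. dd ?f z (u, 0)) differentiable (at (x, y))" by (rule smooth_on_differentiable[OF smooth_on_dd[OF sf] z])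
  have h: "((\<lambda>y. exp (- k * ?b y) * dd ?f (x, y) (u, 0)) has_derivative
     (\<lambda>w. exp (- k * ?b y) * dd (\<lambda>z. dd ?f z (u, 0)) (x, y) (0, w) + (exp (- k * ?b y) * (- k * dd ?b y w)) * dd ?f (x, y) (u, 0))) (at y)"
    using dd_works[OF dd_slice2(2)[OF df]] dd_slice2(1)[OF df]
    by (auto intro!: derivative_eq_intros smooth_on_has_derivative[OF sb \<psi>(2)])
  show "(\<lambda>y. exp (- k * ?b y) * dd (\<lambda>x. f (point \<phi> x, point \<psi> y)) x u) differentiable at y"
    by (rule differentiable_cong[OF o \<psi>(2) _ differentiableI[OF h]]) (rule eq[symmetric])
  have n: "real DIM('f) - 1 \<noteq> 0" using dimf by simp
  have D: "dd (\<lambda>z. dd ?f z (u, 0)) (x, y) (0, w) = k * (dd ?f (x, y) (u, 0) * dd ?b y w)"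
    using mixed[OF \<phi>(1) \<psi>(1) z, of u w] n by (simp add: k_def field_simps)
  have "frechet_derivative (\<lambda>y. exp (- k * ?b y) * dd (\<lambda>x. f (point \<phi> x, point \<psi> y)) x u) (at y) =
      frechet_derivative (\<lambda>y. exp (- k * ?b y) * dd ?f (x, y) (u, 0)) (at y)"
    by (rule dd_cong[OF o \<psi>(2) eq])
  from fun_cong[OF trans[OF this dd_eqI[OF h]], of w] D
  show "dd (\<lambda>y. exp (- k * ?b y) * dd (\<lambda>x. f (point \<phi> x, point \<psi> y)) x u) y w = 0" by simp
qed

lemma df_zero_base_dim_1:
  assumes dime: "DIM('e) = 1" and \<phi>: "\<phi> \<in> A1" "x \<in> cod_of \<phi>" and \<psi>: "\<psi> \<in> A2" "y \<in> cod_of \<psi>"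
  shows "dd (local2 f \<phi> \<psi>) (x, y) (u, 0) = 0"
proof -
  have dimf: "DIM('f) \<ge> 2" using dim dime by simp
  have cont: "continuous_on UNIV b" by (rule smooth_fun_continuous[OF atlas(2) b])
  have "\<exists>q. \<forall>p p'. f (p, q) = f (p', q)"
  \<comment> \<open>The terms of - (\<open>\<kappa>\<close> + lam) must not compete: a minimum of b
    goes with lam \<ge> 0, a maximum with lam < 0.\<close>
  proof (cases "lam \<ge> 0")
    case True
    obtain q where q: "\<And>q'. b q \<le> b q'" using continuous_attains_inf[OF atlas(5) _ cont] by auto
    obtain \<psi> where \<psi>: "\<psi> \<in> A2" "q \<in> dom_of \<psi>" using smooth_atlasD(2)[OF atlas(2)] by blast
    note c = is_chartD[OF smooth_atlasD(1)[OF atlas(2) \<psi>(1)]]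
    define y where "y = coord \<psi> q"
    have y: "y \<in> cod_of \<psi>" "point \<psi> y = q" using c(5,6) \<psi>(2) by (auto simp: y_def)
    let ?b = "\<lambda>y. b (point \<psi> y)"
    note sb = smooth_funD[OF b \<psi>(1)]
    \<comment> \<open>The minimum of b is treated as a maximum of - b; \<open>m1\<close> and
      \<open>m2\<close> translate the derivatives back.\<close>
    note max = second_derivative_at_max[OF c(2) smooth_on_minus[OF c(2) sb] y(1)]
    have m1: "dd (\<lambda>y. - ?b y) y' w = - dd ?b y' w" if "y' \<in> cod_of \<psi>" for y' w
      by (simp add: dd_eqI[OF has_derivative_minus[OF smooth_on_has_derivative[OF sb that]]])
    have m2: "dd (\<lambda>y. dd (\<lambda>y. - ?b y) y w) y w = - dd (\<lambda>y. dd ?b y w) y w" for w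
      using dd_cong[OF c(2) y(1), of "\<lambda>y. dd (\<lambda>y. - ?b y) y w", OF m1]
      by (simp add: dd_eqI[OF has_derivative_minus[OF smooth_on_has_derivative[OF smooth_on_dd[OF sb] y(1)]]])
    have crit: "dd ?b y w = 0" "dd (\<lambda>y. dd ?b y w) y w \<ge> 0" for w
      using max[of w] q y(2) m1[OF y(1), of w] m2[of w] by auto
    have "f (p, point \<psi> y) = f (p', point \<psi> y)" for p p'
    proof (rule constant_slice[of "- 1", OF _ \<psi>(1) y(1)])
      fix \<phi> x assume h: "\<phi> \<in> A1" "x \<in> cod_of \<phi>"
      show "- 1 * warped_chart.lap (G1 \<phi>) ?b (local2 f \<phi> \<psi>) (x, y) \<ge> 0"
        using warped_chart.lap_critical(1)[OF chart[OF h(1) \<psi>(1)] _ einstein[OF h(1) \<psi>(1)] dime, of "(x, y)"] crit True h(2) y(1) by simp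
    qed simp
    then show ?thesis by blast
  next
    case False
    obtain q where q: "\<And>q'. b q' \<le> b q" using continuous_attains_sup[OF atlas(5) _ cont] by auto
    obtain \<psi> where \<psi>: "\<psi> \<in> A2" "q \<in> dom_of \<psi>" using smooth_atlasD(2)[OF atlas(2)] by blast
    note c = is_chartD[OF smooth_atlasD(1)[OF atlas(2) \<psi>(1)]]
    define y where "y = coord \<psi> q"
    have y: "y \<in> cod_of \<psi>" "point \<psi> y = q" using c(5,6) \<psi>(2) by (auto simp: y_def)
    let ?b = "\<lambda>y. b (point \<psi> y)"
    note max = second_derivative_at_max[OF c(2) smooth_funD[OF b \<psi>(1)] y(1)]
    have crit: "dd ?b y w = 0" "dd (\<lambda>y. dd ?b y w) y w \<le> 0" for w
      using max[of w] q y(2) by auto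
    have "f (p, point \<psi> y) = f (p', point \<psi> y)" for p p'
    proof (rule constant_slice[of 1, OF _ \<psi>(1) y(1)])
      fix \<phi> x assume h: "\<phi> \<in> A1" "x \<in> cod_of \<phi>"
      show "1 * warped_chart.lap (G1 \<phi>) ?b (local2 f \<phi> \<psi>) (x, y) \<ge> 0"
        using warped_chart.lap_critical(2)[OF chart[OF h(1) \<psi>(1)] _ einstein[OF h(1) \<psi>(1)] dime, of "(x, y)"] crit False h(2) y(1) by simp
    qed simp
    then show ?thesis by blast
  qed
  then obtain q where q: "\<And>p p'. f (p, q) = f (p', q)" by blast
  \<comment> \<open>D1 f vanishes on the slice over q, and \<open>df_transport\<close> spreads this
    to every slice, its exponential factors being nonzero.\<close>
  have "(\<lambda>x. f (point \<phi> x, q)) = (\<lambda>x. f (point \<phi> x0, q))" for x0 using q by blast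
  then have "dd (\<lambda>x. f (point \<phi> x, q)) x u = 0" by (metis frechet_derivative_const)
  then have "dd (\<lambda>x. f (point \<phi> x, point \<psi> y)) x u = 0"
    using df_transport[OF dimf \<phi>, of q u "point \<psi> y"] by simp
  then show ?thesis
    using dd_slice1(1)[OF smooth_on_differentiable[OF local_f_smooth[OF \<phi>(1) \<psi>(1)], of "(x, y)"]] \<phi>(2) \<psi>(2) by simp
qed

lemma df_zero_if_b_not_constant:
  assumes dime: "DIM('e) \<ge> 2" and dimf: "DIM('f) \<ge> 2" and nc: "b q1 \<noteq> b q2"
    and \<phi>: "\<phi> \<in> A1" "x \<in> cod_of \<phi>" and \<psi>: "\<psi> \<in> A2" "y \<in> cod_of \<psi>"
  shows "dd (local2 f \<phi> \<psi>) (x, y) (u, 0) = 0"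
proof -
  define k where "k = (real DIM('e) + real DIM('f) - 2) / (real DIM('f) - 1)"
  have k: "k > 0" using dime dimf by (simp add: k_def)
  \<comment> \<open>This is e^(-k b) D1 f, evaluated over q1 but the same over every q by
    \<open>df_transport\<close>: a 1-form on M1 in the chart \<phi>.\<close>
  define \<alpha> where "\<alpha> = (\<lambda>x u. exp (- k * b q1) * dd (\<lambda>x. f (point \<phi> x, q1)) x u)"
  note U = is_chartD(2)[OF charts(1)[OF \<phi>(1) \<psi>(1)]]
  have tr: "dd (\<lambda>x. f (point \<phi> x, q)) x u = exp (k * b q) * \<alpha> x u" if "x \<in> cod_of \<phi>" for x q u
  proof -
    have "exp (k * b q) * (exp (- k * b q) * dd (\<lambda>x. f (point \<phi> x, q)) x u) = exp (k * b q) * \<alpha> x u"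
      using df_transport[OF dimf \<phi>(1) that, of q u q1] by (simp add: \<alpha>_def k_def)
    then show ?thesis by (simp add: mult.assoc[symmetric] exp_add[symmetric])
  qed
  have s1: "smooth_on (cod_of \<phi>) (\<lambda>x. f (point \<phi> x, q))" for q
    by (rule smooth_funD[OF smooth_fun_slices(1)[OF atlas(1,2) f] \<phi>(1)])
  have s\<alpha>: "smooth_on (cod_of \<phi>) (\<lambda>x. \<alpha> x u)" for u
    unfolding \<alpha>_def by (intro smooth_on_mult smooth_on_const smooth_on_dd s1 U)
  have lin\<alpha>: "linear (\<alpha> x)"
  proof -
    have "\<alpha> x = (\<lambda>u. exp (- k * b q1) *\<^sub>R dd (\<lambda>x. f (point \<phi> x, q1)) x u)" by (simp add: \<alpha>_def)
    then show ?thesis using linear_compose_scale_right[OF smooth_on_linear_dd[OF s1[of q1] \<phi>(2)]] by metis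
  qed
  define \<alpha>2 where "\<alpha>2 = (\<lambda>u v. dd (\<lambda>x. \<alpha> x v) x u)"
  let ?\<gamma> = "christoffel (G1 \<phi>)"
  \<comment> \<open>On orthogonal vectors both the Einstein term and the Laplacian of b drop out of
    \<open>ric_11\<close>. What remains is a quadratic polynomial in e^(k b(q)) whose coefficients
    do not depend on q.\<close>
  have key: "\<alpha> x v * \<alpha> x w = 0" if orth: "G1 \<phi> x v w = 0" for v w
  proof -
    have eq: "(ric ?\<gamma> x v w) + (- DIM('f) * (\<alpha>2 v w - \<alpha> x (?\<gamma> x v w))) * exp (k * b q) + (- DIM('f) * (\<alpha> x v * \<alpha> x w)) * (exp (k * b q))\<^sup>2 = 0" for q
    proof -
      obtain \<psi>' where \<psi>': "\<psi>' \<in> A2" "q \<in> dom_of \<psi>'" using smooth_atlasD(2)[OF atlas(2)] by blast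
      note c = is_chartD[OF smooth_atlasD(1)[OF atlas(2) \<psi>'(1)]]
      define y' where "y' = coord \<psi>' q"
      have y': "y' \<in> cod_of \<psi>'" "point \<psi>' y' = q" using c(5,6) \<psi>'(2) by (auto simp: y'_def)
      have z: "(x, y') \<in> cod_of \<phi> \<times> cod_of \<psi>'" using \<phi>(2) y'(1) by simp
      note wc = chart[OF \<phi>(1) \<psi>'(1)]
      have d1: "dd (local2 f \<phi> \<psi>') (x', y') (v, 0) = exp (k * b q) * \<alpha> x' v" if "x' \<in> cod_of \<phi>" for x' v
        using warped_chart.slice_derivatives(1)[OF wc that y'(1), of v] tr[OF that, of q v] y'(2) by simp
      have d2: "dd (\<lambda>z. dd (local2 f \<phi> \<psi>') z (w, 0)) (x, y') (v, 0) = exp (k * b q) * \<alpha>2 v w"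
      proof -
        have "dd (\<lambda>z. dd (local2 f \<phi> \<psi>') z (w, 0)) (x, y') (v, 0) = dd (\<lambda>x'. dd (\<lambda>x. f (point \<phi> x, q)) x' w) x v"
          using warped_chart.slice_derivatives(2)[OF wc \<phi>(2) y'(1), of w v] y'(2) by simp
        also have "\<dots> = dd (\<lambda>x. exp (k * b q) * \<alpha> x w) x v" using dd_cong[OF U \<phi>(2) tr] by simp
        also have "\<dots> = exp (k * b q) * \<alpha>2 v w"
          by (simp add: \<alpha>2_def dd_eqI[OF has_derivative_mult_right[OF smooth_on_has_derivative[OF s\<alpha> \<phi>(2)]]])
        finally show ?thesis .
      qed
      have "g (prod_chart \<phi> \<psi>') (x, y') (v, 0) (w, 0) = 0"
        using warped_chart.g_eq[OF wc z] warped_chart.lzero[OF wc z] orth by simp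
      then have "ric (\<Gamma> (prod_chart \<phi> \<psi>')) (x, y') (v, 0) (w, 0) = 0" using einstein[OF \<phi>(1) \<psi>'(1) z] by simp
      then show ?thesis
        using warped_chart.ric_11[OF wc z, of v w] orth unfolding d2 by (simp add: d1[OF \<phi>(2)] power2_eq_square algebra_simps)
    qed
    \<comment> \<open>A third value of b, attained because M2 is connected: a quadratic with three
      distinct zeros has leading coefficient 0.\<close>
    define m where "m = (b q1 + b q2) / 2"
    have "\<exists>q3. b q3 = m"
    proof -
      have "connected (b ` UNIV)" by (rule connected_continuous_image[OF smooth_fun_continuous[OF atlas(2) b] atlas(4)])
      then show ?thesis
        using connectedD_interval[of "range b" "b q1" "b q2" m] connectedD_interval[of "range b" "b q2" "b q1" m]
        by (cases "b q1 \<le> b q2") (force simp: m_def)+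
    qed
    then obtain q3 where q3: "b q3 = m" by blast
    have "- DIM('f) * (\<alpha> x v * \<alpha> x w) = 0"
      by (rule quadratic_zero[OF _ _ _ eq[of q1] eq[of q2] eq[of q3]]) (use nc k q3 in \<open>auto simp: m_def\<close>)
    then show ?thesis by simp
  qed
  have "\<alpha> x u = 0"
  proof (cases "u = 0")
    case False
    note G = riemannian_metricD(1)[OF G1 \<phi>]
    have bl: "bilinear (G1 \<phi> x)" using G by (simp add: inner_form_def)
    obtain v where v: "G1 \<phi> x u v = 0" "G1 \<phi> x v v = G1 \<phi> x u u" using orthogonal_same_length_exists[OF G dime False] by blast
    have vu: "G1 \<phi> x v u = 0" using v(1) G unfolding inner_form_def by metis
    \<comment> \<open>Since |u| = |v|, this pair is orthogonal and gives \<alpha>(u)^2 =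
      \<alpha>(v)^2; the pair u, v itself gives \<alpha>(u) \<alpha>(v) = 0. Together they force
      \<alpha>(u) = 0.\<close>
    have "G1 \<phi> x (u + v) (u - v) = 0" using v vu by (simp add: bilinear_ladd[OF bl] bilinear_rsub[OF bl])
    from key[OF this] have "(\<alpha> x u)\<^sup>2 = (\<alpha> x v)\<^sup>2"
      by (simp add: linear_add[OF lin\<alpha>] linear_diff[OF lin\<alpha>] algebra_simps power2_eq_square)
    then show ?thesis using key[OF v(1)] by auto
  qed (use linear_0[OF lin\<alpha>] in simp)
  then show ?thesis
    using tr[OF \<phi>(2), of "point \<psi> y" u] warped_chart.slice_derivatives(1)[OF chart[OF \<phi>(1) \<psi>(1)] \<phi>(2) \<psi>(2), of u] by simp
qed

theorem f_splits: "splits f"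
proof (rule splits_if_mixed_zero[OF atlas(1-4) f])
  fix \<phi> \<psi> z u w assume \<phi>: "\<phi> \<in> A1" and \<psi>: "\<psi> \<in> A2" and z: "z \<in> cod_of \<phi> \<times> cod_of \<psi>"
  let ?f = "local2 f \<phi> \<psi>"
  have o: "open (cod_of \<phi> \<times> cod_of \<psi>)" by (intro open_Times is_chartD(2) charts[OF \<phi> \<psi>])
  have zero: "dd (\<lambda>z. dd ?f z (u, 0)) z (0, w) = 0" if "\<And>x y. x \<in> cod_of \<phi> \<Longrightarrow> y \<in> cod_of \<psi> \<Longrightarrow> dd ?f (x, y) (u, 0) = 0"
  proof -
    have "dd (\<lambda>z. dd ?f z (u, 0)) z = dd (\<lambda>z. 0) z"
      by (rule dd_cong[OF o z]) (use that in auto)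
    then show ?thesis by simp
  qed
  consider "DIM('f) = 1" | "DIM('e) = 1" | "DIM('f) \<ge> 2" "DIM('e) \<ge> 2"
    using DIM_positive[where 'a='e] DIM_positive[where 'a='f] by linarith
  then show "dd (\<lambda>z. dd ?f z (u, 0)) z (0, w) = 0"
  proof cases
    case 1 then show ?thesis using zero df_zero_fibre_dim_1[OF _ \<phi> _ \<psi>] by blast
  next
    case 2 then show ?thesis using zero df_zero_base_dim_1[OF _ \<phi> _ \<psi>] by blast
  next
    case 3
    show ?thesis
    proof (cases "\<exists>q1 q2. b q1 \<noteq> b q2")
      case True then show ?thesis using zero df_zero_if_b_not_constant[OF 3(2,1) _ \<phi> _ \<psi>] by blast
    next
      \<comment> \<open>For constant b the right side of the mixed equation vanishes, and n2 - 1
        \<noteq> 0 gives the claim although D1 f need not vanish.\<close>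
      case False
      then have "(\<lambda>y. b (point \<psi> y)) = (\<lambda>y. b undefined)" by blast
      then have "dd (\<lambda>y. b (point \<psi> y)) (snd z) w = 0" by simp
      then show ?thesis using mixed[OF \<phi> \<psi> z, of u w] 3(1) by simp
    qed
  qed
qed

end

section \<open>Conformal product structures\<close>

lemma conf_class_eq:
  assumes A: "smooth_atlas A" and k: "smooth_fun A k"
    and eq: "\<And>\<phi> x u v. \<phi> \<in> A \<Longrightarrow> x \<in> cod_of \<phi> \<Longrightarrow> g \<phi> x u v = exp (2 * k (point \<phi> x)) * g0 \<phi> x u v"
  shows "conf_class_of A g = conf_class_of A g0"
proof (intro set_eqI iffI)
  fix g' assume "g' \<in> conf_class_of A g"
  then obtain f where f: "riemannian_metric A g'" "smooth_fun A f"
    "\<And>\<phi> x u v. \<phi> \<in> A \<Longrightarrow> x \<in> cod_of \<phi> \<Longrightarrow> g' \<phi> x u v = exp (2 * f (point \<phi> x)) * g \<phi> x u v"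
    unfolding conf_class_of_def by blast
  then have "g' \<phi> x u v = exp (2 * (f (point \<phi> x) + k (point \<phi> x))) * g0 \<phi> x u v" if "\<phi> \<in> A" "x \<in> cod_of \<phi>" for \<phi> x u v
    using that eq[OF that] by (simp add: distrib_left exp_add)
  then show "g' \<in> conf_class_of A g0"
    using f(1) smooth_fun_add[OF A f(2) k] unfolding conf_class_of_def by blast
next
  fix g' assume "g' \<in> conf_class_of A g0"
  then obtain f where f: "riemannian_metric A g'" "smooth_fun A f"
    "\<And>\<phi> x u v. \<phi> \<in> A \<Longrightarrow> x \<in> cod_of \<phi> \<Longrightarrow> g' \<phi> x u v = exp (2 * f (point \<phi> x)) * g0 \<phi> x u v"
    unfolding conf_class_of_def by blast
  then have "g' \<phi> x u v = exp (2 * (f (point \<phi> x) - k (point \<phi> x))) * g \<phi> x u v" if "\<phi> \<in> A" "x \<in> cod_of \<phi>" for \<phi> x u v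
    using that eq[OF that] by (simp add: right_diff_distrib exp_diff)
  then show "g' \<in> conf_class_of A g"
    using f(1) smooth_fun_diff[OF A f(2) k] unfolding conf_class_of_def by blast
qed

text \<open>The chart chosen in \<open>pullback_metric\<close> may differ from
  \<open>\<phi>\<close>; the differential then contains the change of coordinates, which the
  transformation law of h absorbs.\<close>

lemma pullback_fst:
  assumes A: "smooth_atlas A" "\<phi> \<in> A" and h: "riemannian_metric A h" and c: "is_chart \<psi>" and z: "z \<in> cod_of \<phi> \<times> cod_of \<psi>"
  shows "pullback_metric A fst h (prod_chart \<phi> \<psi>) z u v = h \<phi> (fst z) (fst u) (fst v)"
proof -
  obtain x y where z': "z = (x, y)" "x \<in> cod_of \<phi>" "y \<in> cod_of \<psi>" using z by auto
  note c1 = smooth_atlasD(1)[OF A]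
  have pt: "fst (point (prod_chart \<phi> \<psi>) z) = point \<phi> x" using point_prod_chart[OF c1 c] z' by simp
  define \<eta> where "\<eta> = (SOME \<eta>. \<eta> \<in> A \<and> fst (point (prod_chart \<phi> \<psi>) z) \<in> dom_of \<eta>)"
  have "\<eta> \<in> A \<and> fst (point (prod_chart \<phi> \<psi>) z) \<in> dom_of \<eta>"
    unfolding \<eta>_def by (rule someI[of _ \<phi>]) (use A(2) is_chartD(7)[OF c1 z'(2)] pt in simp)
  then have \<eta>: "\<eta> \<in> A" "x \<in> overlap \<phi> \<eta>" using pt z'(2) by (simp_all add: overlap_iff[OF c1])
  show ?thesis
    unfolding pullback_metric_def Let_def \<eta>_def[symmetric]
    using differential_fst[OF A \<eta>(1) c \<eta>(2) z'(3)] riemannian_metricD(3)[OF h A(2) \<eta>] by (simp add: z')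
qed

lemma pullback_snd:
  assumes A: "smooth_atlas A" "\<psi> \<in> A" and h: "riemannian_metric A h" and c: "is_chart \<phi>" and z: "z \<in> cod_of \<phi> \<times> cod_of \<psi>"
  shows "pullback_metric A snd h (prod_chart \<phi> \<psi>) z u v = h \<psi> (snd z) (snd u) (snd v)"
proof -
  obtain x y where z': "z = (x, y)" "x \<in> cod_of \<phi>" "y \<in> cod_of \<psi>" using z by auto
  note c1 = smooth_atlasD(1)[OF A]
  have pt: "snd (point (prod_chart \<phi> \<psi>) z) = point \<psi> y" using point_prod_chart[OF c c1] z' by simp
  define \<eta> where "\<eta> = (SOME \<eta>. \<eta> \<in> A \<and> snd (point (prod_chart \<phi> \<psi>) z) \<in> dom_of \<eta>)"
  have "\<eta> \<in> A \<and> snd (point (prod_chart \<phi> \<psi>) z) \<in> dom_of \<eta>"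
    unfolding \<eta>_def by (rule someI[of _ \<psi>]) (use A(2) is_chartD(7)[OF c1 z'(3)] pt in simp)
  then have \<eta>: "\<eta> \<in> A" "y \<in> overlap \<psi> \<eta>" using pt z'(3) by (simp_all add: overlap_iff[OF c1])
  show ?thesis
    unfolding pullback_metric_def Let_def \<eta>_def[symmetric]
    using differential_snd[OF A \<eta>(1) c z'(2) \<eta>(2)] riemannian_metricD(3)[OF h A(2) \<eta>] by (simp add: z')
qed

text \<open>By orthogonality TM1 is horizontal for the first projection, and in a product chart the
  differential is the identity on it. So g restricted to TM1 is pointwise proportional to g1, and
  \<open>conformal_factor_exists\<close> makes the factor a smooth function on M; likewise for TM2
  and g2.\<close>

lemma conformal_product_diagonal:
  fixes A1 :: "('a::topological_space, 'e::euclidean_space) chart set" and A2 :: "('b::topological_space, 'f::euclidean_space) chart set"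
  assumes A: "smooth_atlas A1" "smooth_atlas A2" and cps: "conformal_product_structure A1 c1 A2 c2 c"
    and g: "g \<in> c" "riemannian_metric (prod_atlas A1 A2) g"
    and g1: "g1 \<in> c1" "riemannian_metric A1 g1" and g2: "g2 \<in> c2" "riemannian_metric A2 g2"
  shows "\<exists>F1 F2. smooth_fun (prod_atlas A1 A2) F1 \<and> smooth_fun (prod_atlas A1 A2) F2 \<and>
    (\<forall>\<phi>\<in>A1. \<forall>\<psi>\<in>A2. \<forall>z\<in>cod_of \<phi> \<times> cod_of \<psi>. \<forall>u v. g (prod_chart \<phi> \<psi>) z u v =
      exp (2 * local2 F1 \<phi> \<psi> z) * g1 \<phi> (fst z) (fst u) (fst v) + exp (2 * local2 F2 \<phi> \<psi> z) * g2 \<psi> (snd z) (snd u) (snd v))"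
proof -
  let ?A = "prod_atlas A1 A2"
  define ch where "ch = (\<lambda>i :: ('a, 'e) chart \<times> ('b, 'f) chart. prod_chart (fst i) (snd i))"
  define J where "J = A1 \<times> A2"
  have chJ: "ch ` J = ?A"
  proof
    show "ch ` J \<subseteq> ?A"
      by (rule image_subsetI) (unfold mem_prod_atlas ch_def J_def mem_Times_iff, blast)
    show "?A \<subseteq> ch ` J"
    proof
      fix P assume "P \<in> ?A"
      then obtain \<phi> \<psi> where "\<phi> \<in> A1" "\<psi> \<in> A2" "P = prod_chart \<phi> \<psi>" unfolding mem_prod_atlas by blast
      then show "P \<in> ch ` J" by (intro image_eqI[of _ _ "(\<phi>, \<psi>)"]) (simp_all add: ch_def J_def)
    qed
  qed
  note sA = smooth_atlas_prod[OF A]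
  have cs: "conformal_submersion ?A c A1 c1 fst" "conformal_submersion ?A c A2 c2 snd"
    using cps unfolding conformal_product_structure_def by blast+
  have J: "fst i \<in> A1" "snd i \<in> A2" "is_chart (fst i)" "is_chart (snd i)" "ch i \<in> ?A" if "i \<in> J" for i
    using that smooth_atlasD(1)[OF A(1), of "fst i"] smooth_atlasD(1)[OF A(2), of "snd i"] chJ by (auto simp: J_def mem_Times_iff)
  have orth: "g (ch i) z (u, 0) (0, w) = 0" if i: "i \<in> J" "z \<in> cod_of (ch i)" for i z u w
  proof -
    have "(u, 0) \<in> TM1 A2 (ch i) z" "(0, w) \<in> TM2 A1 (ch i) z"
      using TM1_eq[OF A(1) J(1)[OF i(1)] A(2) J(2)[OF i(1)]] TM2_eq[OF A(1) J(1)[OF i(1)] A(2) J(2)[OF i(1)]] i(2) by (simp_all add: ch_def)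
    then show ?thesis using cps g(1) J(5)[OF i(1)] i(2) unfolding conformal_product_structure_def by blast
  qed
  have inner: "inner_form (g (ch i) z)" if "i \<in> J" "z \<in> cod_of (ch i)" for i z
    by (rule riemannian_metricD(1)[OF g(2) J(5)[OF that(1)] that(2)])
  have orth': "g (ch i) z (0, w) (u, 0) = 0" if "i \<in> J" "z \<in> cod_of (ch i)" for i z u w
    using orth[OF that] inner[OF that] unfolding inner_form_def by metis
  have smg: "smooth_on (cod_of (ch i)) (\<lambda>z. g (ch i) z u v)" if "i \<in> J" for i u v
    by (rule riemannian_metricD(2)[OF g(2) J(5)[OF that]])
  have tr: "g (ch i) x u v = g (ch j) (transition (ch i) (ch j) x) (Dtransition (fst i) (fst j) (fst x) (fst u), Dtransition (snd i) (snd j) (snd x) (snd u))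
      (Dtransition (fst i) (fst j) (fst x) (fst v), Dtransition (snd i) (snd j) (snd x) (snd v))"
    and tr1: "fst x \<in> overlap (fst i) (fst j)" "snd x \<in> overlap (snd i) (snd j)"
      "fst (transition (ch i) (ch j) x) = transition (fst i) (fst j) (fst x)" "snd (transition (ch i) (ch j) x) = transition (snd i) (snd j) (snd x)"
    if h: "i \<in> J" "j \<in> J" "x \<in> overlap (ch i) (ch j)" for i j x u v
  proof -
    have "x \<in> overlap (fst i) (fst j) \<times> overlap (snd i) (snd j)" using h(3) by (simp add: ch_def overlap_prod)
    then show o: "fst x \<in> overlap (fst i) (fst j)" "snd x \<in> overlap (snd i) (snd j)" by auto
    have "x \<in> cod_of (fst i) \<times> cod_of (snd i)"
      using o by (simp add: overlap_iff[OF J(3)[OF h(1)]] overlap_iff[OF J(4)[OF h(1)]] mem_Times_iff)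
    then show "fst (transition (ch i) (ch j) x) = transition (fst i) (fst j) (fst x)" "snd (transition (ch i) (ch j) x) = transition (snd i) (snd j) (snd x)"
      using transition_prod[OF J(3)[OF h(1)] J(4)[OF h(1)], of x "fst j" "snd j"] by (simp_all add: ch_def)
    have "Dtransition (ch i) (ch j) x u = (Dtransition (fst i) (fst j) (fst x) (fst u), Dtransition (snd i) (snd j) (snd x) (snd u))" for u
      using Dtransition_prod[OF A(1) J(1)[OF h(1)] J(1)[OF h(2)] A(2) J(2)[OF h(1)] J(2)[OF h(2)] o, of u] by (simp add: ch_def)
    then show "g (ch i) x u v = g (ch j) (transition (ch i) (ch j) x) (Dtransition (fst i) (fst j) (fst x) (fst u), Dtransition (snd i) (snd j) (snd x) (snd u))
      (Dtransition (fst i) (fst j) (fst x) (fst v), Dtransition (snd i) (snd j) (snd x) (snd v))"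
      using riemannian_metricD(3)[OF g(2) J(5)[OF h(1)] J(5)[OF h(2)] h(3), of u v] by simp
  qed
  have "\<exists>F. smooth_fun (ch ` J) F \<and> (\<forall>i\<in>J. \<forall>x\<in>cod_of (ch i). \<forall>u v. g (ch i) x (u, 0) (v, 0) = exp (2 * F (point (ch i) x)) * g1 (fst i) (fst x) u v)"
  proof (rule conformal_factor_exists)
    show "smooth_atlas (ch ` J)" using sA chJ by simp
    fix i z assume i: "i \<in> J" and z: "z \<in> cod_of (ch i)"
    have zz: "z \<in> cod_of (fst i) \<times> cod_of (snd i)" using z by (simp add: ch_def)
    have o: "fst z \<in> overlap (fst i) (fst i)" using zz is_chartD(7)[OF J(3)[OF i]] by (auto simp: overlap_iff[OF J(3)[OF i]])
    have pt: "fst (point (ch i) z) \<in> dom_of (fst i)"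
      using point_prod_chart[OF J(3,4)[OF i], of "fst z" "snd z"] zz is_chartD(7)[OF J(3)[OF i]] by (auto simp: ch_def)
    obtain \<rho> where \<rho>: "\<rho> > 0" "\<And>u v. (\<forall>k\<in>TM2 A1 (ch i) z. g (ch i) z u k = 0) \<Longrightarrow> (\<forall>k\<in>TM2 A1 (ch i) z. g (ch i) z v k = 0) \<Longrightarrow>
        g1 (fst i) (local_rep fst (ch i) (fst i) z) (differential fst (ch i) (fst i) z u) (differential fst (ch i) (fst i) z v) = \<rho> * g (ch i) z u v"
      using cs(1)[unfolded conformal_submersion_def, THEN conjunct2, rule_format, OF g(1) g1(1) J(5)[OF i] z J(1)[OF i] pt] by blast
    \<comment> \<open>The submersion condition speaks of vectors orthogonal to the kernel, which is
      TM2 for the first projection.\<close>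
    have perp: "\<forall>k\<in>TM2 A1 (ch i) z. g (ch i) z (u, 0) k = 0" for u
    proof
      fix k assume "k \<in> TM2 A1 (ch i) z"
      then have "fst k = 0" using TM2_eq[OF A(1) J(1)[OF i] A(2) J(2)[OF i] zz] by (simp add: ch_def)
      then have "k = (0, snd k)" by (simp add: prod_eq_iff)
      then show "g (ch i) z (u, 0) k = 0" using orth[OF i z, of u "snd k"] by simp
    qed
    have "g1 (fst i) (fst z) u v = \<rho> * g (ch i) z (u, 0) (v, 0)" for u v
      using \<rho>(2)[OF perp perp, of u v] differential_fst[OF A(1) J(1)[OF i] J(1)[OF i] J(4)[OF i] o, of "snd z"] zz
        Dtransition_same[OF J(3)[OF i]] is_chartD(8)[OF J(3)[OF i]]
      by (simp add: ch_def transition_eq mem_Times_iff)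
    then show "\<exists>\<rho>>0. \<forall>u v. g (ch i) z (u, 0) (v, 0) = \<rho> * g1 (fst i) (fst z) u v"
      using \<rho>(1) by (intro exI[of _ "1 / \<rho>"]) simp
    show "u \<noteq> 0 \<Longrightarrow> g1 (fst i) (fst z) u u > 0" for u
      using riemannian_metricD(1)[OF g1(2) J(1)[OF i], of "fst z"] zz by (auto simp: inner_form_def)
  next
    fix i j x assume h: "i \<in> J" "j \<in> J" "x \<in> overlap (ch i) (ch j)"
    have l0: "Dtransition (snd i) (snd j) (snd x) 0 = 0" by (rule linear_0[OF linear_Dtransition[OF A(2) J(2)[OF h(1)] J(2)[OF h(2)] tr1(2)[OF h]]])
    show "\<exists>T. \<forall>u v. g (ch i) x (u, 0) (v, 0) = g (ch j) (transition (ch i) (ch j) x) (T u, 0) (T v, 0) \<and>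
       g1 (fst i) (fst x) u v = g1 (fst j) (fst (transition (ch i) (ch j) x)) (T u) (T v)"
      by (rule exI[of _ "Dtransition (fst i) (fst j) (fst x)"])
        (use tr[OF h] l0 riemannian_metricD(3)[OF g1(2) J(1)[OF h(1)] J(1)[OF h(2)] tr1(1)[OF h]] tr1(3)[OF h] in simp)
  next
    fix i u v assume i: "i \<in> J"
    show "smooth_on (cod_of (ch i)) (\<lambda>x. g (ch i) x (u, 0) (v, 0))" by (rule smg[OF i])
    show "smooth_on (cod_of (ch i)) (\<lambda>x. g1 (fst i) (fst x) u v)"
      unfolding ch_def cod_prod_chart
      by (rule smooth_on_fst[OF is_chartD(2)[OF J(3)[OF i]] is_chartD(2)[OF J(4)[OF i]] riemannian_metricD(2)[OF g1(2) J(1)[OF i]]])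
  qed
  then obtain F1 where F1: "smooth_fun ?A F1"
    "\<And>i x u v. i \<in> J \<Longrightarrow> x \<in> cod_of (ch i) \<Longrightarrow> g (ch i) x (u, 0) (v, 0) = exp (2 * F1 (point (ch i) x)) * g1 (fst i) (fst x) u v"
    unfolding chJ by blast
  have "\<exists>F. smooth_fun (ch ` J) F \<and> (\<forall>i\<in>J. \<forall>x\<in>cod_of (ch i). \<forall>u v. g (ch i) x (0, u) (0, v) = exp (2 * F (point (ch i) x)) * g2 (snd i) (snd x) u v)"
  proof (rule conformal_factor_exists)
    show "smooth_atlas (ch ` J)" using sA chJ by simp
    fix i z assume i: "i \<in> J" and z: "z \<in> cod_of (ch i)"
    have zz: "z \<in> cod_of (fst i) \<times> cod_of (snd i)" using z by (simp add: ch_def)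
    have o: "snd z \<in> overlap (snd i) (snd i)" using zz is_chartD(7)[OF J(4)[OF i]] by (auto simp: overlap_iff[OF J(4)[OF i]])
    have pt: "snd (point (ch i) z) \<in> dom_of (snd i)"
      using point_prod_chart[OF J(3,4)[OF i], of "fst z" "snd z"] zz is_chartD(7)[OF J(4)[OF i]] by (auto simp: ch_def)
    obtain \<rho> where \<rho>: "\<rho> > 0" "\<And>u v. (\<forall>k\<in>TM1 A2 (ch i) z. g (ch i) z u k = 0) \<Longrightarrow> (\<forall>k\<in>TM1 A2 (ch i) z. g (ch i) z v k = 0) \<Longrightarrow>
        g2 (snd i) (local_rep snd (ch i) (snd i) z) (differential snd (ch i) (snd i) z u) (differential snd (ch i) (snd i) z v) = \<rho> * g (ch i) z u v"
      using cs(2)[unfolded conformal_submersion_def, THEN conjunct2, rule_format, OF g(1) g2(1) J(5)[OF i] z J(2)[OF i] pt] by blast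
    have perp: "\<forall>k\<in>TM1 A2 (ch i) z. g (ch i) z (0, u) k = 0" for u
    proof
      fix k assume "k \<in> TM1 A2 (ch i) z"
      then have "snd k = 0" using TM1_eq[OF A(1) J(1)[OF i] A(2) J(2)[OF i] zz] by (simp add: ch_def)
      then have "k = (fst k, 0)" by (simp add: prod_eq_iff)
      then show "g (ch i) z (0, u) k = 0" using orth'[OF i z, of u "fst k"] by simp
    qed
    have "g2 (snd i) (snd z) u v = \<rho> * g (ch i) z (0, u) (0, v)" for u v
      using \<rho>(2)[OF perp perp, of u v] differential_snd[OF A(2) J(2)[OF i] J(2)[OF i] J(3)[OF i] _ o, of "fst z"] zz
        Dtransition_same[OF J(4)[OF i]] is_chartD(8)[OF J(4)[OF i]]
      by (simp add: ch_def transition_eq mem_Times_iff)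
    then show "\<exists>\<rho>>0. \<forall>u v. g (ch i) z (0, u) (0, v) = \<rho> * g2 (snd i) (snd z) u v"
      using \<rho>(1) by (intro exI[of _ "1 / \<rho>"]) simp
    show "u \<noteq> 0 \<Longrightarrow> g2 (snd i) (snd z) u u > 0" for u
      using riemannian_metricD(1)[OF g2(2) J(2)[OF i], of "snd z"] zz by (auto simp: inner_form_def)
  next
    fix i j x assume h: "i \<in> J" "j \<in> J" "x \<in> overlap (ch i) (ch j)"
    have l0: "Dtransition (fst i) (fst j) (fst x) 0 = 0" by (rule linear_0[OF linear_Dtransition[OF A(1) J(1)[OF h(1)] J(1)[OF h(2)] tr1(1)[OF h]]])
    show "\<exists>T. \<forall>u v. g (ch i) x (0, u) (0, v) = g (ch j) (transition (ch i) (ch j) x) (0, T u) (0, T v) \<and>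
       g2 (snd i) (snd x) u v = g2 (snd j) (snd (transition (ch i) (ch j) x)) (T u) (T v)"
      by (rule exI[of _ "Dtransition (snd i) (snd j) (snd x)"])
        (use tr[OF h] l0 riemannian_metricD(3)[OF g2(2) J(2)[OF h(1)] J(2)[OF h(2)] tr1(2)[OF h]] tr1(4)[OF h] in simp)
  next
    fix i u v assume i: "i \<in> J"
    show "smooth_on (cod_of (ch i)) (\<lambda>x. g (ch i) x (0, u) (0, v))" by (rule smg[OF i])
    show "smooth_on (cod_of (ch i)) (\<lambda>x. g2 (snd i) (snd x) u v)"
      unfolding ch_def cod_prod_chart
      by (rule smooth_on_snd[OF is_chartD(2)[OF J(3)[OF i]] is_chartD(2)[OF J(4)[OF i]] riemannian_metricD(2)[OF g2(2) J(2)[OF i]]])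
  qed
  then obtain F2 where F2: "smooth_fun ?A F2"
    "\<And>i x u v. i \<in> J \<Longrightarrow> x \<in> cod_of (ch i) \<Longrightarrow> g (ch i) x (0, u) (0, v) = exp (2 * F2 (point (ch i) x)) * g2 (snd i) (snd x) u v"
    unfolding chJ by blast
  have "g (prod_chart \<phi> \<psi>) z u v =
      exp (2 * local2 F1 \<phi> \<psi> z) * g1 \<phi> (fst z) (fst u) (fst v) + exp (2 * local2 F2 \<phi> \<psi> z) * g2 \<psi> (snd z) (snd u) (snd v)"
    if \<phi>: "\<phi> \<in> A1" "\<psi> \<in> A2" and z: "z \<in> cod_of \<phi> \<times> cod_of \<psi>" for \<phi> \<psi> z u v
  proof -
    have i: "(\<phi>, \<psi>) \<in> J" "z \<in> cod_of (ch (\<phi>, \<psi>))" using \<phi> z by (auto simp: J_def ch_def)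
    have bl: "bilinear (g (ch (\<phi>, \<psi>)) z)" using inner[OF i] by (simp add: inner_form_def)
    have pt: "point (ch (\<phi>, \<psi>)) z = (point \<phi> (fst z), point \<psi> (snd z))"
      using point_prod_chart[OF J(3,4)[OF i(1)], of "fst z" "snd z"] z by (auto simp: ch_def)
    have "g (ch (\<phi>, \<psi>)) z u v = g (ch (\<phi>, \<psi>)) z ((fst u, 0) + (0, snd u)) ((fst v, 0) + (0, snd v))" by simp
    also have "\<dots> = g (ch (\<phi>, \<psi>)) z (fst u, 0) (fst v, 0) + g (ch (\<phi>, \<psi>)) z (0, snd u) (0, snd v)"
      by (simp only: bilinear_ladd[OF bl] bilinear_radd[OF bl] orth[OF i] orth'[OF i] add_0_left add_0_right)
    finally show ?thesis unfolding F1(2)[OF i] F2(2)[OF i] pt by (simp add: ch_def)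
  qed
  then show ?thesis using F1(1) F2(1) by blast
qed

text \<open>For a constant field u of TM1 and w in TM2 the derivative of u along w vanishes, so the
  Weyl condition says that w(g(u, u)) is -2 \<theta>(w) g(u, u); differentiating e^(2 F) g1(u, u)
  gives 2 dF(w) g(u, u).\<close>

lemma lee_form_restricted:
  fixes A1 :: "('a::topological_space, 'e::euclidean_space) chart set" and A2 :: "('b::topological_space, 'f::euclidean_space) chart set"
  assumes A: "smooth_atlas A1" "smooth_atlas A2" and ad: "adapted_weyl_connection A1 A2 c \<Gamma>"
    and g: "riemannian_metric (prod_atlas A1 A2) g" and g1: "riemannian_metric A1 g1" and F: "smooth_fun (prod_atlas A1 A2) F"
    and g_eq: "\<And>\<phi> \<psi> z u v. \<phi> \<in> A1 \<Longrightarrow> \<psi> \<in> A2 \<Longrightarrow> z \<in> cod_of \<phi> \<times> cod_of \<psi> \<Longrightarrow>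
      g (prod_chart \<phi> \<psi>) z (u, 0) (v, 0) = exp (2 * local2 F \<phi> \<psi> z) * g1 \<phi> (fst z) u v"
    and lee: "lee_form (prod_atlas A1 A2) \<Gamma> g \<theta>" and \<phi>: "\<phi> \<in> A1" "\<psi> \<in> A2" and z: "z \<in> cod_of \<phi> \<times> cod_of \<psi>"
  shows "\<theta> (prod_chart \<phi> \<psi>) z (0, w) = - dd (local2 F \<phi> \<psi>) z (0, w)"
proof -
  let ?P = "prod_chart \<phi> \<psi>"
  have P: "?P \<in> prod_atlas A1 A2" using \<phi> unfolding mem_prod_atlas by blast
  have zP: "z \<in> cod_of ?P" using z by simp
  note c = is_chartD[OF smooth_atlasD(1)[OF A(1) \<phi>(1)]] is_chartD[OF smooth_atlasD(1)[OF A(2) \<phi>(2)]]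
  have o: "open (cod_of \<phi> \<times> cod_of \<psi>)" by (intro open_Times c)
  have xz: "fst z \<in> cod_of \<phi>" using z by auto
  obtain u :: 'e where "u \<in> Basis" using nonempty_Basis by blast
  then have u: "u \<noteq> 0" by auto
  have pos: "g1 \<phi> (fst z) u u > 0" using riemannian_metricD(1)[OF g1 \<phi>(1) xz] u by (simp add: inner_form_def)
  have bl: "bilinear (g ?P z)" using riemannian_metricD(1)[OF g P zP] by (simp add: inner_form_def)
  have lin: "linear (dd (\<lambda>x. g1 \<phi> x u u) (fst z))" by (rule smooth_on_linear_dd[OF riemannian_metricD(2)[OF g1 \<phi>(1)] xz])
  have h: "((\<lambda>z. exp (2 * local2 F \<phi> \<psi> z) * g1 \<phi> (fst z) u u) has_derivative
     (\<lambda>h. exp (2 * local2 F \<phi> \<psi> z) * dd (\<lambda>x. g1 \<phi> x u u) (fst z) (fst h) +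
       (exp (2 * local2 F \<phi> \<psi> z) * (2 * dd (local2 F \<phi> \<psi>) z h)) * g1 \<phi> (fst z) u u)) (at z)"
    by (rule derivative_eq_intros smooth_on_has_derivative[OF smooth_on_local2[OF A(1) \<phi>(1) A(2) \<phi>(2) F] z]
        has_derivative_compose[OF has_derivative_fst[OF has_derivative_ident] smooth_on_has_derivative[OF riemannian_metricD(2)[OF g1 \<phi>(1)] xz]] refl)+
      (simp add: algebra_simps)
  have "frechet_derivative (\<lambda>z. g ?P z (u, 0) (u, 0)) (at z) = frechet_derivative (\<lambda>z. exp (2 * local2 F \<phi> \<psi> z) * g1 \<phi> (fst z) u u) (at z)"
    by (rule dd_cong[OF o z]) (rule g_eq[OF \<phi>])
  from fun_cong[OF trans[OF this dd_eqI[OF h]], of "(0, w)"]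
  have d: "dd (\<lambda>z. g ?P z (u, 0) (u, 0)) z (0, w) = 2 * dd (local2 F \<phi> \<psi>) z (0, w) * (exp (2 * local2 F \<phi> \<psi> z) * g1 \<phi> (fst z) u u)"
    using linear_0[OF lin] by simp
  have "nabla_metric \<Gamma> g ?P z (0, w) (u, 0) (u, 0) = - 2 * \<theta> ?P z (0, w) * g ?P z (u, 0) (u, 0)"
    using lee P zP unfolding lee_form_def by blast
  then have "2 * dd (local2 F \<phi> \<psi>) z (0, w) * g ?P z (u, 0) (u, 0) = - 2 * \<theta> ?P z (0, w) * g ?P z (u, 0) (u, 0)"
    unfolding nabla_metric_def adapted_mixed_zero(2)[OF A ad \<phi> z] bilinear_lzero[OF bl] bilinear_rzero[OF bl] d g_eq[OF \<phi> z] by simp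
  moreover have "g ?P z (u, 0) (u, 0) \<noteq> 0" using pos g_eq[OF \<phi> z, of u u] by simp
  moreover from calculation have "(dd (local2 F \<phi> \<psi>) z (0, w) + \<theta> ?P z (0, w)) * g ?P z (u, 0) (u, 0) = 0"
    by (simp add: algebra_simps)
  ultimately show ?thesis by simp
qed

text \<open>On constant fields the covariant derivative of \<theta>2 along TM1 is the plain
  derivative of \<theta>2(w), and \<theta>2(w) = - dF(w) by
  \<open>lee_form_restricted\<close>.\<close>

lemma first_factor_splits:
  fixes A1 :: "('a::topological_space, 'e::euclidean_space) chart set" and A2 :: "('b::topological_space, 'f::euclidean_space) chart set"
  assumes A: "smooth_atlas A1" "smooth_atlas A2" "connected (UNIV :: 'a set)" "connected (UNIV :: 'b set)"
    and ad: "adapted_weyl_connection A1 A2 c \<Gamma>"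
    and g: "riemannian_metric (prod_atlas A1 A2) g" and g1: "riemannian_metric A1 g1" and F: "smooth_fun (prod_atlas A1 A2) F"
    and g_eq: "\<And>\<phi> \<psi> z u v. \<phi> \<in> A1 \<Longrightarrow> \<psi> \<in> A2 \<Longrightarrow> z \<in> cod_of \<phi> \<times> cod_of \<psi> \<Longrightarrow>
      g (prod_chart \<phi> \<psi>) z (u, 0) (v, 0) = exp (2 * local2 F \<phi> \<psi> z) * g1 \<phi> (fst z) u v"
    and lee: "lee_form (prod_atlas A1 A2) \<Gamma> g \<theta>" and res: "restriction_TM2 A1 A2 \<theta> \<theta>2"
    and par: "parallel_in_direction (prod_atlas A1 A2) \<Gamma> (TM1 A2) \<theta>2"
  shows "splits F"
proof (rule splits_if_mixed_zero[OF A F])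
  fix \<phi> \<psi> z u w assume \<phi>: "\<phi> \<in> A1" "\<psi> \<in> A2" and z: "z \<in> cod_of \<phi> \<times> cod_of \<psi>"
  let ?P = "prod_chart \<phi> \<psi>" and ?F = "local2 F \<phi> \<psi>"
  have P: "?P \<in> prod_atlas A1 A2" using \<phi> unfolding mem_prod_atlas by blast
  have o: "open (cod_of \<phi> \<times> cod_of \<psi>)" by (intro open_Times is_chartD(2) smooth_atlasD(1)[OF A(1)] smooth_atlasD(1)[OF A(2)] \<phi>)
  have \<theta>2: "\<theta>2 ?P z' (0, w) = - dd ?F z' (0, w)" if z': "z' \<in> cod_of \<phi> \<times> cod_of \<psi>" for z'
  proof -
    have "(0, w) \<in> TM2 A1 ?P z'" using TM2_eq[OF A(1) \<phi>(1) A(2) \<phi>(2) z'] by simp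
    then have "\<theta>2 ?P z' (0, w) = \<theta> ?P z' (0, w)" using res P z' unfolding restriction_TM2_def by simp
    then show ?thesis using lee_form_restricted[OF A(1,2) ad g g1 F g_eq lee \<phi> z'] by simp
  qed
  have "linear (\<theta>2 ?P z)" using res P z unfolding restriction_TM2_def one_form_def by simp
  then have "\<theta>2 ?P z (\<Gamma> ?P z (u, 0) (0, w)) = 0" unfolding adapted_mixed_zero(1)[OF A(1,2) ad \<phi> z] by (rule linear_0)
  moreover have "(u, 0) \<in> TM1 A2 ?P z" using TM1_eq[OF A(1) \<phi>(1) A(2) \<phi>(2) z] by simp
  then have "nabla_form \<Gamma> \<theta>2 ?P z (u, 0) (0, w) = 0" using par P z unfolding parallel_in_direction_def by simp
  ultimately have "dd (\<lambda>z. \<theta>2 ?P z (0, w)) z (u, 0) = 0" by (simp add: nabla_form_def)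
  moreover have "frechet_derivative (\<lambda>z. \<theta>2 ?P z (0, w)) (at z) = frechet_derivative (\<lambda>z. - dd ?F z (0, w)) (at z)"
    by (rule dd_cong[OF o z \<theta>2])
  moreover have sm: "smooth_on (cod_of \<phi> \<times> cod_of \<psi>) ?F" by (rule smooth_on_local2[OF A(1) \<phi>(1) A(2) \<phi>(2) F])
  ultimately have "dd (\<lambda>z. dd ?F z (0, w)) z (u, 0) = 0"
    by (simp add: dd_eqI[OF has_derivative_minus[OF smooth_on_has_derivative[OF smooth_on_dd[OF sm] z]]])
  then show "dd (\<lambda>z. dd ?F z (u, 0)) z (0, w) = 0" using smooth_on_symmetric[OF o sm z] by simp
qed

theorem theorem1p1:
  fixes A1 :: "('a::{t2_space, second_countable_topology}, 'e::euclidean_space) chart set"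
    and A2 :: "('b::{t2_space, second_countable_topology}, 'f::euclidean_space) chart set"
    and c1 :: "('a, 'e) metric_field set"
    and c2 :: "('b, 'f) metric_field set"
    and c :: "('a \<times> 'b, 'e \<times> 'f) metric_field set"
    and g :: "('a \<times> 'b, 'e \<times> 'f) metric_field"
    and nabla :: "('a \<times> 'b, 'e \<times> 'f) connection_field"
    and \<theta> \<theta>2 :: "('a \<times> 'b, 'e \<times> 'f) form_field"
  assumes "compact_manifold A1" and "compact_manifold A2"
    and "conformal_class A1 c1" and "conformal_class A2 c2"
    and "DIM('e \<times> 'f) \<ge> 3"
    and "conformal_product_structure A1 c1 A2 c2 c"
    and "adapted_weyl_connection A1 A2 c nabla"
    and "g \<in> c" and "einstein_metric (prod_atlas A1 A2) g"
    and "lee_form (prod_atlas A1 A2) nabla g \<theta>"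
    and "restriction_TM2 A1 A2 \<theta> \<theta>2"
    and "parallel_in_direction (prod_atlas A1 A2) nabla (TM1 A2) \<theta>2"
  shows "\<exists>h1\<in>c1. \<exists>h2\<in>c2. c = conf_class_of (prod_atlas A1 A2) (product_metric A1 A2 h1 h2)"
proof -
  let ?A = "prod_atlas A1 A2"
  have A: "smooth_atlas A1" "smooth_atlas A2" "connected (UNIV :: 'a set)" "connected (UNIV :: 'b set)"
    using assms(1,2) by (auto simp: compact_manifold_def smooth_manifold_def)
  note sA = smooth_atlas_prod[OF A(1,2)]
  obtain g1 where g1: "riemannian_metric A1 g1" "c1 = conf_class_of A1 g1" using assms(3) unfolding conformal_class_def by blast
  obtain g2 where g2: "riemannian_metric A2 g2" "c2 = conf_class_of A2 g2" using assms(4) unfolding conformal_class_def by blast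
  obtain g0 where g0: "c = conf_class_of ?A g0"
    using assms(6) unfolding conformal_product_structure_def conformal_class_def by blast
  have in_class: "(\<lambda>\<phi> x u v. exp (2 * k (point \<phi> x)) * h \<phi> x u v) \<in> conf_class_of B h"
    if "smooth_atlas B" "riemannian_metric B h" "smooth_fun B k"
    for B :: "('m::topological_space, 'h::euclidean_space) chart set" and h k
    using riemannian_metric_conformal[OF that] that(3) unfolding conf_class_of_def by blast
  have "g1 \<in> c1" "g2 \<in> c2"
    using in_class[OF A(1) g1(1) smooth_fun_const, of 0] in_class[OF A(2) g2(1) smooth_fun_const, of 0] g1(2) g2(2) by auto
  have rg: "riemannian_metric ?A g" using assms(8) g0 unfolding conf_class_of_def by blast
  obtain F1 F2 where F: "smooth_fun ?A F1" "smooth_fun ?A F2" and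
    g_eq: "\<And>\<phi> \<psi> z u v. \<phi> \<in> A1 \<Longrightarrow> \<psi> \<in> A2 \<Longrightarrow> z \<in> cod_of \<phi> \<times> cod_of \<psi> \<Longrightarrow> g (prod_chart \<phi> \<psi>) z u v =
      exp (2 * local2 F1 \<phi> \<psi> z) * g1 \<phi> (fst z) (fst u) (fst v) + exp (2 * local2 F2 \<phi> \<psi> z) * g2 \<psi> (snd z) (snd u) (snd v)"
    using conformal_product_diagonal[OF A(1,2) assms(6,8) rg \<open>g1 \<in> c1\<close> g1(1) \<open>g2 \<in> c2\<close> g2(1)] by blast
  have s1: "splits F1"
  proof (rule first_factor_splits[OF A assms(7) rg g1(1) F(1) _ assms(10-12)])
    fix \<phi> \<psi> z u v assume h: "\<phi> \<in> A1" "\<psi> \<in> A2" "z \<in> cod_of \<phi> \<times> cod_of \<psi>"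
    have "bilinear (g2 \<psi> (snd z))" using riemannian_metricD(1)[OF g2(1) h(2), of "snd z"] h(3) by (auto simp: inner_form_def)
    then show "g (prod_chart \<phi> \<psi>) z (u, 0) (v, 0) = exp (2 * local2 F1 \<phi> \<psi> z) * g1 \<phi> (fst z) u v"
      using g_eq[OF h, of "(u,0)" "(v,0)"] by (simp add: bilinear_lzero)
  qed
  \<comment> \<open>Arbitrary base points. Subtracting F1 (p0, q0) in \<open>b\<close> makes F1 the
    sum of \<open>a\<close> and \<open>b\<close> without a constant.\<close>
  define p0 :: 'a where "p0 = undefined"
  define q0 :: 'b where "q0 = undefined"
  define a where "a = (\<lambda>p. F1 (p, q0))"
  define b where "b = (\<lambda>q. F1 (p0, q) - F1 (p0, q0))"
  have sa: "smooth_fun A1 a" unfolding a_def by (rule smooth_fun_slices(1)[OF A(1,2) F(1)])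
  have sb: "smooth_fun A2 b" unfolding b_def
    by (intro smooth_fun_diff[OF A(2)] smooth_fun_slices(2)[OF A(1,2) F(1)] smooth_fun_const)
  have F1_eq: "F1 (p, q) = b q + a p" for p q
    using s1[unfolded splits_def, rule_format, of p q p0 q0] by (simp add: a_def b_def)
  obtain \<Gamma> lam where \<Gamma>: "levi_civita ?A g \<Gamma>" "\<And>P z u v. P \<in> ?A \<Longrightarrow> z \<in> cod_of P \<Longrightarrow> ricci \<Gamma> P z u v = lam * g P z u v"
    using assms(9) unfolding einstein_metric_def by blast
  \<comment> \<open>The first exponent is a + b, and the part e^(2 a) is absorbed into the first
    metric; F2 takes the role of f.\<close>
  have "einstein_warped A1 A2 (\<lambda>\<phi> x u v. exp (2 * a (point \<phi> x)) * g1 \<phi> x u v) g2 g b F2 \<Gamma> lam"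
  proof
    show "DIM('e) + DIM('f) \<ge> 3" using assms(5) by simp
    show "riemannian_metric A1 (\<lambda>\<phi> x u v. exp (2 * a (point \<phi> x)) * g1 \<phi> x u v)"
      by (rule riemannian_metric_conformal[OF A(1) g1(1) sa])
    fix \<phi> \<psi> z u v assume h: "\<phi> \<in> A1" "\<psi> \<in> A2" "z \<in> cod_of \<phi> \<times> cod_of \<psi>"
    show "g (prod_chart \<phi> \<psi>) z u v = exp (2 * b (point \<psi> (snd z))) * (exp (2 * a (point \<phi> (fst z))) * g1 \<phi> (fst z) (fst u) (fst v)) +
       exp (2 * local2 F2 \<phi> \<psi> z) * g2 \<psi> (snd z) (snd u) (snd v)"
      unfolding g_eq[OF h] F1_eq by (simp add: distrib_left exp_add)
  qed (use assms(1,2) g2(1) sb F(2) \<Gamma> in auto)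
  then have s2: "splits F2" by (rule einstein_warped.f_splits)
  \<comment> \<open>The goal is F1 = H + k1 and F2 = H + k2 with k1 on M1 and k2 on M2, so k must be
    k2 - k1. As k splits, its restrictions to the slices through the base points provide k1 and k2,
    and H is F1 - k1.\<close>
  define k where "k = (\<lambda>r. F2 r - F1 r)"
  have sk: "smooth_fun ?A k" unfolding k_def by (rule smooth_fun_diff[OF sA F(2,1)])
  have k_eq: "k (p, q) = k (p, q0) + (k (p0, q) - k (p0, q0))" for p q
    using s1[unfolded splits_def, rule_format, of p q p0 q0] s2[unfolded splits_def, rule_format, of p q p0 q0] by (simp add: k_def)
  define k1 where "k1 = (\<lambda>p. - k (p, q0))"
  define k2 where "k2 = (\<lambda>q. k (p0, q) - k (p0, q0))"
  have sk1: "smooth_fun A1 k1"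
    unfolding k1_def using smooth_fun_diff[OF A(1) smooth_fun_const[of _ 0] smooth_fun_slices(1)[OF A(1,2) sk]] by simp
  have sk2: "smooth_fun A2 k2" unfolding k2_def
    by (intro smooth_fun_diff[OF A(2)] smooth_fun_slices(2)[OF A(1,2) sk] smooth_fun_const)
  let ?h1 = "\<lambda>\<phi> x u v. exp (2 * k1 (point \<phi> x)) * g1 \<phi> x u v" and ?h2 = "\<lambda>\<psi> y u v. exp (2 * k2 (point \<psi> y)) * g2 \<psi> y u v"
  define H where "H = (\<lambda>r. F1 r - k1 (fst r))"
  have sH: "smooth_fun ?A H"
  proof -
    have "smooth_fun ?A (\<lambda>r. k1 (fst r))"
      by (rule smooth_fun_prodI[OF A(1,2)])
        (auto intro!: smooth_on_fst is_chartD(2) smooth_atlasD(1)[OF A(1)] smooth_atlasD(1)[OF A(2)] smooth_funD[OF sk1])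
    then show ?thesis unfolding H_def by (rule smooth_fun_diff[OF sA F(1)])
  qed
  have "conf_class_of ?A g = conf_class_of ?A (product_metric A1 A2 ?h1 ?h2)"
  proof (rule conf_class_eq[OF sA sH])
    fix P z u v assume P: "P \<in> ?A" and z: "z \<in> cod_of P"
    obtain \<phi> \<psi> where \<phi>: "P = prod_chart \<phi> \<psi>" "\<phi> \<in> A1" "\<psi> \<in> A2" using P unfolding mem_prod_atlas by blast
    have zz: "z \<in> cod_of \<phi> \<times> cod_of \<psi>" using z \<phi>(1) by simp
    note ch = smooth_atlasD(1)[OF A(1) \<phi>(2)] smooth_atlasD(1)[OF A(2) \<phi>(3)]
    have pt: "point P z = (point \<phi> (fst z), point \<psi> (snd z))"
      using point_prod_chart[OF ch, of "fst z" "snd z"] zz by (simp add: \<phi>(1) mem_Times_iff)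
    have pm: "product_metric A1 A2 ?h1 ?h2 P z u v = ?h1 \<phi> (fst z) (fst u) (fst v) + ?h2 \<psi> (snd z) (snd u) (snd v)"
      unfolding product_metric_def \<phi>(1)
        pullback_fst[OF A(1) \<phi>(2) riemannian_metric_conformal[OF A(1) g1(1) sk1] ch(2) zz]
        pullback_snd[OF A(2) \<phi>(3) riemannian_metric_conformal[OF A(2) g2(1) sk2] ch(1) zz] ..
    have F2_eq: "F2 (p, q) = H (p, q) + k2 q" for p q
      using k_eq[of p q] by (simp add: k_def H_def k1_def k2_def)
    have F1_eq': "F1 (p, q) = H (p, q) + k1 p" for p q by (simp add: H_def)
    show "g P z u v = exp (2 * H (point P z)) * product_metric A1 A2 ?h1 ?h2 P z u v"
      unfolding pm pt unfolding \<phi>(1) g_eq[OF \<phi>(2,3) zz] F1_eq' F2_eq by (simp add: distrib_left exp_add)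
  qed
  \<comment> \<open>The class c was given through g0; as g is in it, g generates the same
    class.\<close>
  moreover obtain k0 where "smooth_fun ?A k0"
    "\<And>P z u v. P \<in> ?A \<Longrightarrow> z \<in> cod_of P \<Longrightarrow> g P z u v = exp (2 * k0 (point P z)) * g0 P z u v"
    using assms(8) unfolding g0 conf_class_of_def by blast
  then have "conf_class_of ?A g = c" unfolding g0 by (rule conf_class_eq[OF sA])
  ultimately have "c = conf_class_of ?A (product_metric A1 A2 ?h1 ?h2)" by simp
  moreover have "?h1 \<in> c1" "?h2 \<in> c2"
    using in_class[OF A(1) g1(1) sk1] in_class[OF A(2) g2(1) sk2] g1(2) g2(2) by auto
  ultimately show ?thesis by blast
qed

end
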